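(* Let $\ell(\theta,x)$ be convex in $\theta$ and $R_P(\theta)=\mathbb{E}_P[\ell(\theta,X)]$. Let $\theta^i$ follow the noisy stochastic gradient iteration $$\theta^{i+1}=\theta^i-\eta_i\big(\nabla\ell(\theta^i,X_i)+\xi^i\big),\qquad \eta_i=\eta_0i^{-\beta},\ \beta\in(\tfrac12,1),\ \eta_0>0,$$ where $\xi^i$ is i.i.d. zero-mean noise, and assume that under $X_i\overset{iid}\sim P_0$, with $\theta_0=\operatorname{argmin}_\theta R_{P_0}(\theta)$, the iterates satisfy $$\frac{1}{\sqrt n}\sum_{i=1}^n(\theta^i-\theta_0)=-\frac{1}{\sqrt n}\sum_{i=1}^n\nabla^2R_{P_0}(\theta_0)^{-1}\big(\nabla\ell(\theta_0,X_i)+\xi^i\big)+o_P(1).$$ Let $\bar\theta^n=\frac1n\sum_{i=1}^n\theta^i$. Let $\{P_h\}_{h\in\mathbb{R}^d}\subset\mathcal{P}$ be a sub-model around $P_0$, quadratic mean differentiable at $P_0$ with score $g:\mathcal{X}\to\mathbb{R}^d$, for which the parameter $\theta_h=\operatorname{argmin}_{\theta\in\Theta}R_{P_h}(\theta)$ is regular. Let $$Z\sim\mathcal{N}\Big(0,\ \nabla^2R_{P_0}(\theta_0)^{-1}\big(\operatorname{Cov}_0(\nabla\ell(\theta_0,X))+\operatorname{Cov}(\xi)\big)\nabla^2R_{P_0}(\theta_0)^{-1}\Big).$$ Then for any bounded sequence $h_n\in\mathbb{R}^d$, $\sqrt n(\bar\theta^n-\theta_{h_n/\sqrt n})$ converges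 in distribution to $Z$ under $X_i\overset{iid}\sim P_{h_n/\sqrt n}$, and for any bounded continuous $L$ (with values in $\mathbb{R}_+$) and $c<\infty$, $$\lim_{n\to\infty}\ \sup_{\|h\|\le c/\sqrt n}\mathbb{E}_{P_h}\big[L(\sqrt n(\bar\theta^n-\theta_h))\big]=\mathbb{E}[L(Z)].$$
   Context: $\nabla$ and $\nabla^2$ are with respect to $\theta$; $\operatorname{Cov}_0$ is covariance under $P_0$; $\operatorname{Cov}(\xi)$ is the covariance of the noise $\xi^i$, which is independent of the data. The sub-model $\{P_h\}$ is quadratic mean differentiable at $P_0$ with score $g$ if $\int|dP_h^{1/2}-dP_0^{1/2}-\frac12h^Tg\,dP_0^{1/2}|^2=o(\|h\|^2)$ as $h\to0$. The parameter $\theta_h$ is regular if it has influence function $-\nabla^2R_{P_0}(\theta_0)^{-1}\nabla\ell(\theta_0,x)$, equivalently $$\theta_h=\theta_0-\nabla^2R_{P_0}(\theta_0)^{-1}\operatorname{Cov}_0(\nabla\ell(\theta_0,X),g(X))\,h+o(\|h\|)\quad\text{as }h\to0.$$ Under $P_h$, the data $X_i$ are i.i.d. $P_h$ and the noise has its own fixed distribution. *)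

theory Defs
  imports "HOL-Probability.Probability"
begin

definition grad :: "('a::real_inner \<Rightarrow> real) \<Rightarrow> 'a \<Rightarrow> 'a" where
  "grad f t = (THE D. GDERIV f t :> D)"

lemma grad_eqI:
  assumes "GDERIV f t :> D"
  shows "grad f t = D"
proof -
  have "D' = D" if "GDERIV f t :> D'" for D'
  proof -
    from assms that have "(\<lambda>h. inner h D') = (\<lambda>h. inner h D)"
      unfolding gderiv_def by (auto intro: has_derivative_unique)
    then have "inner h (D' - D) = 0" for h
      by (metis inner_diff_right right_minus_eq)
    then show ?thesis
      by (metis inner_eq_zero_iff right_minus_eq)
  qed
  with assms show ?thesis
    unfolding grad_def by blast
qed

definition hessian :: "(real ^ 'p \<Rightarrow> real) \<Rightarrow> real ^ 'p \<Rightarrow> real ^ 'p ^ 'p" where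
  "hessian f t = jacobian (grad f) (at t)"

definition twice_differentiable_at :: "(real ^ 'p \<Rightarrow> real) \<Rightarrow> real ^ 'p \<Rightarrow> bool" where
  "twice_differentiable_at f t \<longleftrightarrow>
     (\<forall>\<^sub>F s in nhds t. f differentiable (at s)) \<and> grad f differentiable (at t)"

definition risk :: "('t \<Rightarrow> 'x \<Rightarrow> real) \<Rightarrow> 'x measure \<Rightarrow> 't \<Rightarrow> real" where
  "risk loss P t = (\<integral>x. loss t x \<partial>P)"

definition cov_matrix ::
  "'x measure \<Rightarrow> ('x \<Rightarrow> real ^ 'p) \<Rightarrow> ('x \<Rightarrow> real ^ 'd) \<Rightarrow> real ^ 'd ^ 'p" where
  "cov_matrix M U V =
     (\<chi> i j. \<integral>x. (U x $ i - (\<integral>y. U y $ i \<partial>M)) * (V x $ j - (\<integral>y. V y $ j \<partial>M)) \<partial>M)"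

text \<open>The law \<open>\<N>(m, V)\<close> is given by its characteristic function, so that a singular
  covariance matrix \<open>V\<close> is allowed.\<close>

definition gaussian_law :: "real ^ 'p \<Rightarrow> real ^ 'p ^ 'p \<Rightarrow> (real ^ 'p) measure \<Rightarrow> bool" where
  "gaussian_law m V \<mu> \<longleftrightarrow>
     prob_space \<mu> \<and> sets \<mu> = sets borel \<and>
     (\<forall>t. (CLINT z|\<mu>. iexp (t \<bullet> z)) =
          iexp (t \<bullet> m) * complex_of_real (exp (- (t \<bullet> (V *v t)) / 2)))"

definition conv_in_prob_zero ::
  "'a measure \<Rightarrow> (nat \<Rightarrow> 'a \<Rightarrow> 'b::real_normed_vector) \<Rightarrow> bool" where
  "conv_in_prob_zero M Y \<longleftrightarrow>
     (\<forall>\<epsilon>>0. (\<lambda>n. measure M {\<omega> \<in> space M. norm (Y n \<omega>) > \<epsilon>}) \<longlonglongrightarrow> 0)"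

text \<open>The variable \<open>Y n\<close> lives on its own probability space \<open>M n\<close>.\<close>

definition conv_in_distribution ::
  "(nat \<Rightarrow> 'a measure) \<Rightarrow> (nat \<Rightarrow> 'a \<Rightarrow> 'b::topological_space) \<Rightarrow> 'z measure \<Rightarrow> ('z \<Rightarrow> 'b) \<Rightarrow> bool" where
  "conv_in_distribution M Y N Z \<longleftrightarrow>
     (\<forall>n. Y n \<in> borel_measurable (M n)) \<and> Z \<in> borel_measurable N \<and>
     (\<forall>f :: 'b \<Rightarrow> real. continuous_on UNIV f \<longrightarrow> bounded (range f) \<longrightarrow>
        (\<lambda>n. \<integral>\<omega>. f (Y n \<omega>) \<partial>M n) \<longlonglongrightarrow> (\<integral>z. f (Z z) \<partial>N))"

definition sum_measure :: "'x measure \<Rightarrow> 'x measure \<Rightarrow> 'x measure" where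
  "sum_measure M N = measure_of (space M) (sets M) (\<lambda>A. emeasure M A + emeasure N A)"

lemma space_sum_measure [simp]: "space (sum_measure M N) = space M"
  and sets_sum_measure [simp]: "sets (sum_measure M N) = sets M"
  unfolding sum_measure_def by simp_all

lemma emeasure_sum_measure:
  assumes "sets N = sets M" and "A \<in> sets M"
  shows "emeasure (sum_measure M N) A = emeasure M A + emeasure N A"
proof (rule emeasure_measure_of[OF sum_measure_def])
  show "countably_additive (sets (sum_measure M N)) (\<lambda>A. emeasure M A + emeasure N A)"
  proof (rule countably_additiveI)
    fix F :: "nat \<Rightarrow> _"
    assume F: "range F \<subseteq> sets (sum_measure M N)" "disjoint_family F"
    then have "range F \<subseteq> sets M" "range F \<subseteq> sets N"
      using assms by simp_all
    then show "(\<Sum>i. emeasure M (F i) + emeasure N (F i)) = emeasure M (\<Union>i. F i) + emeasure N (\<Union>i. F i)"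
      using F(2) by (simp add: suminf_add[symmetric] suminf_emeasure)
  qed
qed (use assms sets.space_closed in \<open>auto simp: positive_def\<close>)

definition sqrt_density :: "'x measure \<Rightarrow> 'x measure \<Rightarrow> 'x \<Rightarrow> real" where
  "sqrt_density \<mu> P x = sqrt (enn2real (RN_deriv \<mu> P x))"

text \<open>The integral in the definition does not depend on the choice of the measure dominating
  \<open>P h\<close> and \<open>P 0\<close>; their sum is used here. The family as a whole need not be dominated.
  As a value in \<open>[0, \<infinity>]\<close> the integral makes sense without integrability of the integrand.\<close>

definition qmd_remainder ::
  "(real ^ 'd \<Rightarrow> 'x measure) \<Rightarrow> ('x \<Rightarrow> real ^ 'd) \<Rightarrow> real ^ 'd \<Rightarrow> ennreal" where
  "qmd_remainder P g h =
     (let \<mu> = sum_measure (P 0) (P h) in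
      \<integral>\<^sup>+x. ennreal ((sqrt_density \<mu> (P h) x - sqrt_density \<mu> (P 0) x
                      - 1 / 2 * (h \<bullet> g x) * sqrt_density \<mu> (P 0) x)\<^sup>2) \<partial>\<mu>)"

definition qmd_at_zero :: "(real ^ 'd \<Rightarrow> 'x measure) \<Rightarrow> ('x \<Rightarrow> real ^ 'd) \<Rightarrow> bool" where
  "qmd_at_zero P g \<longleftrightarrow>
     g \<in> borel_measurable (P 0) \<and>
     ((\<lambda>h. qmd_remainder P g h / ennreal ((norm h)\<^sup>2)) \<longlongrightarrow> 0) (at 0)"

definition regular_parameter ::
  "(real ^ 'p \<Rightarrow> 'x \<Rightarrow> real) \<Rightarrow> (real ^ 'd \<Rightarrow> 'x measure) \<Rightarrow> ('x \<Rightarrow> real ^ 'd) \<Rightarrow>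
   (real ^ 'd \<Rightarrow> real ^ 'p) \<Rightarrow> bool" where
  "regular_parameter loss P g \<theta> \<longleftrightarrow>
     ((\<lambda>h. (\<theta> h - (\<theta> 0 - matrix_inv (hessian (risk loss (P 0)) (\<theta> 0)) *v
                     (cov_matrix (P 0) (\<lambda>x. grad (\<lambda>t. loss t x) (\<theta> 0)) g *v h))) /\<^sub>R norm h)
        \<longlongrightarrow> 0) (at 0)"

text \<open>A sample point \<open>(x, t, z)\<close> consists of the data sequence \<open>x\<close>, the initial iterate \<open>t\<close> and
  the noise sequence \<open>z\<close>, all independent; the coordinates \<open>x 0\<close> and \<open>z 0\<close> are not used.
  A deterministic initial iterate \<open>t\<close> corresponds to \<open>\<nu> = return borel t\<close>.\<close>

definition sampling ::
  "'x measure \<Rightarrow> 'b measure \<Rightarrow> 'c measure \<Rightarrow> ((nat \<Rightarrow> 'x) \<times> 'b \<times> (nat \<Rightarrow> 'c)) measure" where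
  "sampling P \<nu> Q =
     (\<Pi>\<^sub>M i\<in>(UNIV :: nat set). P) \<Otimes>\<^sub>M (\<nu> \<Otimes>\<^sub>M (\<Pi>\<^sub>M i\<in>(UNIV :: nat set). Q))"

definition iterate_mean :: "(nat \<Rightarrow> 'a \<Rightarrow> 'b::real_vector) \<Rightarrow> nat \<Rightarrow> 'a \<Rightarrow> 'b" where
  "iterate_mean T n \<omega> = (1 / real n) *\<^sub>R (\<Sum>i=1..n. T i \<omega>)"

end

theory Submission
  imports Defs
begin

text \<open>Write \<open>\<psi> x\<close> for the gradient of the loss at \<open>\<theta> 0\<close>, \<open>H\<close> for the Hessian of the risk there and \<open>k\<^sub>n\<close>
  for a parameter with \<open>\<surd>n \<parallel>k\<^sub>n\<parallel>\<close> bounded. Under \<open>P 0\<close> the averaged iterate satisfies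
  \<open>\<surd>n (\<theta>\<^sup>n - \<theta> 0) = S\<^sub>n + R\<^sub>n\<close>, where \<open>S\<^sub>n = - n\<^sup>-\<^sup>1\<^sup>/\<^sup>2 \<Sum> H\<^sup>-\<^sup>1 (\<psi> X\<^sub>i + \<xi>\<^sub>i)\<close> and \<open>R\<^sub>n\<close> vanishes in
  probability. Two things have to be moved from \<open>P 0\<close> to \<open>P k\<^sub>n\<close>: that \<open>R\<^sub>n\<close> vanishes, and the limit law
  of \<open>S\<^sub>n\<close>.

  For \<open>R\<^sub>n\<close> contiguity is enough. Quadratic mean differentiability makes the squared Hellinger distance
  of \<open>P k\<^sub>n\<close> and \<open>P 0\<close> of order \<open>1/n\<close>, and it makes the event that the root of the likelihood ratio
  exceeds 2 have \<open>P k\<^sub>n\<close>-probability \<open>o(1/n)\<close>. So none of \<open>n\<close> observations falls into that event, up to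
  a vanishing probability, and off it the likelihood ratio of one observation has second moment
  \<open>1 + O(1/n)\<close>, hence that of \<open>n\<close> observations has bounded second moment
  (\<open>contiguity_bound\<close>, \<open>contiguity\<close>, \<open>sampling_contiguity\<close>).

  For \<open>S\<^sub>n\<close> the characteristic function is computed directly, as the \<open>n\<close>-th power of that of a single
  summand. The latter is expanded to order \<open>o(1/n)\<close>: passing from \<open>P 0\<close> to \<open>P k\<^sub>n\<close> changes the expectation
  of \<open>exp(i s \<psi> / \<surd>n)\<close> by \<open>i Cov(s \<psi>, g) k\<^sub>n / \<surd>n\<close> (\<open>expectation_change\<close>,
  \<open>local_char_expansion\<close>). This shift of the mean of \<open>S\<^sub>n\<close> is \<open>- H\<^sup>-\<^sup>1 Cov(\<psi>, g) \<surd>n k\<^sub>n\<close>, which by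
  regularity equals \<open>\<surd>n (\<theta> k\<^sub>n - \<theta> 0)\<close> up to \<open>o(1)\<close>. The two cancel, and the centred limit does not depend on
  the sequence (\<open>linear_statistic_char\<close>, \<open>regular_parameter_expansion\<close>). Symmetry of \<open>H\<close>
  (\<open>transpose_hessian\<close>) turns \<open>H\<^sup>-\<^sup>1 \<Sigma> H\<^sup>-\<^sup>T\<close> into the stated covariance.

  Convergence of characteristic functions is turned into weak convergence by a Levy theorem in Euclidean
  space (\<open>levy_continuity_euclidean\<close>). Since weak convergence holds along every sequence \<open>k\<^sub>n\<close>, it holds along near-maximizers
  of the expected loss over the shrinking balls, which is the statement on the
  supremum (\<open>SUP_tendsto_of_selections\<close>).\<close>

section \<open>Weak convergence in Euclidean space from characteristic functions\<close>

text \<open>Real trigonometric polynomials on an inner product space, with arbitrary frequencies. The phase makes the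
  sines and the constants special cases.\<close>

inductive trig_sum :: "('b::real_inner \<Rightarrow> real) \<Rightarrow> bool" where
  wave: "trig_sum (\<lambda>x. c * cos (t \<bullet> x + s))"
| add: "trig_sum f \<Longrightarrow> trig_sum g \<Longrightarrow> trig_sum (\<lambda>x. f x + g x)"

lemma trig_sum_const: "trig_sum (\<lambda>x. c)"
  using trig_sum.wave[of c 0 0] by simp

lemma trig_sum_continuous_bounded:
  assumes "trig_sum f"
  shows "continuous_on UNIV f \<and> (\<exists>G\<ge>0. \<forall>x. \<bar>f x\<bar> \<le> G)"
  using assms
proof induction
  case (wave c t s)
  have "\<bar>c * cos (t \<bullet> x + s)\<bar> \<le> \<bar>c\<bar>" for x
    using abs_cos_le_one[of "t \<bullet> x + s"] by (simp add: abs_mult mult_left_le)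
  moreover have "continuous_on UNIV (\<lambda>x. c * cos (t \<bullet> x + s))"
    by (intro continuous_intros)
  ultimately show ?case
    by (intro conjI exI[of _ "\<bar>c\<bar>"]) auto
next
  case (add f g)
  then obtain F G where "F \<ge> 0" "\<And>x. \<bar>f x\<bar> \<le> F" "G \<ge> 0" "\<And>x. \<bar>g x\<bar> \<le> G"
    by blast
  then have "\<bar>f x + g x\<bar> \<le> F + G" for x
    by (meson abs_triangle_ineq add_mono order_trans)
  with add \<open>F \<ge> 0\<close> \<open>G \<ge> 0\<close> show ?case
    by (intro conjI continuous_intros exI[of _ "F + G"]) auto
qed

lemma trig_sum_mult:
  assumes "trig_sum f" "trig_sum g"
  shows "trig_sum (\<lambda>x. f x * g x)"
  using assms
proof (induction arbitrary: g)
  case (wave c t s)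
  from wave show ?case
  proof induction
    case (wave c' t' s')
    have "c * cos (t \<bullet> x + s) * (c' * cos (t' \<bullet> x + s')) =
        c * c' / 2 * cos ((t - t') \<bullet> x + (s - s')) + c * c' / 2 * cos ((t + t') \<bullet> x + (s + s'))" for x
    proof -
      have "cos (t \<bullet> x + s) * cos (t' \<bullet> x + s') =
          (cos ((t - t') \<bullet> x + (s - s')) + cos ((t + t') \<bullet> x + (s + s'))) / 2"
        unfolding cos_times_cos by (simp add: inner_diff_left inner_add_left algebra_simps)
      moreover have "c * u * (c' * v) = c * c' / 2 * a + c * c' / 2 * b" if "u * v = (a + b) / 2" for u v a b
        using that by algebra
      ultimately show ?thesis by blast
    qed
    then show ?case
      by (simp only: trig_sum.intros)
  next
    case (add f g)
    then show ?case
      by (simp add: distrib_left trig_sum.add)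
  qed
next
  case (add f1 f2)
  then show ?case
    by (simp add: distrib_right trig_sum.add)
qed

text \<open>A trigonometric sum stays one after composition with a polynomial. This is what allows a trigonometric approximation
  on a compact set to be truncated without leaving the class.\<close>

lemma trig_sum_polynomial:
  assumes q: "real_polynomial_function (q :: real \<Rightarrow> real)" and g: "trig_sum g"
  shows "trig_sum (\<lambda>x. q (g x))"
  using q
proof induction
  case (linear f)
  interpret bounded_linear f by fact
  have "f y = f 1 * y" for y
    using scaleR[of y 1] by (simp only: real_scaleR_def mult_1_left mult_1_right mult.commute)
  then have "f = (\<lambda>y. f 1 * y)"
    by (rule ext)
  then show ?case
    using trig_sum_mult[OF trig_sum_const[of "f 1"] g] by metis
qed (auto intro: trig_sum_const trig_sum.add trig_sum_mult)

lemma (in prob_space) expectation_cos_eq_Re: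
  fixes Y :: "'a \<Rightarrow> 'b::euclidean_space"
  assumes [measurable]: "Y \<in> borel_measurable M"
  shows "(\<integral>\<omega>. cos (t \<bullet> Y \<omega> + s) \<partial>M) = Re (iexp s * (CLINT \<omega>|M. iexp (t \<bullet> Y \<omega>)))"
proof -
  have int: "integrable M (\<lambda>\<omega>. iexp (t \<bullet> Y \<omega>))"
    by (rule integrable_iexp) auto
  have "Re (iexp s * (CLINT \<omega>|M. iexp (t \<bullet> Y \<omega>))) = Re (CLINT \<omega>|M. iexp s * iexp (t \<bullet> Y \<omega>))"
    by simp
  also have "\<dots> = (\<integral>\<omega>. Re (iexp s * iexp (t \<bullet> Y \<omega>)) \<partial>M)"
    by (rule integral_Re[symmetric]) (use int in auto)
  also have "(\<lambda>\<omega>. Re (iexp s * iexp (t \<bullet> Y \<omega>))) = (\<lambda>\<omega>. cos (t \<bullet> Y \<omega> + s))"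
    by (auto simp: exp_add[symmetric] distrib_left[symmetric] of_real_add[symmetric] Re_exp add.commute
        simp del: of_real_add)
  finally show ?thesis ..
qed

lemma (in prob_space) integrable_bounded_continuous:
  fixes f :: "'b::topological_space \<Rightarrow> real"
  assumes [measurable]: "Y \<in> borel_measurable M" and f: "continuous_on UNIV f" "\<And>x. \<bar>f x\<bar> \<le> G"
  shows "integrable M (\<lambda>\<omega>. f (Y \<omega>))"
proof -
  have [measurable]: "f \<in> borel_measurable borel"
    using f(1) by (intro borel_measurable_continuous_onI)
  show ?thesis
    by (rule integrable_const_bound[of _ G]) (use f(2) in auto)
qed

text \<open>A single wave is the real part of a rotated character.\<close>

lemma trig_sum_expectation_convergence:
  fixes Y :: "nat \<Rightarrow> 'a \<Rightarrow> 'b::euclidean_space"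
  assumes M: "\<And>n. prob_space (M n)" and Y: "\<And>n. Y n \<in> borel_measurable (M n)"
    and N: "prob_space N" and Z: "Z \<in> borel_measurable N"
    and char: "\<And>t. (\<lambda>n. CLINT \<omega>|M n. iexp (t \<bullet> Y n \<omega>)) \<longlonglongrightarrow> (CLINT z|N. iexp (t \<bullet> Z z))"
    and f: "trig_sum f"
  shows "(\<lambda>n. \<integral>\<omega>. f (Y n \<omega>) \<partial>M n) \<longlonglongrightarrow> (\<integral>z. f (Z z) \<partial>N)"
  using f
proof induction
  case (wave c t s)
  have "(\<lambda>n. c * Re (iexp s * (CLINT \<omega>|M n. iexp (t \<bullet> Y n \<omega>))))
      \<longlonglongrightarrow> c * Re (iexp s * (CLINT z|N. iexp (t \<bullet> Z z)))"
    by (intro tendsto_intros char)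
  then show ?case
    using prob_space.expectation_cos_eq_Re[OF M Y] prob_space.expectation_cos_eq_Re[OF N Z] by simp
next
  case (add f g)
  have "integrable (M n) (\<lambda>\<omega>. h (Y n \<omega>)) \<and> integrable N (\<lambda>z. h (Z z))" if "trig_sum h" for h n
    using trig_sum_continuous_bounded[OF that]
      prob_space.integrable_bounded_continuous[OF M Y] prob_space.integrable_bounded_continuous[OF N Z]
    by blast
  with add show ?case
    by (auto intro: tendsto_add)
qed

text \<open>Stone--Weierstrass gives a trigonometric sum \<open>g\<close> close to \<open>f\<close> on the compact set, but it gives no useful bound on \<open>g\<close>
  elsewhere. Clamping \<open>g\<close> to \<open>[-B, B]\<close> cures this and does not hurt on \<open>K\<close>; as \<open>g\<close> is bounded, the clamping function
  can be replaced by a polynomial that is close to it on the range of \<open>g\<close>.\<close>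

lemma trig_sum_approximation:
  fixes f :: "'b::euclidean_space \<Rightarrow> real"
  assumes K: "compact K" and f: "continuous_on UNIV f" "\<And>x. \<bar>f x\<bar> \<le> B" and e: "e > 0"
  obtains k where "trig_sum k" "\<And>x. \<bar>k x\<bar> \<le> B + e" "\<And>x. x \<in> K \<Longrightarrow> \<bar>f x - k x\<bar> \<le> 2 * e"
proof -
  have "\<exists>g. trig_sum g \<and> (\<forall>x\<in>K. \<bar>f x - g x\<bar> < e)"
  proof (rule Stone_Weierstrass_HOL[of K trig_sum f e])
    fix x y :: 'b
    assume "x \<in> K \<and> y \<in> K \<and> x \<noteq> y"
    then have d: "(x - y) \<bullet> (x - y) > 0"
      by simp
    define a where "a = (x - y) \<bullet> (x - y)"
    \<comment> \<open>the phase is chosen so that the two points are a quarter of a period apart\<close>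
    define h where "h = (\<lambda>z. 1 * cos (((pi / (2 * a)) *\<^sub>R (x - y)) \<bullet> z + - (((pi / (2 * a)) *\<^sub>R (x - y)) \<bullet> y)))"
    have "h z = cos (pi / (2 * a) * ((x - y) \<bullet> (z - y)))" for z
      by (simp add: h_def inner_diff_right right_diff_distrib)
    then have "h x = cos (pi / 2)" "h y = 1"
      using d by (simp_all add: a_def[symmetric])
    moreover have "trig_sum h"
      unfolding h_def by (rule trig_sum.wave)
    ultimately show "\<exists>f. trig_sum f \<and> f x \<noteq> f y"
      by (intro exI[of _ h]) simp
  qed (use K f e in \<open>auto intro: trig_sum_const trig_sum.add trig_sum_mult continuous_on_subset
        dest: trig_sum_continuous_bounded\<close>)
  then obtain g where g: "trig_sum g" "\<And>x. x \<in> K \<Longrightarrow> \<bar>f x - g x\<bar> < e"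
    by blast
  obtain G where G: "\<And>x. \<bar>g x\<bar> \<le> G"
    using trig_sum_continuous_bounded[OF g(1)] by blast
  \<comment> \<open>the clamping function on the range of \<open>g\<close>\<close>
  obtain q where q: "real_polynomial_function q"
    "\<And>y. y \<in> {-G..G} \<Longrightarrow> \<bar>max (- B) (min B y) - q y\<bar> < e"
  proof (rule Stone_Weierstrass_real_polynomial_function[of "{-G..G}" "\<lambda>y. max (- B) (min B y)" e])
    show "continuous_on {-G..G} (\<lambda>y. max (- B) (min B y))"
      by (intro continuous_intros)
  qed (use e in auto)
  have close: "\<bar>max (- B) (min B (g x)) - q (g x)\<bar> < e" for x
    using q(2)[of "g x"] G[of x] by (simp add: abs_le_iff)
  show thesis
  proof
    show "trig_sum (\<lambda>x. q (g x))"
      using q(1) g(1) by (rule trig_sum_polynomial)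
    show "\<bar>q (g x)\<bar> \<le> B + e" for x
      using close[of x] f(2)[of x] by (simp add: abs_le_iff abs_less_iff max_def min_def split: if_splits)
    show "\<bar>f x - q (g x)\<bar> \<le> 2 * e" if "x \<in> K" for x
      using close[of x] f(2)[of x] g(2)[OF that] by (simp add: abs_le_iff abs_less_iff max_def min_def split: if_splits)
  qed
qed

lemma (in prob_space) expectation_diff_le_off_set:
  fixes f k :: "'b::topological_space \<Rightarrow> real"
  assumes Y[measurable]: "Y \<in> borel_measurable M" and K[measurable]: "K \<in> sets borel"
    and f: "continuous_on UNIV f" "\<And>x. \<bar>f x\<bar> \<le> B"
    and k: "continuous_on UNIV k" "\<And>x. \<bar>k x\<bar> \<le> C"
    and a: "0 \<le> a" "\<And>x. x \<in> K \<Longrightarrow> \<bar>f x - k x\<bar> \<le> a"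
  shows "\<bar>(\<integral>\<omega>. f (Y \<omega>) \<partial>M) - (\<integral>\<omega>. k (Y \<omega>) \<partial>M)\<bar> \<le> a + (B + C) * prob {\<omega>\<in>space M. Y \<omega> \<notin> K}"
proof -
  have [measurable]: "f \<in> borel_measurable borel" "k \<in> borel_measurable borel"
    using f(1) k(1) by (auto intro: borel_measurable_continuous_onI)
  note intf = integrable_bounded_continuous[OF Y f] and intk = integrable_bounded_continuous[OF Y k]
  have "0 \<le> B" "0 \<le> C"
    using f(2) k(2) abs_ge_zero order_trans by blast+
  have "\<bar>(\<integral>\<omega>. f (Y \<omega>) \<partial>M) - (\<integral>\<omega>. k (Y \<omega>) \<partial>M)\<bar> = \<bar>\<integral>\<omega>. f (Y \<omega>) - k (Y \<omega>) \<partial>M\<bar>"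
    using intf intk by simp
  also have "\<dots> \<le> (\<integral>\<omega>. \<bar>f (Y \<omega>) - k (Y \<omega>)\<bar> \<partial>M)"
    by (rule integral_abs_bound)
  also have "\<dots> \<le> (\<integral>\<omega>. a + (B + C) * indicator {\<omega>\<in>space M. Y \<omega> \<notin> K} \<omega> \<partial>M)"
  proof (rule integral_mono)
    show "integrable M (\<lambda>\<omega>. a + (B + C) * indicator {\<omega>\<in>space M. Y \<omega> \<notin> K} \<omega>)"
      by (intro Bochner_Integration.integrable_add integrable_const integrable_mult_right integrable_real_indicator)
        (auto simp: emeasure_eq_measure)
    show "\<bar>f (Y \<omega>) - k (Y \<omega>)\<bar> \<le> a + (B + C) * indicator {\<omega>\<in>space M. Y \<omega> \<notin> K} \<omega>"
      if "\<omega> \<in> space M" for \<omega>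
      using a f(2)[of "Y \<omega>"] k(2)[of "Y \<omega>"] that by (auto simp: indicator_def)
  qed (use intf intk in auto)
  also have "\<dots> = a + (B + C) * prob {\<omega>\<in>space M. Y \<omega> \<notin> K}"
    by (subst Bochner_Integration.integral_add)
      (auto simp: prob_space emeasure_eq_measure intro!: integrable_real_indicator)
  finally show ?thesis .
qed

text \<open>A continuous stand-in for the indicator of \<open>\<bar>x\<bar> > R\<close>, against which the weak convergence of a coordinate can
  be tested.\<close>

definition ramp :: "real \<Rightarrow> real \<Rightarrow> real" where
  "ramp R x = min 1 (max 0 (\<bar>x\<bar> - R))"

lemma ramp_bounds: "0 \<le> ramp R x" "ramp R x \<le> 1" "\<bar>ramp R x\<bar> \<le> 1"
  by (auto simp: ramp_def)

lemma isCont_ramp: "isCont (ramp R) x"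
  unfolding ramp_def by (intro continuous_intros)

lemma continuous_on_ramp: "continuous_on UNIV (ramp R)"
  by (simp add: continuous_on_eq_continuous_at isCont_ramp)

lemma (in prob_space) prob_le_expectation_ramp:
  assumes [measurable]: "X \<in> borel_measurable M"
  shows "prob {\<omega>\<in>space M. R + 1 < \<bar>X \<omega>\<bar>} \<le> (\<integral>\<omega>. ramp R (X \<omega>) \<partial>M)"
proof -
  have "prob {\<omega>\<in>space M. R + 1 < \<bar>X \<omega>\<bar>} = (\<integral>\<omega>. indicator {\<omega>\<in>space M. R + 1 < \<bar>X \<omega>\<bar>} \<omega> \<partial>M)"
    by simp
  also have "\<dots> \<le> (\<integral>\<omega>. ramp R (X \<omega>) \<partial>M)"
    by (intro integral_mono integrable_bounded_continuous[OF assms continuous_on_ramp ramp_bounds(3)]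
          integrable_real_indicator)
      (auto simp: emeasure_eq_measure indicator_def ramp_bounds, auto simp: ramp_def)
  finally show ?thesis .
qed

lemma (in prob_space) expectation_ramp_tendsto_0:
  assumes [measurable]: "X \<in> borel_measurable M"
  shows "(\<lambda>R. \<integral>\<omega>. ramp (real R) (X \<omega>) \<partial>M) \<longlonglongrightarrow> 0"
proof -
  have [measurable]: "ramp R \<in> borel_measurable borel" for R
    using continuous_on_ramp by (rule borel_measurable_continuous_onI)
  have "(\<lambda>R. \<integral>\<omega>. ramp (real R) (X \<omega>) \<partial>M) \<longlonglongrightarrow> (\<integral>\<omega>. 0 \<partial>M)"
  proof (rule integral_dominated_convergence[where w = "\<lambda>_. 1"])
    have "(\<lambda>R. ramp (real R) y) \<longlonglongrightarrow> 0" for y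
    proof (rule tendsto_eventually)
      obtain m :: nat where "\<bar>y\<bar> \<le> real m"
        using real_arch_simple by blast
      then show "eventually (\<lambda>R. ramp (real R) y = 0) sequentially"
        by (auto simp: eventually_sequentially ramp_def intro!: exI[of _ m])
    qed
    then show "AE \<omega> in M. (\<lambda>R. ramp (real R) (X \<omega>)) \<longlonglongrightarrow> 0"
      by simp
  qed (auto simp: ramp_bounds)
  then show ?thesis
    by simp
qed

text \<open>Linear functionals are real random variables, so the one-dimensional Levy theorem applies to them.\<close>

lemma coordinate_weak_convergence:
  fixes Y :: "nat \<Rightarrow> 'a \<Rightarrow> 'b::euclidean_space" and \<phi> :: "real \<Rightarrow> real"
  assumes M: "\<And>n. prob_space (M n)" and Y: "\<And>n. Y n \<in> borel_measurable (M n)"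
    and N: "prob_space N" and Z: "Z \<in> borel_measurable N"
    and char: "\<And>t. (\<lambda>n. CLINT \<omega>|M n. iexp (t \<bullet> Y n \<omega>)) \<longlonglongrightarrow> (CLINT z|N. iexp (t \<bullet> Z z))"
    and \<phi>: "\<And>x. isCont \<phi> x" "\<And>x. \<bar>\<phi> x\<bar> \<le> B"
  shows "(\<lambda>n. \<integral>\<omega>. \<phi> (b \<bullet> Y n \<omega>) \<partial>M n) \<longlonglongrightarrow> (\<integral>z. \<phi> (b \<bullet> Z z) \<partial>N)"
proof -
  have [measurable]: "Y n \<in> borel_measurable (M n)" "Z \<in> borel_measurable N" for n
    by fact+
  have [measurable]: "\<phi> \<in> borel_measurable borel"
    using \<phi>(1) by (intro borel_measurable_continuous_onI continuous_at_imp_continuous_on) auto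
  define D where "D n = distr (M n) borel (\<lambda>\<omega>. b \<bullet> Y n \<omega>)" for n
  define D' where "D' = distr N borel (\<lambda>z. b \<bullet> Z z)"
  have D: "real_distribution (D n)" for n
    unfolding D_def by (intro prob_space.real_distribution_distr M) measurable
  have D': "real_distribution D'"
    unfolding D'_def by (intro prob_space.real_distribution_distr N) measurable
  have "weak_conv_m D D'"
  proof (rule levy_continuity[OF D D'])
    fix u :: real
    show "(\<lambda>n. char (D n) u) \<longlonglongrightarrow> char D' u"
      using char[of "u *\<^sub>R b"] by (simp add: char_def D_def D'_def integral_distr)
  qed
  then have "(\<lambda>n. integral\<^sup>L (D n) \<phi>) \<longlonglongrightarrow> integral\<^sup>L D' \<phi>"
    using \<phi> by (intro weak_conv_imp_integral_bdd_continuous_conv[OF D D']) auto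
  then show ?thesis
    by (simp add: D_def D'_def integral_distr)
qed

text \<open>Weak convergence of the coordinates confines all but \<open>e\<close> of the mass to a fixed box. On the box a bounded continuous
  function is approximated by a globally bounded trigonometric sum, whose expectations converge by assumption.\<close>

theorem levy_continuity_euclidean:
  fixes Y :: "nat \<Rightarrow> 'a \<Rightarrow> 'b::euclidean_space"
  assumes M: "\<And>n. prob_space (M n)" and Y: "\<And>n. Y n \<in> borel_measurable (M n)"
    and N: "prob_space N" and Z: "Z \<in> borel_measurable N"
    and char: "\<And>t. (\<lambda>n. CLINT \<omega>|M n. iexp (t \<bullet> Y n \<omega>)) \<longlonglongrightarrow> (CLINT z|N. iexp (t \<bullet> Z z))"
  shows "conv_in_distribution M Y N Z"
  unfolding conv_in_distribution_def
proof (intro conjI allI impI)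
  show "Y n \<in> borel_measurable (M n)" for n by fact
  show "Z \<in> borel_measurable N" by fact
  note [measurable] = this Y
  fix f :: "'b \<Rightarrow> real"
  assume f: "continuous_on UNIV f" "bounded (range f)"
  obtain B where B: "\<And>x. \<bar>f x\<bar> \<le> B"
    using f(2) by (auto simp: bounded_iff)
  then have "B \<ge> 0"
    using abs_ge_zero order_trans by blast
  define d where "d = real DIM('b)"
  have d: "d > 0"
    by (simp add: d_def)
  define \<delta> where "\<delta> e = 2 * (2 * e + (2 * B + e) * e) + e" for e
  have approx: "\<forall>\<^sub>F n in sequentially. \<bar>(\<integral>\<omega>. f (Y n \<omega>) \<partial>M n) - (\<integral>z. f (Z z) \<partial>N)\<bar> \<le> \<delta> e"
    if e: "e > 0" for e :: real
  proof -
    have "\<exists>R. (\<integral>z. ramp (real R) (b \<bullet> Z z) \<partial>N) < e / d" for b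
      using order_tendstoD(2)[OF prob_space.expectation_ramp_tendsto_0[OF N, of "\<lambda>z. b \<bullet> Z z"], of "e / d"] e d
      by (auto simp: eventually_sequentially)
    then obtain R :: "'b \<Rightarrow> nat" where R: "\<And>b. (\<integral>z. ramp (real (R b)) (b \<bullet> Z z) \<partial>N) < e / d"
      by metis
    define K where "K = {y::'b. \<forall>b\<in>Basis. \<bar>b \<bullet> y\<bar> \<le> real (R b) + 1}"
    have K_eq: "K = cbox (- (\<Sum>b\<in>Basis. (real (R b) + 1) *\<^sub>R b)) (\<Sum>b\<in>Basis. (real (R b) + 1) *\<^sub>R b)"
    proof -
      have "K = {y. \<forall>b\<in>Basis. \<bar>y \<bullet> b\<bar> \<le> real (R b) + 1}"
        by (simp add: K_def inner_commute)
      moreover have "\<bar>u\<bar> \<le> r \<longleftrightarrow> - r \<le> u \<and> u \<le> r" for u r :: real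
        by linarith
      ultimately show ?thesis
        by (simp only: mem_box set_eq_iff mem_Collect_eq) simp
    qed
    then have K: "compact K" and [measurable]: "K \<in> sets borel"
      by simp_all
    have off: "measure L {\<omega>\<in>space L. W \<omega> \<notin> K} \<le> e"
      if L: "prob_space L" and [measurable]: "W \<in> borel_measurable L"
        and small: "\<And>b. b \<in> Basis \<Longrightarrow> (\<integral>\<omega>. ramp (real (R b)) (b \<bullet> W \<omega>) \<partial>L) < e / d"
      for L :: "'l measure" and W
    proof -
      interpret L: prob_space L by fact
      have "{\<omega>\<in>space L. W \<omega> \<notin> K} = (\<Union>b\<in>Basis. {\<omega>\<in>space L. real (R b) + 1 < \<bar>b \<bullet> W \<omega>\<bar>})"
        by (auto simp: K_def not_le)
      then have "L.prob {\<omega>\<in>space L. W \<omega> \<notin> K} \<le> (\<Sum>b\<in>Basis. L.prob {\<omega>\<in>space L. real (R b) + 1 < \<bar>b \<bullet> W \<omega>\<bar>})"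
        by (simp add: L.finite_measure_subadditive_finite image_subset_iff)
      also have "\<dots> \<le> (\<Sum>b\<in>(Basis::'b set). e / d)"
      proof (rule sum_mono)
        fix b :: 'b
        assume "b \<in> Basis"
        have "L.prob {\<omega>\<in>space L. real (R b) + 1 < \<bar>b \<bullet> W \<omega>\<bar>} \<le> (\<integral>\<omega>. ramp (real (R b)) (b \<bullet> W \<omega>) \<partial>L)"
          by (rule L.prob_le_expectation_ramp) measurable
        with small[OF \<open>b \<in> Basis\<close>]
        show "L.prob {\<omega>\<in>space L. real (R b) + 1 < \<bar>b \<bullet> W \<omega>\<bar>} \<le> e / d"
          by linarith
      qed
      also have "\<dots> = e"
        using d by (simp add: d_def)
      finally show ?thesis .
    qed
    obtain k where k: "trig_sum k" "\<And>x. \<bar>k x\<bar> \<le> B + e" "\<And>x. x \<in> K \<Longrightarrow> \<bar>f x - k x\<bar> \<le> 2 * e"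
      using trig_sum_approximation[OF K f(1) B e] by blast
    have kc: "continuous_on UNIV k"
      using trig_sum_continuous_bounded[OF k(1)] by blast
    have close: "\<bar>(\<integral>\<omega>. f (W \<omega>) \<partial>L) - (\<integral>\<omega>. k (W \<omega>) \<partial>L)\<bar> \<le> 2 * e + (2 * B + e) * e"
      if L: "prob_space L" and W: "W \<in> borel_measurable L"
        and off: "measure L {\<omega>\<in>space L. W \<omega> \<notin> K} \<le> e"
      for L :: "'l measure" and W
    proof -
      have "\<bar>(\<integral>\<omega>. f (W \<omega>) \<partial>L) - (\<integral>\<omega>. k (W \<omega>) \<partial>L)\<bar>
          \<le> 2 * e + (B + (B + e)) * measure L {\<omega>\<in>space L. W \<omega> \<notin> K}"
        by (rule prob_space.expectation_diff_le_off_set[OF L W _ f(1) B kc k(2)]) (use k(3) e in auto)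
      also have "\<dots> \<le> 2 * e + (2 * B + e) * e"
        using mult_left_mono[OF off, of "2 * B + e"] \<open>B \<ge> 0\<close> e by (simp add: algebra_simps)
      finally show ?thesis .
    qed
    have ramp_conv: "(\<lambda>n. \<integral>\<omega>. ramp R (b \<bullet> Y n \<omega>) \<partial>M n) \<longlonglongrightarrow> (\<integral>z. ramp R (b \<bullet> Z z) \<partial>N)" for R b
      by (rule coordinate_weak_convergence[OF M Y N Z char isCont_ramp ramp_bounds(3)])
    have "\<forall>\<^sub>F n in sequentially. \<forall>b\<in>Basis. (\<integral>\<omega>. ramp (real (R b)) (b \<bullet> Y n \<omega>) \<partial>M n) < e / d"
      using order_tendstoD(2)[OF ramp_conv R] by (intro eventually_ball_finite) auto
    moreover have "(\<lambda>n. \<integral>\<omega>. k (Y n \<omega>) \<partial>M n) \<longlonglongrightarrow> (\<integral>z. k (Z z) \<partial>N)"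
      by (rule trig_sum_expectation_convergence[OF M Y N Z char k(1)])
    then have "\<forall>\<^sub>F n in sequentially. \<bar>(\<integral>\<omega>. k (Y n \<omega>) \<partial>M n) - (\<integral>z. k (Z z) \<partial>N)\<bar> < e"
      using e by (auto dest: tendstoD simp: dist_real_def)
    ultimately show ?thesis
    proof eventually_elim
      case (elim n)
      then have "\<bar>(\<integral>\<omega>. f (Y n \<omega>) \<partial>M n) - (\<integral>\<omega>. k (Y n \<omega>) \<partial>M n)\<bar> \<le> 2 * e + (2 * B + e) * e"
        using M[of n] Y[of n] by (intro close off) auto
      moreover have "\<bar>(\<integral>z. f (Z z) \<partial>N) - (\<integral>z. k (Z z) \<partial>N)\<bar> \<le> 2 * e + (2 * B + e) * e"
        using N Z R by (intro close off) auto
      moreover have "\<bar>u - w\<bar> \<le> 2 * a + e" if "\<bar>u - v\<bar> \<le> a" "\<bar>w - x\<bar> \<le> a" "\<bar>v - x\<bar> < e" for u v w x a :: real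
        using that by linarith
      ultimately show ?case
        using elim(2) unfolding \<delta>_def by blast
    qed
  qed
  show "(\<lambda>n. \<integral>\<omega>. f (Y n \<omega>) \<partial>M n) \<longlonglongrightarrow> (\<integral>z. f (Z z) \<partial>N)"
  proof (rule tendstoI)
    fix \<epsilon> :: real
    assume "\<epsilon> > 0"
    have "(\<delta> \<longlongrightarrow> \<delta> 0) (at_right 0)"
      unfolding \<delta>_def by (intro tendsto_intros)
    moreover have "\<delta> 0 < \<epsilon>"
      using \<open>\<epsilon> > 0\<close> by (simp add: \<delta>_def)
    ultimately have "\<forall>\<^sub>F e in at_right 0. \<delta> e < \<epsilon>"
      by (rule order_tendstoD(2))
    then obtain e where "e > 0" "\<delta> e < \<epsilon>"
      using eventually_happens'[OF _ eventually_conj[OF _ eventually_at_right_less[of "0::real"]]] by force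
    with approx[of e] show "\<forall>\<^sub>F n in sequentially. dist (\<integral>\<omega>. f (Y n \<omega>) \<partial>M n) (\<integral>z. f (Z z) \<partial>N) < \<epsilon>"
      by (auto elim!: eventually_mono simp: dist_real_def)
  qed
qed

section \<open>Gradients of convex risks and symmetry of the Hessian\<close>

lemma GDERIV_grad:
  fixes f :: "'a::euclidean_space \<Rightarrow> real"
  assumes "f differentiable (at t)"
  shows "GDERIV f t :> grad f t"
proof -
  obtain f' where f': "(f has_derivative f') (at t)"
    using assms by (auto simp: differentiable_def)
  then have "linear f'"
    by (rule has_derivative_linear)
  then have "f' = (\<lambda>h. h \<bullet> adjoint f' 1)"
    by (simp add: adjoint_works)
  with f' have "GDERIV f t :> adjoint f' 1"
    by (simp add: gderiv_def)
  then show ?thesis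
    using grad_eqI by metis
qed

lemma directional_derivative:
  fixes f :: "'a::euclidean_space \<Rightarrow> real"
  assumes "f differentiable (at (t + r *\<^sub>R v))"
  shows "((\<lambda>r. f (t + r *\<^sub>R v)) has_real_derivative v \<bullet> grad f (t + r *\<^sub>R v)) (at r)"
proof -
  have "(f has_derivative (\<lambda>h. h \<bullet> grad f (t + r *\<^sub>R v))) (at (t + r *\<^sub>R v))"
    using GDERIV_grad[OF assms] by (simp add: gderiv_def)
  moreover have "((\<lambda>r. t + r *\<^sub>R v) has_derivative (\<lambda>h. h *\<^sub>R v)) (at r)"
    by (auto intro!: derivative_eq_intros)
  ultimately have "((\<lambda>r. f (t + r *\<^sub>R v)) has_derivative (\<lambda>h. (h *\<^sub>R v) \<bullet> grad f (t + r *\<^sub>R v))) (at r)"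
    by (rule has_derivative_compose[rotated])
  then show ?thesis
    unfolding has_field_derivative_def by (rule has_derivative_eq_rhs) (auto simp: mult.commute)
qed

lemma difference_quotient_tendsto:
  fixes f :: "'a::euclidean_space \<Rightarrow> real"
  assumes "f differentiable (at t)"
  shows "(\<lambda>n. real (Suc n) * (f (t + inverse (real (Suc n)) *\<^sub>R v) - f t)) \<longlonglongrightarrow> v \<bullet> grad f t"
proof -
  have "((\<lambda>r. (f (t + r *\<^sub>R v) - f t) / r) \<longlongrightarrow> v \<bullet> grad f t) (at 0)"
    using directional_derivative[of f t 0 v] assms by (simp add: has_field_derivative_iff)
  moreover have "filterlim (\<lambda>n. inverse (real (Suc n))) (at 0) sequentially"
    using LIMSEQ_inverse_real_of_nat by (simp add: filterlim_at)
  ultimately have "(\<lambda>n. (f (t + inverse (real (Suc n)) *\<^sub>R v) - f t) / inverse (real (Suc n))) \<longlonglongrightarrow> v \<bullet> grad f t"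
    by (rule filterlim_compose)
  then show ?thesis
    by (simp add: divide_inverse mult.commute)
qed

text \<open>The first argument is replaced by the first point of a countable dense sequence within distance \<open>1/(n+1)\<close>.
  The resulting function is measurable as a countable patchwork, and it converges by continuity.\<close>

lemma measurable_Caratheodory:
  fixes F :: "'b::{metric_space, second_countable_topology} \<Rightarrow> 'x \<Rightarrow> 'c::metric_space"
  assumes F: "\<And>t. F t \<in> borel_measurable X"
    and cont: "\<And>x. x \<in> space X \<Longrightarrow> continuous_on UNIV (\<lambda>t. F t x)"
  shows "(\<lambda>(t, x). F t x) \<in> borel_measurable (borel \<Otimes>\<^sub>M X)"
proof -
  obtain D :: "'b set" where D: "countable D" "\<And>U. open U \<Longrightarrow> U \<noteq> {} \<Longrightarrow> \<exists>d\<in>D. d \<in> U"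
    using countable_dense_setE by blast
  have "D \<noteq> {}"
    using D(2)[of UNIV] by auto
  define d where "d = from_nat_into D"
  have dense: "\<exists>k. dist (d k) t < e" if "e > 0" for t e
    using D(2)[of "ball t e"] that from_nat_into_surj[OF D(1)]
    by (force simp: d_def dist_commute)
  define k where "k n t = (LEAST k. dist (d k) t < inverse (real (Suc n)))" for n t
  have close: "dist (d (k n t)) t < inverse (real (Suc n))" for n t
    unfolding k_def by (rule LeastI_ex, rule dense) simp
  have k_meas[measurable]: "k n \<in> measurable borel (count_space UNIV)" for n
    unfolding k_def[abs_def]
  proof (rule measurable_Least)
    show "Measurable.pred borel (\<lambda>t. dist (d i) t < inverse (real (Suc n)))" for i
    proof -
      have "{t \<in> space borel. dist (d i) t < inverse (real (Suc n))} = ball (d i) (inverse (real (Suc n)))"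
        unfolding ball_def space_borel by simp
      then show ?thesis
        unfolding pred_def by (simp only: borel_open open_ball)
    qed
  qed
  have conv: "(\<lambda>n. d (k n t)) \<longlonglongrightarrow> t" for t
    unfolding tendsto_dist_iff[of _ t]
  proof (rule tendsto_sandwich[OF _ _ tendsto_const LIMSEQ_inverse_real_of_nat])
    show "\<forall>\<^sub>F n in sequentially. dist (d (k n t)) t \<le> inverse (real (Suc n))"
      by (intro always_eventually allI less_imp_le close)
  qed (intro always_eventually allI zero_le_dist)
  show ?thesis
  proof (rule borel_measurable_LIMSEQ_metric)
    show "(\<lambda>p. F (d (k n (fst p))) (snd p)) \<in> borel_measurable (borel \<Otimes>\<^sub>M X)" for n
    proof (rule measurable_compose_countable[where g = "\<lambda>p. k n (fst p)"])
      show "(\<lambda>p. F (d i) (snd p)) \<in> borel_measurable (borel \<Otimes>\<^sub>M X)" for i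
        using F by measurable
    qed measurable
    fix p :: "'b \<times> 'x"
    assume "p \<in> space (borel \<Otimes>\<^sub>M X)"
    then have "continuous_on UNIV (\<lambda>t. F t (snd p))"
      by (intro cont) (auto simp: space_pair_measure)
    then have "(\<lambda>n. F (d (k n (fst p))) (snd p)) \<longlonglongrightarrow> F (fst p) (snd p)"
      by (rule continuous_on_tendsto_compose[OF _ conv]) auto
    then show "(\<lambda>n. F (d (k n (fst p))) (snd p)) \<longlonglongrightarrow> (case p of (t, x) \<Rightarrow> F t x)"
      by (simp add: case_prod_beta)
  qed
qed

text \<open>Each component of the gradient is a limit of difference quotients, and these are jointly measurable.\<close>

lemma measurable_grad:
  fixes F :: "'b::euclidean_space \<Rightarrow> 'x \<Rightarrow> real"
  assumes F: "\<And>t. F t \<in> borel_measurable X"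
    and diff: "\<And>x t. x \<in> space X \<Longrightarrow> (\<lambda>s. F s x) differentiable (at t)"
  shows "(\<lambda>(t, x). grad (\<lambda>s. F s x) t) \<in> borel_measurable (borel \<Otimes>\<^sub>M X)"
proof -
  have "continuous_on UNIV (\<lambda>t. F t x)" if "x \<in> space X" for x
    using diff[OF that] by (intro differentiable_imp_continuous_on) (simp add: differentiable_on_def)
  from measurable_Caratheodory[OF F this]
  have joint: "(\<lambda>(t, x). F t x) \<in> borel_measurable (borel \<Otimes>\<^sub>M X)" .
  show ?thesis
    unfolding borel_measurable_euclidean_space[of "\<lambda>(t, x). grad (\<lambda>s. F s x) t"]
  proof
    fix b :: 'b
    assume "b \<in> Basis"
    have F2: "(\<lambda>p. F (g p) (snd p)) \<in> borel_measurable (borel \<Otimes>\<^sub>M X)"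
      if "g \<in> borel_measurable (borel \<Otimes>\<^sub>M X)" for g
      using measurable_compose[OF _ joint, of "\<lambda>p. (g p, snd p)" "borel \<Otimes>\<^sub>M X"] that by simp
    show "(\<lambda>p. (case p of (t, x) \<Rightarrow> grad (\<lambda>s. F s x) t) \<bullet> b) \<in> borel_measurable (borel \<Otimes>\<^sub>M X)"
    proof (rule borel_measurable_LIMSEQ_real)
      show "(\<lambda>p. real (Suc n) * (F (fst p + inverse (real (Suc n)) *\<^sub>R b) (snd p) - F (fst p) (snd p)))
          \<in> borel_measurable (borel \<Otimes>\<^sub>M X)" for n
        by (intro borel_measurable_times borel_measurable_diff borel_measurable_const F2) measurable
      fix p :: "'b \<times> 'x"
      assume "p \<in> space (borel \<Otimes>\<^sub>M X)"
      then have "(\<lambda>s. F s (snd p)) differentiable (at (fst p))"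
        by (intro diff) (auto simp: space_pair_measure)
      from difference_quotient_tendsto[OF this, of b]
      show "(\<lambda>n. real (Suc n) * (F (fst p + inverse (real (Suc n)) *\<^sub>R b) (snd p) - F (fst p) (snd p)))
          \<longlonglongrightarrow> (case p of (t, x) \<Rightarrow> grad (\<lambda>s. F s x) t) \<bullet> b"
        by (simp add: case_prod_beta inner_commute)
    qed
  qed
qed

text \<open>Difference quotients of a convex function increase with the step. They therefore lie between the two unit-step quotients, which are
  integrable, and dominated convergence shows that the expected directional derivative is a limit of nonnegative
  numbers. Reversing the direction gives equality.\<close>

lemma expected_gradient_at_minimizer:
  fixes F :: "'b::euclidean_space \<Rightarrow> 'x \<Rightarrow> real"
  assumes int: "\<And>t. integrable M (F t)"
    and convex: "\<And>x. x \<in> space M \<Longrightarrow> convex_on UNIV (\<lambda>t. F t x)"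
    and diff: "\<And>x t. x \<in> space M \<Longrightarrow> (\<lambda>s. F s x) differentiable (at t)"
    and min: "\<And>t. (\<integral>x. F t0 x \<partial>M) \<le> (\<integral>x. F t x \<partial>M)"
  shows "(\<integral>x. v \<bullet> grad (\<lambda>t. F t x) t0 \<partial>M) = 0"
proof -
  have nonneg: "0 \<le> (\<integral>x. v \<bullet> grad (\<lambda>t. F t x) t0 \<partial>M)" for v
  proof -
    define a where "a n x = real (Suc n) * (F (t0 + inverse (real (Suc n)) *\<^sub>R v) x - F t0 x)" for n x
    define w where "w x = \<bar>F (t0 + v) x - F t0 x\<bar> + \<bar>F t0 x - F (t0 - v) x\<bar>" for x
    have a_int: "integrable M (a n)" for n
      unfolding a_def using int by simp
    have lim: "(\<lambda>n. a n x) \<longlonglongrightarrow> v \<bullet> grad (\<lambda>t. F t x) t0" if "x \<in> space M" for x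
      unfolding a_def using difference_quotient_tendsto[OF diff[OF that]] .
    \<comment> \<open>the two estimates below compare the step \<open>1/m\<close> with the steps 1 and -1\<close>
    have bound: "\<bar>a n x\<bar> \<le> w x" if "x \<in> space M" for n x
    proof -
      define m where "m = real (Suc n)"
      have m: "m > 0"
        by (simp add: m_def)
      note cv = convex_onD[OF convex[OF that]]
      let ?y = "t0 + inverse m *\<^sub>R v"
      have cancel: "m * (inverse m * y) = y" for y
        using m by simp
      have "?y = (1 - inverse m) *\<^sub>R t0 + inverse m *\<^sub>R (t0 + v)"
        by (simp add: algebra_simps)
      moreover have "inverse m \<le> 1"
        by (simp add: m_def field_simps)
      ultimately have "F ?y x \<le> (1 - inverse m) * F t0 x + inverse m * F (t0 + v) x"
        using cv[of "inverse m" t0 "t0 + v"] m by simp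
      then have "m * F ?y x \<le> m * ((1 - inverse m) * F t0 x + inverse m * F (t0 + v) x)"
        using m by (intro mult_left_mono) auto
      then have upper: "a n x \<le> F (t0 + v) x - F t0 x"
        unfolding a_def m_def[symmetric] by (simp add: algebra_simps cancel)
      have "(1 - m / (m + 1)) *\<^sub>R (t0 - v) + (m / (m + 1)) *\<^sub>R ?y
          = ((1 - m / (m + 1)) + m / (m + 1)) *\<^sub>R t0 + (m / (m + 1) * inverse m - (1 - m / (m + 1))) *\<^sub>R v"
        by (simp add: algebra_simps)
      also have "m / (m + 1) * inverse m - (1 - m / (m + 1)) = 0"
        using m by (simp add: field_simps)
      finally have "t0 = (1 - m / (m + 1)) *\<^sub>R (t0 - v) + (m / (m + 1)) *\<^sub>R ?y"
        by simp
      then have "F t0 x \<le> (1 - m / (m + 1)) * F (t0 - v) x + m / (m + 1) * F ?y x"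
        using cv[of "m / (m + 1)" "t0 - v" ?y] m by simp
      then have "(m + 1) * F t0 x \<le> (m + 1) * ((1 - m / (m + 1)) * F (t0 - v) x + m / (m + 1) * F ?y x)"
        using m by (intro mult_left_mono) auto
      also have "\<dots> = F (t0 - v) x + m * F ?y x"
      proof -
        have "(m + 1) * (1 - m / (m + 1)) = 1" "(m + 1) * (m / (m + 1)) = m"
          using m by (simp_all add: field_simps)
        moreover have "(m + 1) * (a * y + b * z) = ((m + 1) * a) * y + ((m + 1) * b) * z" for a b y z
          by algebra
        ultimately show ?thesis
          by (metis mult_1)
      qed
      finally have lower: "F t0 x - F (t0 - v) x \<le> a n x"
        unfolding a_def m_def[symmetric] by (simp add: algebra_simps)
      show ?thesis
        using upper lower unfolding w_def by linarith
    qed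
    have "(\<lambda>n. \<integral>x. a n x \<partial>M) \<longlonglongrightarrow> (\<integral>x. v \<bullet> grad (\<lambda>t. F t x) t0 \<partial>M)"
    proof (rule integral_dominated_convergence)
      show "integrable M w"
        unfolding w_def using int by simp
      show a_meas: "a n \<in> borel_measurable M" for n
        using a_int by (rule borel_measurable_integrable)
      show "(\<lambda>x. v \<bullet> grad (\<lambda>t. F t x) t0) \<in> borel_measurable M"
        using lim a_meas by (rule borel_measurable_LIMSEQ_real)
    qed (use lim bound in auto)
    moreover have "0 \<le> (\<integral>x. a n x \<partial>M)" for n
      using min int by (simp add: a_def)
    ultimately show ?thesis
      using LIMSEQ_le_const by blast
  qed
  have "0 \<le> - (\<integral>x. v \<bullet> grad (\<lambda>t. F t x) t0 \<partial>M)"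
    using nonneg[of "- v"] by simp
  with nonneg[of v] show ?thesis
    by linarith
qed

text \<open>Both mixed second differences \<open>u \<bullet> H v\<close> and \<open>v \<bullet> H u\<close> approximate the same symmetric expression. The mean value theorem is
  applied to the function \<open>r \<mapsto> f (t + v + r u) - f (t + r u)\<close>; differentiability of the gradient at the
  single point \<open>t\<close> controls the two gradients which appear.\<close>

lemma second_difference_bound:
  fixes f :: "'a::euclidean_space \<Rightarrow> real"
  assumes diff: "\<And>k. norm k < d \<Longrightarrow> f differentiable (at (t + k))"
    and grad: "\<And>k. norm k < d \<Longrightarrow> norm (grad f (t + k) - grad f t - H k) \<le> e * norm k"
    and H: "linear H" and small: "norm u + norm v < d" and e: "0 \<le> e"
  shows "\<bar>f (t + u + v) - f (t + u) - f (t + v) + f t - u \<bullet> H v\<bar> \<le> 2 * e * norm u * (norm u + norm v)"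
proof -
  have norm_le: "norm (r *\<^sub>R u + v) \<le> norm u + norm v" "norm (r *\<^sub>R u) \<le> norm u + norm v"
    if "0 \<le> r" "r \<le> 1" for r
  proof -
    have "norm (r *\<^sub>R u) \<le> norm u"
      using that by (simp add: mult_left_le_one_le)
    then show "norm (r *\<^sub>R u + v) \<le> norm u + norm v" "norm (r *\<^sub>R u) \<le> norm u + norm v"
      using norm_triangle_ineq[of "r *\<^sub>R u" v] norm_ge_zero[of v] by linarith+
  qed
  have "\<exists>r>0. r < 1 \<and> (f (t + v + 1 *\<^sub>R u) - f (t + 1 *\<^sub>R u)) - (f (t + v + 0 *\<^sub>R u) - f (t + 0 *\<^sub>R u))
      = (1 - 0) * (u \<bullet> grad f (t + v + r *\<^sub>R u) - u \<bullet> grad f (t + r *\<^sub>R u))"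
  proof (rule MVT2)
    fix r :: real
    assume r: "0 \<le> r" "r \<le> 1"
    have "f differentiable (at (t + (r *\<^sub>R u + v)))" "f differentiable (at (t + r *\<^sub>R u))"
      using norm_le[OF r] small by (auto intro!: diff)
    then show "((\<lambda>r. f (t + v + r *\<^sub>R u) - f (t + r *\<^sub>R u)) has_real_derivative
        u \<bullet> grad f (t + v + r *\<^sub>R u) - u \<bullet> grad f (t + r *\<^sub>R u)) (at r)"
      by (intro DERIV_diff directional_derivative) (simp_all add: ac_simps)
  qed simp
  then obtain r where r: "0 < r" "r < 1" and
    eq: "f (t + u + v) - f (t + u) - f (t + v) + f t = u \<bullet> (grad f (t + (r *\<^sub>R u + v)) - grad f (t + r *\<^sub>R u))"
    by (auto simp: inner_diff_right algebra_simps)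
  let ?a = "grad f (t + (r *\<^sub>R u + v)) - grad f t - H (r *\<^sub>R u + v)"
  let ?b = "grad f (t + r *\<^sub>R u) - grad f t - H (r *\<^sub>R u)"
  have "norm ?a \<le> e * norm (r *\<^sub>R u + v)" "norm ?b \<le> e * norm (r *\<^sub>R u)"
    using norm_le[of r] r small by (intro grad; linarith)+
  moreover have "e * norm (r *\<^sub>R u + v) \<le> e * (norm u + norm v)" "e * norm (r *\<^sub>R u) \<le> e * (norm u + norm v)"
    using norm_le[of r] r e by (auto intro!: mult_left_mono)
  ultimately have "norm (?a - ?b) \<le> 2 * e * (norm u + norm v)"
    using norm_triangle_ineq4[of ?a ?b] by linarith
  then have "norm u * norm (?a - ?b) \<le> norm u * (2 * e * (norm u + norm v))"
    by (rule mult_left_mono) simp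
  moreover have "f (t + u + v) - f (t + u) - f (t + v) + f t - u \<bullet> H v = u \<bullet> (?a - ?b)"
    unfolding eq using H by (simp add: linear_add inner_diff_right inner_add_right algebra_simps)
  ultimately show ?thesis
    using Cauchy_Schwarz_ineq2[of u "?a - ?b"] by (simp add: ac_simps)
qed

text \<open>Peano's form of the symmetry of second derivatives. The displacements are scaled by \<open>c\<close>, and both the two bilinear
  terms and the error bound of \<open>second_difference_bound\<close> are homogeneous of degree 2 in \<open>c\<close>.\<close>

lemma transpose_hessian:
  fixes f :: "real ^ 'p \<Rightarrow> real"
  assumes "twice_differentiable_at f t"
  shows "transpose (hessian f t) = hessian f t"
proof -
  let ?H = "\<lambda>h. hessian f t *v h"
  have ev: "\<forall>\<^sub>F s in nhds t. f differentiable (at s)"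
    and der: "(grad f has_derivative ?H) (at t)"
    using assms jacobian_works[of "grad f" "at t"] by (auto simp: twice_differentiable_at_def hessian_def)
  have sym: "u \<bullet> ?H v = v \<bullet> ?H u" for u v
  proof -
    have le: "\<bar>u \<bullet> ?H v - v \<bullet> ?H u\<bar> \<le> e * (2 * (norm u + norm v)\<^sup>2)" if e: "e > 0" for e
    proof -
      obtain d1 where d1: "d1 > 0" "\<And>s. dist s t < d1 \<Longrightarrow> f differentiable (at s)"
        using ev unfolding eventually_nhds_metric by blast
      obtain d2 where d2: "d2 > 0"
        "\<And>s. norm (s - t) < d2 \<Longrightarrow> norm (grad f s - grad f t - ?H (s - t)) \<le> e * norm (s - t)"
        using der e unfolding has_derivative_at_alt by blast
      define d where "d = min d1 d2"
      have "d > 0"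
        using d1(1) d2(1) by (simp add: d_def)
      \<comment> \<open>a scale at which both displacements stay in the ball of radius \<open>d\<close>; it cancels in the end\<close>
      define c where "c = d / (2 * (norm u + norm v + 1))"
      have pos: "norm u + norm v + 1 > 0"
        by (simp add: add_nonneg_pos)
      then have c: "c > 0"
        using \<open>d > 0\<close> by (simp add: c_def)
      have small: "norm (c *\<^sub>R u) + norm (c *\<^sub>R v) < d"
      proof -
        have "norm (c *\<^sub>R u) + norm (c *\<^sub>R v) = c * (norm u + norm v)"
          using c by (simp add: distrib_left)
        also have "\<dots> < c * (2 * (norm u + norm v + 1))"
        proof (rule mult_strict_left_mono)
          have "n < 2 * (n + 1)" if "0 \<le> n" for n :: real
            using that by (simp add: distrib_left)
          then show "norm u + norm v < 2 * (norm u + norm v + 1)"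
            by (meson add_nonneg_nonneg norm_ge_zero)
        qed fact
        also have "\<dots> = d"
          using pos by (simp add: c_def)
        finally show ?thesis .
      qed
      let ?\<Delta> = "f (t + c *\<^sub>R u + c *\<^sub>R v) - f (t + c *\<^sub>R u) - f (t + c *\<^sub>R v) + f t"
      have A: "f differentiable (at (t + k))" "norm (grad f (t + k) - grad f t - ?H k) \<le> e * norm k"
        if "norm k < d" for k
        using that d1(2)[of "t + k"] d2(2)[of "t + k"] by (auto simp: d_def dist_norm)
      note bound = second_difference_bound[where f = f and t = t and d = d and H = ?H and e = e, OF A]
      have "\<bar>?\<Delta> - (c *\<^sub>R u) \<bullet> ?H (c *\<^sub>R v)\<bar> \<le> 2 * e * norm (c *\<^sub>R u) * (norm (c *\<^sub>R u) + norm (c *\<^sub>R v))"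
        using bound[of "c *\<^sub>R u" "c *\<^sub>R v"] small e by (simp add: matrix_vector_mul_linear)
      moreover have "\<bar>?\<Delta> - (c *\<^sub>R v) \<bullet> ?H (c *\<^sub>R u)\<bar> \<le> 2 * e * norm (c *\<^sub>R v) * (norm (c *\<^sub>R u) + norm (c *\<^sub>R v))"
        using bound[of "c *\<^sub>R v" "c *\<^sub>R u"] small e by (simp add: matrix_vector_mul_linear algebra_simps)
      ultimately have "\<bar>(c *\<^sub>R u) \<bullet> ?H (c *\<^sub>R v) - (c *\<^sub>R v) \<bullet> ?H (c *\<^sub>R u)\<bar> \<le>
          2 * e * norm (c *\<^sub>R u) * (norm (c *\<^sub>R u) + norm (c *\<^sub>R v))
          + 2 * e * norm (c *\<^sub>R v) * (norm (c *\<^sub>R u) + norm (c *\<^sub>R v))"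
        by linarith
      also have "\<dots> = c\<^sup>2 * (e * (2 * (norm u + norm v)\<^sup>2))"
        using c by (simp add: power2_eq_square algebra_simps)
      also have "(c *\<^sub>R u) \<bullet> ?H (c *\<^sub>R v) - (c *\<^sub>R v) \<bullet> ?H (c *\<^sub>R u) = c\<^sup>2 * (u \<bullet> ?H v - v \<bullet> ?H u)"
        by (simp add: matrix_vector_mult_scaleR power2_eq_square right_diff_distrib)
      finally show ?thesis
        using c by (simp add: abs_mult)
    qed
    have "((\<lambda>e. e * (2 * (norm u + norm v)\<^sup>2)) \<longlongrightarrow> 0 * (2 * (norm u + norm v)\<^sup>2)) (at_right 0)"
      by (intro tendsto_intros)
    then have "\<bar>u \<bullet> ?H v - v \<bullet> ?H u\<bar> \<le> 0 * (2 * (norm u + norm v)\<^sup>2)"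
      by (rule tendsto_lowerbound) (auto intro: eventually_mono[OF eventually_at_right_less] le)
    then show ?thesis
      by simp
  qed
  have "transpose (hessian f t) *v v = hessian f t *v v" for v
  proof -
    have "u \<bullet> (transpose (hessian f t) *v v) = u \<bullet> (hessian f t *v v)" for u
      using sym[of u v] by (metis dot_lmul_matrix inner_commute transpose_matrix_vector)
    then show ?thesis
      using vector_eq_ldot by blast
  qed
  then show ?thesis
    by (simp add: matrix_eq)
qed

lemma transpose_matrix_inv:
  fixes A :: "real ^ 'n ^ 'n"
  assumes "invertible A" "transpose A = A"
  shows "transpose (matrix_inv A) = matrix_inv A"
proof -
  have "\<exists>B. A ** B = mat 1 \<and> B ** A = mat 1"
    using assms(1) by (simp add: invertible_def)
  then have inv: "A ** matrix_inv A = mat 1 \<and> matrix_inv A ** A = mat 1"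
    unfolding matrix_inv_def by (rule someI_ex)
  then have "transpose (A ** matrix_inv A) = mat 1"
    by (simp add: transpose_mat)
  then have "transpose (matrix_inv A) ** A = mat 1"
    by (simp add: matrix_transpose_mul assms(2))
  then show ?thesis
    using inv by (metis matrix_mul_assoc matrix_mul_lid matrix_mul_rid)
qed


section \<open>Contiguity of product measures from root densities\<close>

lemma finite_measure_sum_measure:
  assumes "prob_space M" "prob_space N" "sets N = sets M"
  shows "finite_measure (sum_measure M N)"
proof (rule finite_measureI)
  interpret M: prob_space M by fact
  interpret N: prob_space N by fact
  have "space N = space M"
    using assms(3) by (rule sets_eq_imp_space_eq)
  then have "emeasure (sum_measure M N) (space M) = 1 + 1"
    by (metis assms(3) emeasure_sum_measure sets.top M.emeasure_space_1 N.emeasure_space_1)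
  then show "emeasure (sum_measure M N) (space (sum_measure M N)) \<noteq> \<infinity>"
    by simp
qed

text \<open>Radon--Nikodym derivatives of finite measures are finite almost everywhere, so passing to the real root loses nothing.\<close>

lemma density_sqrt_density:
  assumes M: "prob_space M" and N: "prob_space N" "sets N = sets M"
    and R: "R = M \<or> R = N"
  shows "density (sum_measure M N) (\<lambda>x. ennreal ((sqrt_density (sum_measure M N) R x)\<^sup>2)) = R"
proof -
  define \<mu> where "\<mu> = sum_measure M N"
  interpret \<mu>: finite_measure \<mu>
    unfolding \<mu>_def by (rule finite_measure_sum_measure) fact+
  interpret R: prob_space R
    using M N R by auto
  have sets_R: "sets R = sets \<mu>"
    using N R by (auto simp: \<mu>_def)
  have ac: "absolutely_continuous \<mu> R"
    unfolding absolutely_continuous_def null_sets_def \<mu>_def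
    using N R by (auto simp: emeasure_sum_measure)
  have "AE x in \<mu>. RN_deriv \<mu> R x \<noteq> \<infinity>"
    using \<mu>.RN_deriv_finite[OF R.sigma_finite_measure_axioms ac sets_R] .
  then have "AE x in \<mu>. ennreal ((sqrt_density \<mu> R x)\<^sup>2) = RN_deriv \<mu> R x"
    by eventually_elim (simp add: sqrt_density_def less_top)
  then have "density \<mu> (\<lambda>x. ennreal ((sqrt_density \<mu> R x)\<^sup>2)) = density \<mu> (RN_deriv \<mu> R)"
    by (intro density_cong) (simp_all add: sqrt_density_def[abs_def])
  also have "\<dots> = R"
    by (rule \<mu>.density_RN_deriv[OF ac sets_R])
  finally show ?thesis
    by (simp add: \<mu>_def)
qed

text \<open>Two probability measures that are compared through their root densities with respect to a common measure, so that
  mutually singular parts are covered.\<close>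

locale root_densities =
  fixes \<mu> P0 P1 :: "'x measure" and s0 s1 :: "'x \<Rightarrow> real"
  assumes prob_P0: "prob_space P0" and prob_P1: "prob_space P1"
    and s0[measurable]: "s0 \<in> borel_measurable \<mu>" and s1[measurable]: "s1 \<in> borel_measurable \<mu>"
    and s0_nonneg: "0 \<le> s0 x" and s1_nonneg: "0 \<le> s1 x"
    and density_s0: "density \<mu> (\<lambda>x. ennreal ((s0 x)\<^sup>2)) = P0"
    and density_s1: "density \<mu> (\<lambda>x. ennreal ((s1 x)\<^sup>2)) = P1"

lemma root_densities_sqrt_density:
  assumes "prob_space M" "prob_space N" "sets N = sets M"
  shows "root_densities (sum_measure M N) M N
    (sqrt_density (sum_measure M N) M) (sqrt_density (sum_measure M N) N)"
proof -
  have "sqrt_density (sum_measure M N) R \<in> borel_measurable (sum_measure M N)"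
    "0 \<le> sqrt_density (sum_measure M N) R x" for R x
    by (simp_all add: sqrt_density_def[abs_def])
  then show ?thesis
    using assms by (auto intro!: root_densities.intro density_sqrt_density)
qed

context root_densities
begin

lemma sets_P0 [measurable_cong, simp]: "sets P0 = sets \<mu>"
  using density_s0 by (metis sets_density)

lemma sets_P1 [measurable_cong, simp]: "sets P1 = sets \<mu>"
  using density_s1 by (metis sets_density)

lemma space_P0 [simp]: "space P0 = space \<mu>"
  using sets_P0 by (rule sets_eq_imp_space_eq)

lemma space_P1 [simp]: "space P1 = space \<mu>"
  using sets_P1 by (rule sets_eq_imp_space_eq)

lemma nn_integral_P0:
  assumes "f \<in> borel_measurable \<mu>"
  shows "(\<integral>\<^sup>+x. f x \<partial>P0) = (\<integral>\<^sup>+x. ennreal ((s0 x)\<^sup>2) * f x \<partial>\<mu>)"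
  by (subst density_s0[symmetric], rule nn_integral_density) (use assms in auto)

lemma nn_integral_P1:
  assumes "f \<in> borel_measurable \<mu>"
  shows "(\<integral>\<^sup>+x. f x \<partial>P1) = (\<integral>\<^sup>+x. ennreal ((s1 x)\<^sup>2) * f x \<partial>\<mu>)"
  by (subst density_s1[symmetric], rule nn_integral_density) (use assms in auto)

lemma P0_integrable:
  fixes f :: "'x \<Rightarrow> 'b::{banach, second_countable_topology}"
  assumes "f \<in> borel_measurable \<mu>"
  shows "integrable P0 f \<longleftrightarrow> integrable \<mu> (\<lambda>x. (s0 x)\<^sup>2 *\<^sub>R f x)"
  by (subst density_s0[symmetric], rule integrable_density) (use assms in auto)

lemma P1_integrable:
  fixes f :: "'x \<Rightarrow> 'b::{banach, second_countable_topology}"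
  assumes "f \<in> borel_measurable \<mu>"
  shows "integrable P1 f \<longleftrightarrow> integrable \<mu> (\<lambda>x. (s1 x)\<^sup>2 *\<^sub>R f x)"
  by (subst density_s1[symmetric], rule integrable_density) (use assms in auto)

lemma P0_integral:
  fixes f :: "'x \<Rightarrow> 'b::{banach, second_countable_topology}"
  assumes "f \<in> borel_measurable \<mu>"
  shows "integral\<^sup>L P0 f = (\<integral>x. (s0 x)\<^sup>2 *\<^sub>R f x \<partial>\<mu>)"
  by (subst density_s0[symmetric], rule integral_density) (use assms in auto)

lemma P1_integral:
  fixes f :: "'x \<Rightarrow> 'b::{banach, second_countable_topology}"
  assumes "f \<in> borel_measurable \<mu>"
  shows "integral\<^sup>L P1 f = (\<integral>x. (s1 x)\<^sup>2 *\<^sub>R f x \<partial>\<mu>)"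
  by (subst density_s1[symmetric], rule integral_density) (use assms in auto)

lemma s0_square_integrable [simp]: "integrable \<mu> (\<lambda>x. (s0 x)\<^sup>2)" "(\<integral>x. (s0 x)\<^sup>2 \<partial>\<mu>) = 1"
proof -
  interpret P0: prob_space P0 by (rule prob_P0)
  show "integrable \<mu> (\<lambda>x. (s0 x)\<^sup>2)"
    using P0_integrable[of "\<lambda>_. 1::real"] by simp
  show "(\<integral>x. (s0 x)\<^sup>2 \<partial>\<mu>) = 1"
    using P0_integral[of "\<lambda>_. 1::real"] P0.prob_space by simp
qed

lemma s1_square_integrable [simp]: "integrable \<mu> (\<lambda>x. (s1 x)\<^sup>2)" "(\<integral>x. (s1 x)\<^sup>2 \<partial>\<mu>) = 1"
proof -
  interpret P1: prob_space P1 by (rule prob_P1)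
  show "integrable \<mu> (\<lambda>x. (s1 x)\<^sup>2)"
    using P1_integrable[of "\<lambda>_. 1::real"] by simp
  show "(\<integral>x. (s1 x)\<^sup>2 \<partial>\<mu>) = 1"
    using P1_integral[of "\<lambda>_. 1::real"] P1.prob_space by simp
qed

text \<open>Twice the squared Hellinger distance, in the normalization that bounds the latter by 1.\<close>

definition hellinger2 :: real where
  "hellinger2 = (\<integral>x. (s1 x - s0 x)\<^sup>2 \<partial>\<mu>)"

lemma integrable_root_diff_square: "integrable \<mu> (\<lambda>x. (s1 x - s0 x)\<^sup>2)"
proof (rule Bochner_Integration.integrable_bound)
  show "integrable \<mu> (\<lambda>x. 2 * (s1 x)\<^sup>2 + 2 * (s0 x)\<^sup>2)"
    by simp
  have "(a - b)\<^sup>2 \<le> 2 * a\<^sup>2 + 2 * b\<^sup>2" for a b :: real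
    using zero_le_power2[of "a + b"] by (simp add: power2_sum power2_diff)
  then show "AE x in \<mu>. norm ((s1 x - s0 x)\<^sup>2) \<le> norm (2 * (s1 x)\<^sup>2 + 2 * (s0 x)\<^sup>2)"
    by auto
qed simp

lemma hellinger2_nonneg: "0 \<le> hellinger2"
  unfolding hellinger2_def by simp

text \<open>On the good points the second measure has a bounded density with respect to the first.\<close>

definition good :: "'x \<Rightarrow> bool" where
  "good x \<longleftrightarrow> s1 x \<le> 2 * s0 x \<and> 0 < s0 x"

text \<open>The likelihood ratio of \<open>P1\<close> to \<open>P0\<close>, cut off to 0 outside the good points.\<close>

definition ratio :: "'x \<Rightarrow> real" where
  "ratio x = (if good x then (s1 x)\<^sup>2 / (s0 x)\<^sup>2 else 0)"

lemma good_measurable [measurable]: "Measurable.pred \<mu> good"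
  unfolding good_def[abs_def] by measurable

lemma ratio_measurable [measurable]: "ratio \<in> borel_measurable \<mu>"
  unfolding ratio_def[abs_def] by measurable

lemma ratio_nonneg: "0 \<le> ratio x"
  by (simp add: ratio_def)

lemma density_ratio:
  "density P0 (\<lambda>x. ennreal (ratio x)) = density P1 (indicator {x\<in>space \<mu>. good x})"
proof -
  have "density P0 (\<lambda>x. ennreal (ratio x)) = density \<mu> (\<lambda>x. ennreal ((s0 x)\<^sup>2) * ennreal (ratio x))"
    unfolding density_s0[symmetric] by (rule density_density_eq) measurable
  also have "\<dots> = density \<mu> (\<lambda>x. ennreal ((s1 x)\<^sup>2) * indicator {x\<in>space \<mu>. good x} x)"
    by (intro density_cong) (auto simp: ratio_def good_def ennreal_mult[symmetric] indicator_def)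
  also have "\<dots> = density P1 (indicator {x\<in>space \<mu>. good x})"
    unfolding density_s1[symmetric] by (rule density_density_eq[symmetric]) measurable
  finally show ?thesis .
qed

text \<open>With \<open>w = s1 / s0 - 1\<close> the ratio is \<open>(1 + w)\<^sup>2\<close>, and \<open>(1 + w)\<^sup>4 \<le> 2 (1 + w)\<^sup>2 - 1 + 10 w\<^sup>2\<close> for \<open>\<bar>w\<bar> \<le> 1\<close>.
  The right-hand side has no linear term in \<open>w\<close> left after integration, because \<open>(1 + w)\<^sup>2\<close> integrates to a mass at most 1.\<close>

lemma ratio_second_moment:
  "(\<integral>\<^sup>+x. ennreal ((ratio x)\<^sup>2) \<partial>P0) \<le> ennreal (1 + 10 * hellinger2)"
proof -
  have pointwise: "(s0 x)\<^sup>2 * (ratio x)\<^sup>2 \<le> 2 * (s1 x)\<^sup>2 - (s0 x)\<^sup>2 + 10 * (s1 x - s0 x)\<^sup>2" for x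
  proof (cases "good x")
    case True
    then have pos: "0 < s0 x"
      by (simp add: good_def)
    define w where "w = s1 x / s0 x - 1"
    have w: "-1 \<le> w" "w \<le> 1"
      using True pos s1_nonneg[of x] by (simp_all add: w_def good_def field_simps)
    have s1_eq: "s1 x = (1 + w) * s0 x"
      using pos by (simp add: w_def)
    have "(1 + w) ^ 4 \<le> 2 * (1 + w)\<^sup>2 - 1 + 10 * w\<^sup>2"
    proof -
      have "w\<^sup>2 \<le> 1"
        using w by (simp add: abs_square_le_1 abs_le_iff)
      then have "w * w\<^sup>2 \<le> 1 * w\<^sup>2" "w\<^sup>2 * w\<^sup>2 \<le> 1 * w\<^sup>2"
        using mult_right_mono[OF w(2), of "w\<^sup>2"] mult_right_mono[of "w\<^sup>2" 1 "w\<^sup>2"] by simp_all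
      then have "w ^ 3 \<le> w\<^sup>2" "w ^ 4 \<le> w\<^sup>2"
        by (simp_all add: numeral_eq_Suc)
      moreover have "(1 + w) ^ 4 = 1 + 4 * w + 6 * w\<^sup>2 + 4 * w ^ 3 + w ^ 4"
        by algebra
      moreover have "2 * (1 + w)\<^sup>2 - 1 + 10 * w\<^sup>2 = 1 + 4 * w + 12 * w\<^sup>2"
        by algebra
      ultimately show ?thesis
        using zero_le_power2[of w] by linarith
    qed
    then have "(s0 x)\<^sup>2 * (1 + w) ^ 4 \<le> (s0 x)\<^sup>2 * (2 * (1 + w)\<^sup>2 - 1 + 10 * w\<^sup>2)"
      by (rule mult_left_mono) simp
    moreover have "(s0 x)\<^sup>2 * (ratio x)\<^sup>2 = (s0 x)\<^sup>2 * (1 + w) ^ 4"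
      using True pos by (simp add: ratio_def s1_eq power_mult_distrib flip: power_mult)
    moreover have "(s0 x)\<^sup>2 * (2 * (1 + w)\<^sup>2 - 1 + 10 * w\<^sup>2) =
        2 * (s1 x)\<^sup>2 - (s0 x)\<^sup>2 + 10 * (s1 x - s0 x)\<^sup>2"
      unfolding s1_eq by algebra
    ultimately show ?thesis
      by metis
  next
    case False
    then have "2 * s0 x \<le> s1 x"
      using s0_nonneg[of x] s1_nonneg[of x] by (auto simp: good_def)
    then have "(s0 x)\<^sup>2 \<le> (s1 x)\<^sup>2"
      using s0_nonneg[of x] by (intro power_mono) auto
    then have "0 \<le> 2 * (s1 x)\<^sup>2 - (s0 x)\<^sup>2"
      using zero_le_power2[of "s1 x"] by linarith
    then have "0 \<le> 2 * (s1 x)\<^sup>2 - (s0 x)\<^sup>2 + 10 * (s1 x - s0 x)\<^sup>2"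
      by (intro add_nonneg_nonneg) auto
    then show ?thesis
      using False unfolding ratio_def by simp
  qed
  have "(\<integral>\<^sup>+x. ennreal ((ratio x)\<^sup>2) \<partial>P0) = (\<integral>\<^sup>+x. ennreal ((s0 x)\<^sup>2 * (ratio x)\<^sup>2) \<partial>\<mu>)"
    by (subst nn_integral_P0) (auto simp: ennreal_mult)
  also have "\<dots> \<le> (\<integral>\<^sup>+x. ennreal (2 * (s1 x)\<^sup>2 - (s0 x)\<^sup>2 + 10 * (s1 x - s0 x)\<^sup>2) \<partial>\<mu>)"
    using pointwise by (intro nn_integral_mono ennreal_leI)
  also have "\<dots> = ennreal (\<integral>x. 2 * (s1 x)\<^sup>2 - (s0 x)\<^sup>2 + 10 * (s1 x - s0 x)\<^sup>2 \<partial>\<mu>)"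
  proof (rule nn_integral_eq_integral)
    show "AE x in \<mu>. 0 \<le> 2 * (s1 x)\<^sup>2 - (s0 x)\<^sup>2 + 10 * (s1 x - s0 x)\<^sup>2"
      using pointwise by (intro AE_I2) (meson mult_nonneg_nonneg order_trans zero_le_power2)
  qed (simp add: integrable_root_diff_square)
  also have "(\<integral>x. 2 * (s1 x)\<^sup>2 - (s0 x)\<^sup>2 + 10 * (s1 x - s0 x)\<^sup>2 \<partial>\<mu>) = 1 + 10 * hellinger2"
    by (simp add: integrable_root_diff_square hellinger2_def)
  finally show ?thesis .
qed

text \<open>A point that is not good has \<open>s0 \<le> s1 - s0\<close>. If the score \<open>\<gamma>\<close> is at most 1 there, the linear term \<open>\<gamma> s0 / 2\<close> explains at most half of
  \<open>s1 - s0\<close>, so the remainder must account for the rest; otherwise the score itself is large.\<close>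

lemma prob_not_good:
  assumes [measurable]: "\<gamma> \<in> borel_measurable \<mu>"
  shows "emeasure P1 {x\<in>space \<mu>. \<not> good x} \<le>
    16 * (\<integral>\<^sup>+x. ennreal ((s1 x - s0 x - 1 / 2 * \<gamma> x * s0 x)\<^sup>2) \<partial>\<mu>)
    + 2 * (\<integral>\<^sup>+x. ennreal ((\<gamma> x)\<^sup>2 * indicator {y. 1 < \<bar>\<gamma> y\<bar>} x) \<partial>P0)"
proof -
  define r where "r x = s1 x - s0 x - 1 / 2 * \<gamma> x * s0 x" for x
  have [measurable]: "r \<in> borel_measurable \<mu>"
    unfolding r_def[abs_def] by measurable
  have pointwise: "(s1 x)\<^sup>2 \<le> 16 * (r x)\<^sup>2 + 2 * ((s0 x)\<^sup>2 * ((\<gamma> x)\<^sup>2 * indicator {y. 1 < \<bar>\<gamma> y\<bar>} x))"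
    if "\<not> good x" for x
  proof -
    have le: "2 * s0 x \<le> s1 x"
      using that s0_nonneg[of x] s1_nonneg[of x] by (auto simp: good_def)
    then have half: "s1 x \<le> 2 * (s1 x - s0 x)" "s0 x \<le> s1 x - s0 x"
      by auto
    have d: "s1 x - s0 x = r x + 1 / 2 * \<gamma> x * s0 x"
      by (simp add: r_def)
    show ?thesis
    proof (cases "\<bar>\<gamma> x\<bar> \<le> 1")
      case True
      then have "\<gamma> x * s0 x \<le> 1 * s0 x"
        using s0_nonneg[of x] by (intro mult_right_mono) auto
      then have "s1 x \<le> 4 * r x"
        using d half by linarith
      then have "(s1 x)\<^sup>2 \<le> (4 * r x)\<^sup>2"
        using s1_nonneg[of x] by (intro power_mono) auto
      then show ?thesis
        using True by (simp add: power_mult_distrib)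
    next
      case False
      have "(s1 x)\<^sup>2 \<le> (2 * (r x + 1 / 2 * \<gamma> x * s0 x))\<^sup>2"
        using s1_nonneg[of x] half d by (intro power_mono) auto
      also have "\<dots> \<le> 8 * (r x)\<^sup>2 + 2 * ((s0 x)\<^sup>2 * (\<gamma> x)\<^sup>2)"
        using zero_le_power2[of "2 * r x - \<gamma> x * s0 x"] by (simp add: power2_eq_square algebra_simps)
      also have "\<dots> \<le> 16 * (r x)\<^sup>2 + 2 * ((s0 x)\<^sup>2 * (\<gamma> x)\<^sup>2)"
        by simp
      finally show ?thesis
        using False by simp
    qed
  qed
  have "emeasure P1 {x\<in>space \<mu>. \<not> good x} = (\<integral>\<^sup>+x. indicator {x\<in>space \<mu>. \<not> good x} x \<partial>P1)"
    by (rule nn_integral_indicator[symmetric]) measurable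
  also have "\<dots> = (\<integral>\<^sup>+x. ennreal ((s1 x)\<^sup>2) * indicator {x\<in>space \<mu>. \<not> good x} x \<partial>\<mu>)"
    by (rule nn_integral_P1) measurable
  also have "\<dots> \<le> (\<integral>\<^sup>+x. 16 * ennreal ((r x)\<^sup>2)
      + 2 * (ennreal ((s0 x)\<^sup>2) * ennreal ((\<gamma> x)\<^sup>2 * indicator {y. 1 < \<bar>\<gamma> y\<bar>} x)) \<partial>\<mu>)"
  proof (rule nn_integral_mono)
    fix x
    have "ennreal ((s1 x)\<^sup>2) \<le> ennreal (16 * (r x)\<^sup>2 + 2 * ((s0 x)\<^sup>2 * ((\<gamma> x)\<^sup>2 * indicator {y. 1 < \<bar>\<gamma> y\<bar>} x)))"
      if "\<not> good x"
      using pointwise[OF that] by (rule ennreal_leI)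
    also have "ennreal (16 * (r x)\<^sup>2 + 2 * ((s0 x)\<^sup>2 * ((\<gamma> x)\<^sup>2 * indicator {y. 1 < \<bar>\<gamma> y\<bar>} x))) =
        16 * ennreal ((r x)\<^sup>2)
        + 2 * (ennreal ((s0 x)\<^sup>2) * ennreal ((\<gamma> x)\<^sup>2 * indicator {y. 1 < \<bar>\<gamma> y\<bar>} x))"
      by (simp add: ennreal_mult ennreal_numeral[symmetric] del: ennreal_numeral)
    finally show "ennreal ((s1 x)\<^sup>2) * indicator {x\<in>space \<mu>. \<not> good x} x \<le> 16 * ennreal ((r x)\<^sup>2)
        + 2 * (ennreal ((s0 x)\<^sup>2) * ennreal ((\<gamma> x)\<^sup>2 * indicator {y. 1 < \<bar>\<gamma> y\<bar>} x))"
      by (auto simp: indicator_def)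
  qed
  also have "\<dots> = 16 * (\<integral>\<^sup>+x. ennreal ((r x)\<^sup>2) \<partial>\<mu>)
      + 2 * (\<integral>\<^sup>+x. ennreal ((\<gamma> x)\<^sup>2 * indicator {y. 1 < \<bar>\<gamma> y\<bar>} x) \<partial>P0)"
    by (subst nn_integral_P0) (auto simp: nn_integral_add nn_integral_cmult)
  finally show ?thesis
    by (simp add: r_def)
qed

end

lemma PiM_density:
  fixes f :: "'x \<Rightarrow> ennreal"
  assumes I: "finite I" and M: "sigma_finite_measure M" and f[measurable]: "f \<in> borel_measurable M"
    and Mf: "sigma_finite_measure (density M f)"
  shows "density (PiM I (\<lambda>_. M)) (\<lambda>x. \<Prod>i\<in>I. f (x i)) = PiM I (\<lambda>_. density M f)"
proof -
  interpret M: product_sigma_finite "\<lambda>_. M"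
    by (intro product_sigma_finite.intro M)
  interpret Mf: product_sigma_finite "\<lambda>_. density M f"
    by (intro product_sigma_finite.intro Mf)
  show ?thesis
  proof (rule Mf.PiM_eqI[OF I])
    show "sets (density (PiM I (\<lambda>_. M)) (\<lambda>x. \<Prod>i\<in>I. f (x i))) = sets (PiM I (\<lambda>_. density M f))"
      unfolding sets_density by (rule sets_PiM_cong) auto
  next
    fix A
    assume "\<And>i. i \<in> I \<Longrightarrow> A i \<in> sets (density M f)"
    then have A[measurable]: "\<And>i. i \<in> I \<Longrightarrow> A i \<in> sets M"
      by simp
    have "emeasure (density (PiM I (\<lambda>_. M)) (\<lambda>x. \<Prod>i\<in>I. f (x i))) (Pi\<^sub>E I A) =
        (\<integral>\<^sup>+x. (\<Prod>i\<in>I. f (x i)) * indicator (Pi\<^sub>E I A) x \<partial>PiM I (\<lambda>_. M))"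
      using I A by (intro emeasure_density sets_PiM_I_finite) auto
    also have "\<dots> = (\<integral>\<^sup>+x. (\<Prod>i\<in>I. f (x i) * indicator (A i) (x i)) \<partial>PiM I (\<lambda>_. M))"
    proof (rule nn_integral_cong)
      fix x
      assume x: "x \<in> space (PiM I (\<lambda>_. M))"
      have "indicator (Pi\<^sub>E I A) x = (\<Prod>i\<in>I. indicator (A i) (x i) :: ennreal)"
      proof (cases "x \<in> Pi\<^sub>E I A")
        case True
        then show ?thesis
          by (auto simp: PiE_iff intro!: prod.neutral[symmetric])
      next
        case False
        with x obtain i where "i \<in> I" "x i \<notin> A i"
          by (auto simp: space_PiM PiE_iff)
        then have "(\<Prod>i\<in>I. indicator (A i) (x i) :: ennreal) = 0"
          using I by (intro prod_zero bexI[of _ i]) auto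
        with False show ?thesis
          by simp
      qed
      then show "(\<Prod>i\<in>I. f (x i)) * indicator (Pi\<^sub>E I A) x = (\<Prod>i\<in>I. f (x i) * indicator (A i) (x i))"
        by (simp add: prod.distrib)
    qed
    also have "\<dots> = (\<Prod>i\<in>I. \<integral>\<^sup>+x. f x * indicator (A i) x \<partial>M)"
      using I A by (intro M.product_nn_integral_prod) auto
    also have "\<dots> = (\<Prod>i\<in>I. emeasure (density M f) (A i))"
      using A by (intro prod.cong refl emeasure_density[symmetric]) auto
    finally show "emeasure (density (PiM I (\<lambda>_. M)) (\<lambda>x. \<Prod>i\<in>I. f (x i))) (Pi\<^sub>E I A) =
        (\<Prod>i\<in>I. emeasure (density M f) (A i))" .
  qed
qed

context root_densities
begin

text \<open>Either some observation is not good, which costs the first term, or the likelihood ratio \<open>l\<close> of the sample is the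
  product of the truncated ratios. The splitting \<open>l \<le> K + l\<^sup>2 / K\<close> bounds that part linearly in the
  \<open>P0\<close>-probability of \<open>B\<close>. Linearity lets the bound pass through an integration over independent noise.\<close>

lemma contiguity_bound:
  assumes I: "finite I" and B: "B \<in> sets (PiM I (\<lambda>_. \<mu>))" and K: "0 < K"
  shows "emeasure (PiM I (\<lambda>_. P1)) B \<le> of_nat (card I) * emeasure P1 {x\<in>space \<mu>. \<not> good x}
    + ennreal K * emeasure (PiM I (\<lambda>_. P0)) B + ennreal ((1 + 10 * hellinger2) ^ card I / K)"
proof -
  interpret P0: prob_space P0 by (rule prob_P0)
  interpret P1: prob_space P1 by (rule prob_P1)
  interpret X0: product_prob_space "\<lambda>_. P0" I
    by (rule product_prob_spaceI) (rule prob_P0)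
  interpret X1: product_prob_space "\<lambda>_. P1" I
    by (rule product_prob_spaceI) (rule prob_P1)
  let ?X0 = "PiM I (\<lambda>_. P0)" and ?X1 = "PiM I (\<lambda>_. P1)" and ?G = "{x\<in>space \<mu>. good x}"
  have setsX: "sets ?X0 = sets (PiM I (\<lambda>_. \<mu>))" "sets ?X1 = sets (PiM I (\<lambda>_. \<mu>))"
    by (intro sets_PiM_cong; simp)+
  have B0[measurable]: "B \<in> sets ?X0" and B1[measurable]: "B \<in> sets ?X1"
    using B setsX by auto
  have sub: "sigma_finite_measure (density P1 (indicator ?G))"
  proof -
    have "emeasure (density P1 (indicator ?G)) (space \<mu>) = (\<integral>\<^sup>+x. indicator ?G x * indicator (space \<mu>) x \<partial>P1)"
      by (rule emeasure_density) auto
    also have "\<dots> \<le> (\<integral>\<^sup>+x. 1 \<partial>P1)"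
      by (intro nn_integral_mono) (auto simp: indicator_def)
    also have "\<dots> = 1"
      using P1.emeasure_space_1 by simp
    finally have "emeasure (density P1 (indicator ?G)) (space \<mu>) \<le> 1" .
    then have "finite_measure (density P1 (indicator ?G))"
      by (intro finite_measureI) (auto simp: top_unique)
    then show ?thesis
      by (simp add: finite_measure_def)
  qed
  have eq: "density ?X1 (\<lambda>x. \<Prod>i\<in>I. indicator ?G (x i)) = density ?X0 (\<lambda>x. \<Prod>i\<in>I. ennreal (ratio (x i)))"
    using PiM_density[OF I P1.sigma_finite_measure_axioms _ sub]
      PiM_density[OF I P0.sigma_finite_measure_axioms, of "\<lambda>x. ennreal (ratio x)"] sub
    by (simp add: density_ratio)
  have "emeasure ?X1 B = (\<integral>\<^sup>+x. indicator B x \<partial>?X1)"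
    by simp
  also have "\<dots> \<le> (\<integral>\<^sup>+x. (\<Sum>i\<in>I. indicator {x\<in>space \<mu>. \<not> good x} (x i))
      + (\<Prod>i\<in>I. indicator ?G (x i)) * indicator B x \<partial>?X1)"
  proof (rule nn_integral_mono)
    fix x
    assume "x \<in> space ?X1"
    then have x: "x i \<in> space \<mu>" if "i \<in> I" for i
      using that by (auto simp: space_PiM)
    show "indicator B x \<le> (\<Sum>i\<in>I. indicator {x\<in>space \<mu>. \<not> good x} (x i) :: ennreal)
      + (\<Prod>i\<in>I. indicator ?G (x i)) * indicator B x"
    proof (cases "\<forall>i\<in>I. good (x i)")
      case True
      then have "(\<Prod>i\<in>I. indicator ?G (x i) :: ennreal) = 1"
        using x by (intro prod.neutral) auto
      then show ?thesis
        by simp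
    next
      case False
      then obtain j where "j \<in> I" "\<not> good (x j)"
        by blast
      then have "(1::ennreal) \<le> (\<Sum>i\<in>I. indicator {x\<in>space \<mu>. \<not> good x} (x i))"
        using I x member_le_sum[of j I "\<lambda>i. indicator {x\<in>space \<mu>. \<not> good x} (x i) :: ennreal"] by auto
      then show ?thesis
        by (auto simp: indicator_def intro: order_trans add_increasing2)
    qed
  qed
  also have "\<dots> = (\<Sum>i\<in>I. \<integral>\<^sup>+x. indicator {x\<in>space \<mu>. \<not> good x} (x i) \<partial>?X1)
      + (\<integral>\<^sup>+x. (\<Prod>i\<in>I. indicator ?G (x i)) * indicator B x \<partial>?X1)"
    by (subst nn_integral_add) (auto simp: nn_integral_sum)
  also have "(\<Sum>i\<in>I. \<integral>\<^sup>+x. indicator {x\<in>space \<mu>. \<not> good x} (x i) \<partial>?X1) =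
      of_nat (card I) * emeasure P1 {x\<in>space \<mu>. \<not> good x}"
  proof -
    have "(\<integral>\<^sup>+x. indicator {x\<in>space \<mu>. \<not> good x} (x i) \<partial>?X1) = emeasure P1 {x\<in>space \<mu>. \<not> good x}"
      if "i \<in> I" for i
    proof -
      have "(\<integral>\<^sup>+x. indicator {x\<in>space \<mu>. \<not> good x} (x i) \<partial>?X1) =
          (\<integral>\<^sup>+x. indicator {x\<in>space \<mu>. \<not> good x} x \<partial>distr ?X1 P1 (\<lambda>x. x i))"
        using that by (intro nn_integral_distr[symmetric]) measurable
      also have "distr ?X1 P1 (\<lambda>x. x i) = P1"
        using X1.PiM_component[OF that] by simp
      finally show ?thesis
        by simp
    qed
    then show ?thesis
      by simp
  qed
  also have "(\<integral>\<^sup>+x. (\<Prod>i\<in>I. indicator ?G (x i)) * indicator B x \<partial>?X1) =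
      (\<integral>\<^sup>+x. (\<Prod>i\<in>I. ennreal (ratio (x i))) * indicator B x \<partial>?X0)"
    using arg_cong[OF eq, of "\<lambda>M. emeasure M B"] B0 B1 by (simp add: emeasure_density)
  also have "\<dots> \<le> (\<integral>\<^sup>+x. ennreal K * indicator B x + ennreal (1 / K) * (\<Prod>i\<in>I. ennreal ((ratio (x i))\<^sup>2)) \<partial>?X0)"
  proof (rule nn_integral_mono)
    fix x
    define l where "l = (\<Prod>i\<in>I. ratio (x i))"
    have "0 \<le> l"
      unfolding l_def by (intro prod_nonneg ratio_nonneg)
    have "l \<le> K + 1 / K * l\<^sup>2"
    proof (cases "l \<le> K")
      case True
      have "0 \<le> 1 / K * l\<^sup>2" using K by simp
      with True show ?thesis by linarith
    next
      case False
      then have "K * l \<le> l * l"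
        using \<open>0 \<le> l\<close> by (intro mult_right_mono) auto
      then have "l \<le> 1 / K * l\<^sup>2"
        using K by (simp add: field_simps power2_eq_square)
      with K show ?thesis by linarith
    qed
    then have "ennreal l \<le> ennreal K + ennreal (1 / K) * ennreal (l\<^sup>2)"
      using K by (simp add: ennreal_mult[symmetric] ennreal_plus[symmetric] del: ennreal_plus)
    moreover have "(\<Prod>i\<in>I. ennreal (ratio (x i))) = ennreal l"
      unfolding l_def by (intro prod_ennreal ratio_nonneg)
    moreover have "(\<Prod>i\<in>I. ennreal ((ratio (x i))\<^sup>2)) = ennreal (l\<^sup>2)"
      unfolding l_def by (simp add: prod_ennreal prod_power_distrib)
    ultimately show "(\<Prod>i\<in>I. ennreal (ratio (x i))) * indicator B x \<le>
        ennreal K * indicator B x + ennreal (1 / K) * (\<Prod>i\<in>I. ennreal ((ratio (x i))\<^sup>2))"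
      by (auto simp: indicator_def)
  qed
  also have "\<dots> = ennreal K * emeasure ?X0 B
      + ennreal (1 / K) * (\<integral>\<^sup>+x. (\<Prod>i\<in>I. ennreal ((ratio (x i))\<^sup>2)) \<partial>?X0)"
    by (subst nn_integral_add) (auto simp: nn_integral_cmult)
  also have "(\<integral>\<^sup>+x. (\<Prod>i\<in>I. ennreal ((ratio (x i))\<^sup>2)) \<partial>?X0) = (\<integral>\<^sup>+x. ennreal ((ratio x)\<^sup>2) \<partial>P0) ^ card I"
    by (subst X0.product_nn_integral_prod) (use I in auto)
  also have "\<dots> \<le> ennreal (1 + 10 * hellinger2) ^ card I"
    by (intro power_mono ratio_second_moment) simp
  also have "ennreal (1 / K) * ennreal (1 + 10 * hellinger2) ^ card I = ennreal ((1 + 10 * hellinger2) ^ card I / K)"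
    using K hellinger2_nonneg
    by (simp add: ennreal_power ennreal_mult[symmetric] del: ennreal_plus)
  finally show ?thesis
    by (simp add: add.assoc add_mono mult_left_mono)
qed

end

section \<open>Change of expectation along a score\<close>

context root_densities
begin

text \<open>The pointwise error of the expansion of the root density with score \<open>\<gamma>\<close>, as in the definition of quadratic
  mean differentiability.\<close>

definition score_remainder :: "('x \<Rightarrow> real) \<Rightarrow> 'x \<Rightarrow> real" where
  "score_remainder \<gamma> x = s1 x - s0 x - 1 / 2 * \<gamma> x * s0 x"

lemma measurable_score_remainder [measurable]:
  assumes [measurable]: "\<gamma> \<in> borel_measurable \<mu>"
  shows "score_remainder \<gamma> \<in> borel_measurable \<mu>"
  unfolding score_remainder_def[abs_def] by measurable

context
  fixes \<gamma> :: "'x \<Rightarrow> real"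
  assumes \<gamma>[measurable]: "\<gamma> \<in> borel_measurable \<mu>"
    and finite_remainder: "(\<integral>\<^sup>+x. ennreal ((score_remainder \<gamma> x)\<^sup>2) \<partial>\<mu>) < \<infinity>"
begin

lemma remainder_square_integrable: "integrable \<mu> (\<lambda>x. (score_remainder \<gamma> x)\<^sup>2)"
  using finite_remainder by (intro integrableI_nonneg) auto

lemma integral_remainder_square:
  "(\<integral>x. (score_remainder \<gamma> x)\<^sup>2 \<partial>\<mu>) = enn2real (\<integral>\<^sup>+x. ennreal ((score_remainder \<gamma> x)\<^sup>2) \<partial>\<mu>)"
  by (rule integral_eq_nn_integral) auto

lemma score_square_integrable: "integrable P0 (\<lambda>x. (\<gamma> x)\<^sup>2)"
proof -
  have "integrable \<mu> (\<lambda>x. (s0 x)\<^sup>2 *\<^sub>R (\<gamma> x)\<^sup>2)"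
  proof (rule Bochner_Integration.integrable_bound)
    show "integrable \<mu> (\<lambda>x. 8 * (s1 x - s0 x)\<^sup>2 + 8 * (score_remainder \<gamma> x)\<^sup>2)"
      using integrable_root_diff_square remainder_square_integrable by simp
    have "(s0 x)\<^sup>2 * (\<gamma> x)\<^sup>2 \<le> 8 * (s1 x - s0 x)\<^sup>2 + 8 * (score_remainder \<gamma> x)\<^sup>2" for x
    proof -
      have "s0 x * \<gamma> x = 2 * ((s1 x - s0 x) - score_remainder \<gamma> x)"
        by (simp add: score_remainder_def)
      then have "(s0 x)\<^sup>2 * (\<gamma> x)\<^sup>2 = (2 * ((s1 x - s0 x) - score_remainder \<gamma> x))\<^sup>2"
        by (simp add: power_mult_distrib[symmetric])
      also have "\<dots> \<le> 8 * (s1 x - s0 x)\<^sup>2 + 8 * (score_remainder \<gamma> x)\<^sup>2"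
        using zero_le_power2[of "2 * ((s1 x - s0 x) + score_remainder \<gamma> x)"]
        by (simp add: power2_eq_square algebra_simps)
      finally show ?thesis .
    qed
    then show "AE x in \<mu>. norm ((s0 x)\<^sup>2 *\<^sub>R (\<gamma> x)\<^sup>2)
        \<le> norm (8 * (s1 x - s0 x)\<^sup>2 + 8 * (score_remainder \<gamma> x)\<^sup>2)"
      by (intro AE_I2) (simp add: abs_mult)
  qed measurable
  then show ?thesis
    by (simp add: P0_integrable)
qed

lemma s0_score_square_integrable:
  "integrable \<mu> (\<lambda>x. (s0 x)\<^sup>2 * (\<gamma> x)\<^sup>2)" "(\<integral>x. (s0 x)\<^sup>2 * (\<gamma> x)\<^sup>2 \<partial>\<mu>) = (\<integral>x. (\<gamma> x)\<^sup>2 \<partial>P0)"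
  using score_square_integrable P0_integrable[of "\<lambda>x. (\<gamma> x)\<^sup>2"] P0_integral[of "\<lambda>x. (\<gamma> x)\<^sup>2"]
  by simp_all

lemma root_diff_square_le:
  "(s1 x - s0 x)\<^sup>2 \<le> 2 * (score_remainder \<gamma> x)\<^sup>2 + 1 / 2 * ((s0 x)\<^sup>2 * (\<gamma> x)\<^sup>2)"
proof -
  have "s1 x - s0 x = score_remainder \<gamma> x + 1 / 2 * (s0 x * \<gamma> x)"
    by (simp add: score_remainder_def)
  moreover have "(a + 1 / 2 * b)\<^sup>2 \<le> 2 * a\<^sup>2 + 1 / 2 * b\<^sup>2" for a b :: real
    using zero_le_power2[of "a - 1 / 2 * b"] by (simp add: power2_eq_square algebra_simps)
  ultimately show ?thesis
    by (simp add: power_mult_distrib[symmetric])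
qed

lemma hellinger2_le:
  "hellinger2 \<le> 2 * (\<integral>x. (score_remainder \<gamma> x)\<^sup>2 \<partial>\<mu>) + 1 / 2 * (\<integral>x. (\<gamma> x)\<^sup>2 \<partial>P0)"
proof -
  have "hellinger2 \<le> (\<integral>x. 2 * (score_remainder \<gamma> x)\<^sup>2 + 1 / 2 * ((s0 x)\<^sup>2 * (\<gamma> x)\<^sup>2) \<partial>\<mu>)"
    unfolding hellinger2_def
    using remainder_square_integrable s0_score_square_integrable(1)
    by (intro integral_mono integrable_root_diff_square root_diff_square_le
        Bochner_Integration.integrable_add integrable_mult_right)
  also have "\<dots> = 2 * (\<integral>x. (score_remainder \<gamma> x)\<^sup>2 \<partial>\<mu>) + 1 / 2 * (\<integral>x. (\<gamma> x)\<^sup>2 \<partial>P0)"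
    using remainder_square_integrable s0_score_square_integrable by simp
  finally show ?thesis .
qed

text \<open>The difference of the densities is \<open>s1\<^sup>2 - s0\<^sup>2 = \<gamma> s0\<^sup>2 + 2 r s0 + (s1 - s0)\<^sup>2\<close> with \<open>r\<close> the remainder. The first
  summand gives the linear term. In the applications \<open>e\<close> is small like \<open>a\<close>; the free parameter \<open>\<tau>\<close> balances the product of
  \<open>a s0\<close> and \<open>r\<close>, whose squares have integrals of order \<open>1/n\<close> and \<open>o(1/n)\<close>.\<close>

lemma expectation_change:
  fixes e :: "'x \<Rightarrow> complex" and a :: "'x \<Rightarrow> real"
  assumes e[measurable]: "e \<in> borel_measurable \<mu>" and e2: "\<And>x. cmod (e x) \<le> 2"
    and ea: "\<And>x. cmod (e x) \<le> \<bar>a x\<bar>" and a[measurable]: "a \<in> borel_measurable \<mu>"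
    and a2: "integrable P0 (\<lambda>x. (a x)\<^sup>2)" and \<tau>: "\<tau> > 0"
  shows "cmod ((\<integral>x. e x \<partial>P1) - (\<integral>x. e x \<partial>P0) - (\<integral>x. e x * \<gamma> x \<partial>P0)) \<le>
    \<tau> * (\<integral>x. (a x)\<^sup>2 \<partial>P0) + (1 / \<tau> + 4) * (\<integral>x. (score_remainder \<gamma> x)\<^sup>2 \<partial>\<mu>)
    + 1 / 2 * (\<integral>x. cmod (e x) * (\<gamma> x)\<^sup>2 \<partial>P0)"
proof -
  interpret P0: prob_space P0 by (rule prob_P0)
  interpret P1: prob_space P1 by (rule prob_P1)
  let ?r = "score_remainder \<gamma>"
  have e_int: "integrable P0 e" "integrable P1 e"
    using e2 by (auto intro!: P0.integrable_const_bound[of _ 2] P1.integrable_const_bound[of _ 2])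
  have \<gamma>_int: "integrable P0 \<gamma>"
    by (rule P0.square_integrable_imp_integrable[OF _ score_square_integrable]) measurable
  have e\<gamma>_int: "integrable P0 (\<lambda>x. e x * \<gamma> x)"
  proof (rule Bochner_Integration.integrable_bound)
    show "integrable P0 (\<lambda>x. 2 * \<gamma> x)"
      using \<gamma>_int by simp
    show "AE x in P0. norm (e x * complex_of_real (\<gamma> x)) \<le> norm (2 * \<gamma> x)"
      using e2 by (intro AE_I2) (auto simp: norm_mult abs_mult intro!: mult_right_mono)
  qed measurable
  have e\<gamma>2_int: "integrable P0 (\<lambda>x. cmod (e x) * (\<gamma> x)\<^sup>2)"
  proof (rule Bochner_Integration.integrable_bound)
    show "integrable P0 (\<lambda>x. 2 * (\<gamma> x)\<^sup>2)"
      using score_square_integrable by simp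
    show "AE x in P0. norm (cmod (e x) * (\<gamma> x)\<^sup>2) \<le> norm (2 * (\<gamma> x)\<^sup>2)"
      using e2 by (intro AE_I2) (auto simp: norm_mult intro!: mult_right_mono)
  qed measurable
  define b where "b x = \<tau> * ((s0 x)\<^sup>2 * (a x)\<^sup>2) + (1 / \<tau> + 4) * (?r x)\<^sup>2
    + 1 / 2 * ((s0 x)\<^sup>2 * (cmod (e x) * (\<gamma> x)\<^sup>2))" for x
  have ints: "integrable \<mu> (\<lambda>x. (s0 x)\<^sup>2 * (a x)\<^sup>2)" "integrable \<mu> (\<lambda>x. (s0 x)\<^sup>2 * (cmod (e x) * (\<gamma> x)\<^sup>2))"
    using P0_integrable[of "\<lambda>x. (a x)\<^sup>2"] P0_integrable[of "\<lambda>x. cmod (e x) * (\<gamma> x)\<^sup>2"] a2 e\<gamma>2_int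
    by simp_all
  have b_int: "integrable \<mu> b"
    unfolding b_def[abs_def] using ints remainder_square_integrable by simp
  have "(\<integral>x. e x \<partial>P1) - (\<integral>x. e x \<partial>P0) - (\<integral>x. e x * \<gamma> x \<partial>P0) =
      (\<integral>x. (s1 x)\<^sup>2 *\<^sub>R e x - (s0 x)\<^sup>2 *\<^sub>R e x - (s0 x)\<^sup>2 *\<^sub>R (e x * \<gamma> x) \<partial>\<mu>)"
    using e_int e\<gamma>_int by (simp add: P0_integral P1_integral P0_integrable P1_integrable)
  also have "cmod \<dots> \<le> (\<integral>x. b x \<partial>\<mu>)"
  proof (rule order_trans[OF integral_norm_bound integral_mono])
    show "integrable \<mu> (\<lambda>x. cmod ((s1 x)\<^sup>2 *\<^sub>R e x - (s0 x)\<^sup>2 *\<^sub>R e x - (s0 x)\<^sup>2 *\<^sub>R (e x * \<gamma> x)))"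
      using e_int e\<gamma>_int by (simp add: P0_integrable P1_integrable)
    show "integrable \<mu> b" by fact
    show "cmod ((s1 x)\<^sup>2 *\<^sub>R e x - (s0 x)\<^sup>2 *\<^sub>R e x - (s0 x)\<^sup>2 *\<^sub>R (e x * \<gamma> x)) \<le> b x" for x
    proof -
      have "(s1 x)\<^sup>2 - (s0 x)\<^sup>2 - (s0 x)\<^sup>2 * \<gamma> x = 2 * (?r x * s0 x) + (s1 x - s0 x)\<^sup>2"
        unfolding score_remainder_def by algebra
      moreover have "(s1 x)\<^sup>2 *\<^sub>R e x - (s0 x)\<^sup>2 *\<^sub>R e x - (s0 x)\<^sup>2 *\<^sub>R (e x * \<gamma> x) =
          ((s1 x)\<^sup>2 - (s0 x)\<^sup>2 - (s0 x)\<^sup>2 * \<gamma> x) *\<^sub>R e x"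
        by (simp add: scaleR_conv_of_real algebra_simps)
      ultimately have "cmod ((s1 x)\<^sup>2 *\<^sub>R e x - (s0 x)\<^sup>2 *\<^sub>R e x - (s0 x)\<^sup>2 *\<^sub>R (e x * \<gamma> x)) =
          \<bar>2 * (?r x * s0 x) + (s1 x - s0 x)\<^sup>2\<bar> * cmod (e x)"
        by simp
      also have "\<dots> \<le> (2 * (\<bar>?r x\<bar> * s0 x) + (s1 x - s0 x)\<^sup>2) * cmod (e x)"
      proof (rule mult_right_mono)
        have "\<bar>2 * (?r x * s0 x) + (s1 x - s0 x)\<^sup>2\<bar> \<le> \<bar>2 * (?r x * s0 x)\<bar> + \<bar>(s1 x - s0 x)\<^sup>2\<bar>"
          by (rule abs_triangle_ineq)
        also have "\<dots> = 2 * (\<bar>?r x\<bar> * s0 x) + (s1 x - s0 x)\<^sup>2"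
          using s0_nonneg[of x] by (simp add: abs_mult)
        finally show "\<bar>2 * (?r x * s0 x) + (s1 x - s0 x)\<^sup>2\<bar> \<le> 2 * (\<bar>?r x\<bar> * s0 x) + (s1 x - s0 x)\<^sup>2" .
      qed simp
      also have "\<dots> = 2 * \<bar>?r x\<bar> * (s0 x * cmod (e x)) + (s1 x - s0 x)\<^sup>2 * cmod (e x)"
        by (simp add: algebra_simps)
      also have "2 * \<bar>?r x\<bar> * (s0 x * cmod (e x)) \<le> \<tau> * ((s0 x)\<^sup>2 * (a x)\<^sup>2) + 1 / \<tau> * (?r x)\<^sup>2"
      proof -
        have "2 * \<bar>?r x\<bar> * (s0 x * cmod (e x)) \<le> 2 * \<bar>?r x\<bar> * (s0 x * \<bar>a x\<bar>)"
          using ea[of x] s0_nonneg[of x] by (intro mult_left_mono) auto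
        also have "\<dots> \<le> \<tau> * (s0 x * \<bar>a x\<bar>)\<^sup>2 + 1 / \<tau> * \<bar>?r x\<bar>\<^sup>2"
        proof -
          have "0 \<le> 1 / \<tau> * (\<tau> * (s0 x * \<bar>a x\<bar>) - \<bar>?r x\<bar>)\<^sup>2"
            using \<tau> by simp
          also have "\<dots> = \<tau> * (s0 x * \<bar>a x\<bar>)\<^sup>2 + 1 / \<tau> * \<bar>?r x\<bar>\<^sup>2 - 2 * \<bar>?r x\<bar> * (s0 x * \<bar>a x\<bar>)"
            using \<tau> by (simp add: power2_diff power_mult_distrib field_simps power2_eq_square)
          finally show ?thesis by simp
        qed
        finally show ?thesis
          by (simp add: power_mult_distrib)
      qed
      also have "(s1 x - s0 x)\<^sup>2 * cmod (e x) \<le> 4 * (?r x)\<^sup>2 + 1 / 2 * ((s0 x)\<^sup>2 * (cmod (e x) * (\<gamma> x)\<^sup>2))"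
      proof -
        have "(s1 x - s0 x)\<^sup>2 * cmod (e x) \<le> (2 * (?r x)\<^sup>2 + 1 / 2 * ((s0 x)\<^sup>2 * (\<gamma> x)\<^sup>2)) * cmod (e x)"
          by (intro mult_right_mono root_diff_square_le) simp
        also have "\<dots> = cmod (e x) * (2 * (?r x)\<^sup>2) + 1 / 2 * ((s0 x)\<^sup>2 * (cmod (e x) * (\<gamma> x)\<^sup>2))"
          by (simp add: algebra_simps)
        also have "cmod (e x) * (2 * (?r x)\<^sup>2) \<le> 2 * (2 * (?r x)\<^sup>2)"
          by (intro mult_right_mono e2) simp
        finally show ?thesis
          by simp
      qed
      finally show ?thesis
        by (simp add: b_def algebra_simps)
    qed
  qed
  also have "(\<integral>x. b x \<partial>\<mu>) = \<tau> * (\<integral>x. (a x)\<^sup>2 \<partial>P0) + (1 / \<tau> + 4) * (\<integral>x. (?r x)\<^sup>2 \<partial>\<mu>)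
      + 1 / 2 * (\<integral>x. cmod (e x) * (\<gamma> x)\<^sup>2 \<partial>P0)"
    unfolding b_def using ints remainder_square_integrable
    by (simp add: P0_integral)
  finally show ?thesis .
qed

end

end

lemma integrable_mult_of_squares:
  fixes f g :: "'a \<Rightarrow> real"
  assumes [measurable]: "f \<in> borel_measurable M" "g \<in> borel_measurable M"
    and "integrable M (\<lambda>x. (f x)\<^sup>2)" "integrable M (\<lambda>x. (g x)\<^sup>2)"
  shows "integrable M (\<lambda>x. f x * g x)"
proof (rule Bochner_Integration.integrable_bound)
  show "integrable M (\<lambda>x. (f x)\<^sup>2 + (g x)\<^sup>2)"
    using assms by simp
  have "\<bar>a * b\<bar> \<le> a\<^sup>2 + b\<^sup>2" for a b :: real
  proof -
    have "2 * \<bar>a * b\<bar> \<le> a\<^sup>2 + b\<^sup>2"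
      using zero_le_power2[of "\<bar>a\<bar> - \<bar>b\<bar>"] by (simp add: power2_diff abs_mult)
    then show ?thesis
      using abs_ge_zero[of "a * b"] by linarith
  qed
  then show "AE x in M. norm (f x * g x) \<le> norm ((f x)\<^sup>2 + (g x)\<^sup>2)"
    by simp
qed measurable

lemma norm_exp_minus_linear_le:
  fixes z :: complex
  shows "cmod (exp z - 1 - z) \<le> exp (cmod z) * (cmod z)\<^sup>2"
  using Taylor_exp_field[of z 1] by (simp add: power2_eq_square algebra_simps)

text \<open>Both \<open>z\<^sub>n\<close> and \<open>exp(u\<^sub>n / n)\<close> lie in the unit disc, where taking \<open>n\<close>-th powers multiplies distances by at most \<open>n\<close>. Boundedness
  of \<open>u\<^sub>n\<close>, in place of convergence, lets it follow an arbitrary bounded sequence of local parameters.\<close>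

lemma power_tendsto_exp:
  fixes z u :: "nat \<Rightarrow> complex"
  assumes z: "\<And>n. cmod (z n) \<le> 1"
    and zu: "(\<lambda>n. of_nat n * (z n - 1) - u n) \<longlonglongrightarrow> 0"
    and u: "\<And>n. cmod (u n) \<le> C" "\<And>n. Re (u n) \<le> 0"
  shows "(\<lambda>n. z n ^ n - exp (u n)) \<longlonglongrightarrow> 0"
proof (rule Lim_null_comparison)
  have "0 \<le> C"
    using u(1) norm_ge_zero order_trans by blast
  show "\<forall>\<^sub>F n in sequentially. norm (z n ^ n - exp (u n)) \<le>
      cmod (of_nat n * (z n - 1) - u n) + exp C * C\<^sup>2 * inverse (real n)"
  proof (rule eventually_sequentiallyI[of 1])
    fix n :: nat
    assume n: "1 \<le> n"
    let ?w = "u n / of_nat n"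
    have w: "cmod ?w \<le> C / real n" "C / real n \<le> C"
      using u(1)[of n] n \<open>0 \<le> C\<close> by (auto simp: norm_divide divide_right_mono field_simps mult_le_cancel_left1)
    have "cmod (exp ?w) \<le> 1"
      using u(2)[of n] n by (simp add: divide_le_0_iff)
    then have "cmod (z n ^ n - exp ?w ^ n) \<le> real n * cmod (z n - exp ?w)"
      by (intro norm_power_diff z)
    also have "\<dots> = cmod (of_nat n * (z n - exp ?w))"
      by (simp add: norm_mult)
    also have "of_nat n * (z n - exp ?w) = (of_nat n * (z n - 1) - u n) - of_nat n * (exp ?w - 1 - ?w)"
      using n by (simp add: algebra_simps)
    also have "cmod \<dots> \<le> cmod (of_nat n * (z n - 1) - u n) + cmod (of_nat n * (exp ?w - 1 - ?w))"
      by (rule norm_triangle_ineq4)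
    also have "cmod (of_nat n * (exp ?w - 1 - ?w)) \<le> real n * (exp C * (C / real n)\<^sup>2)"
    proof -
      have "cmod (exp ?w - 1 - ?w) \<le> exp (cmod ?w) * (cmod ?w)\<^sup>2"
        by (rule norm_exp_minus_linear_le)
      also have "\<dots> \<le> exp C * (C / real n)\<^sup>2"
        using w by (intro mult_mono power_mono) auto
      finally show ?thesis
        by (simp add: norm_mult mult_left_mono)
    qed
    also have "real n * (exp C * (C / real n)\<^sup>2) = exp C * C\<^sup>2 * inverse (real n)"
      using n by (simp add: power2_eq_square field_simps)
    also have "exp ?w ^ n = exp (u n)"
      using n by (simp flip: exp_of_nat_mult)
    finally show "norm (z n ^ n - exp (u n)) \<le>
        cmod (of_nat n * (z n - 1) - u n) + exp C * C\<^sup>2 * inverse (real n)"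
      by simp
  qed
  have "(\<lambda>n. exp C * C\<^sup>2 * inverse (real n)) \<longlonglongrightarrow> exp C * C\<^sup>2 * 0"
    by (intro tendsto_intros lim_inverse_n)
  then show "(\<lambda>n. cmod (of_nat n * (z n - 1) - u n) + exp C * C\<^sup>2 * inverse (real n)) \<longlonglongrightarrow> 0"
    using tendsto_add[OF tendsto_norm_zero[OF zu]] by fastforce
qed

lemma norm_iexp_minus_1_le: "cmod (iexp x - 1) \<le> \<bar>x\<bar>" "cmod (iexp x - 1) \<le> 2"
  using iexp_approx1[of x 0] iexp_approx2[of x 0] by simp_all

lemma norm_iexp_minus_linear_le: "cmod (iexp x - 1 - \<i> * x) \<le> x\<^sup>2 / 2" "cmod (iexp x - 1 - \<i> * x) \<le> 2 * \<bar>x\<bar>"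
  using iexp_approx1[of x 1] iexp_approx2[of x 1] by (simp_all add: power2_eq_square algebra_simps)

lemma (in prob_space) char_second_order_expansion:
  fixes X :: "'a \<Rightarrow> real"
  assumes X[measurable]: "X \<in> borel_measurable M" and X2: "integrable M (\<lambda>x. (X x)\<^sup>2)" and X0: "expectation X = 0"
  shows "(\<lambda>n. of_nat n * ((CLINT x|M. iexp (X x / sqrt (real n))) - 1)) \<longlonglongrightarrow> - of_real (expectation (\<lambda>x. (X x)\<^sup>2) / 2)"
proof -
  have X1: "integrable M X"
    by (rule square_integrable_imp_integrable[OF X X2])
  define f where "f n x = of_nat n * (iexp (X x / sqrt (real n)) - 1 - \<i> * (X x / sqrt (real n)))" for n x
  have iexp_int: "integrable M (\<lambda>x. iexp (X x / c))" for c
    by (rule integrable_iexp) auto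
  have eq: "of_nat n * ((CLINT x|M. iexp (X x / sqrt (real n))) - 1) = (CLINT x|M. f n x)" for n
  proof -
    have "(CLINT x|M. f n x) = of_nat n * ((CLINT x|M. iexp (X x / sqrt (real n))) - 1
        - \<i> * (CLINT x|M. complex_of_real (X x / sqrt (real n))))"
      unfolding f_def using iexp_int[of "sqrt (real n)"] X1 by (simp add: prob_space)
    also have "(CLINT x|M. complex_of_real (X x / sqrt (real n))) = 0"
      using X0 by (simp only: integral_complex_of_real) simp
    finally show ?thesis
      by simp
  qed
  have "(\<lambda>n. CLINT x|M. f n x) \<longlonglongrightarrow> (CLINT x|M. - of_real ((X x)\<^sup>2 / 2))"
  proof (rule integral_dominated_convergence[where w = "\<lambda>x. (X x)\<^sup>2 / 2"])
    show "integrable M (\<lambda>x. (X x)\<^sup>2 / 2)"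
      using X2 by simp
    show "AE x in M. norm (f n x) \<le> (X x)\<^sup>2 / 2" for n
    proof (rule AE_I2)
      fix x
      have "norm (f n x) \<le> real n * ((X x / sqrt (real n))\<^sup>2 / 2)"
        unfolding f_def norm_mult using norm_iexp_minus_linear_le(1)[of "X x / sqrt (real n)"]
        by (intro mult_mono) auto
      also have "\<dots> \<le> (X x)\<^sup>2 / 2"
        by (cases "n = 0") (auto simp: power_divide)
      finally show "norm (f n x) \<le> (X x)\<^sup>2 / 2" .
    qed
    show "AE x in M. (\<lambda>n. f n x) \<longlonglongrightarrow> - of_real ((X x)\<^sup>2 / 2)"
    proof (rule AE_I2)
      fix x
      have "(\<lambda>n. f n x - (- of_real ((X x)\<^sup>2 / 2))) \<longlonglongrightarrow> 0"
      proof (rule Lim_null_comparison)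
        show "\<forall>\<^sub>F n in sequentially. norm (f n x - (- of_real ((X x)\<^sup>2 / 2))) \<le> \<bar>X x\<bar> ^ 3 / 6 * inverse (sqrt (real n))"
        proof (rule eventually_sequentiallyI[of 1])
          fix n :: nat
          assume n: "1 \<le> n"
          let ?y = "X x / sqrt (real n)"
          define S where "S = iexp ?y - (\<Sum>k\<le>2. (\<i> * ?y) ^ k / fact k)"
          have "cmod S \<le> \<bar>?y\<bar> ^ 3 / 6"
            using iexp_approx1[of ?y 2] unfolding S_def by (simp only: eval_nat_numeral fact_Suc) simp
          moreover have "f n x - (- of_real ((X x)\<^sup>2 / 2)) = of_nat n * S"
            unfolding f_def S_def using n
            by (simp add: numeral_2_eq_2 field_simps) (simp add: power2_eq_square flip: of_real_mult)
          ultimately have "norm (f n x - (- of_real ((X x)\<^sup>2 / 2))) \<le> real n * (\<bar>?y\<bar> ^ 3 / 6)"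
            by (metis mult_left_mono norm_mult norm_of_nat of_nat_0_le_iff)
          also have "\<dots> = \<bar>X x\<bar> ^ 3 / 6 * inverse (sqrt (real n))"
            using n by (simp add: power_divide field_simps power3_eq_cube)
          finally show "norm (f n x - (- of_real ((X x)\<^sup>2 / 2))) \<le> \<bar>X x\<bar> ^ 3 / 6 * inverse (sqrt (real n))" .
        qed
        have "(\<lambda>n. inverse (sqrt (real n))) \<longlonglongrightarrow> 0"
          by (intro tendsto_inverse_0_at_top filterlim_compose[OF sqrt_at_top filterlim_real_sequentially])
        then show "(\<lambda>n. \<bar>X x\<bar> ^ 3 / 6 * inverse (sqrt (real n))) \<longlonglongrightarrow> 0"
          by (rule tendsto_mult_right_zero)
      qed
      then show "(\<lambda>n. f n x) \<longlonglongrightarrow> - of_real ((X x)\<^sup>2 / 2)"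
        by (rule LIM_zero_cancel)
    qed
  qed (auto simp: f_def)
  moreover have "(CLINT x|M. - of_real ((X x)\<^sup>2 / 2)) = - complex_of_real (expectation (\<lambda>x. (X x)\<^sup>2) / 2)"
    by (simp only: integral_minus integral_complex_of_real integral_divide_zero)
  ultimately show ?thesis
    by (simp only: eq)
qed

section \<open>Local alternatives in a quadratic mean differentiable model\<close>

text \<open>A submodel that is quadratic mean differentiable at 0. The dominating measure for \<open>P 0\<close> and \<open>P h\<close> changes with \<open>h\<close>, so the
  results on root densities are applied separately for each \<open>h\<close>.\<close>

locale qmd_model =
  fixes P :: "real ^ 'd \<Rightarrow> 'x measure" and g :: "'x \<Rightarrow> real ^ 'd"
  assumes prob: "\<And>h. prob_space (P h)" and sets_P: "\<And>h. sets (P h) = sets (P 0)"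
    and qmd: "qmd_at_zero P g"
begin

lemma g_measurable [measurable]: "g \<in> borel_measurable (P 0)"
  using qmd by (simp add: qmd_at_zero_def)

abbreviation \<mu> :: "real ^ 'd \<Rightarrow> 'x measure" where
  "\<mu> h \<equiv> sum_measure (P 0) (P h)"

abbreviation root\<^sub>0 :: "real ^ 'd \<Rightarrow> 'x \<Rightarrow> real" where
  "root\<^sub>0 h \<equiv> sqrt_density (\<mu> h) (P 0)"

abbreviation root\<^sub>1 :: "real ^ 'd \<Rightarrow> 'x \<Rightarrow> real" where
  "root\<^sub>1 h \<equiv> sqrt_density (\<mu> h) (P h)"

lemma root_densities_P: "root_densities (\<mu> h) (P 0) (P h) (root\<^sub>0 h) (root\<^sub>1 h)"
  by (rule root_densities_sqrt_density[OF prob prob sets_P])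

definition remainder :: "real ^ 'd \<Rightarrow> real" where
  "remainder h = enn2real (qmd_remainder P g h)"

lemma remainder_nonneg: "0 \<le> remainder h"
  by (simp add: remainder_def)

lemma qmd_remainder_zero: "qmd_remainder P g 0 = 0"
  by (simp add: qmd_remainder_def Let_def)

lemma qmd_remainder_small:
  assumes \<epsilon>: "\<epsilon> > 0"
  shows "\<exists>d>0. \<forall>h. norm h < d \<longrightarrow> qmd_remainder P g h \<le> ennreal (\<epsilon> * (norm h)\<^sup>2)"
proof -
  have "((\<lambda>h. qmd_remainder P g h / ennreal ((norm h)\<^sup>2)) \<longlongrightarrow> 0) (at 0)"
    using qmd by (simp add: qmd_at_zero_def)
  then have "\<forall>\<^sub>F h in at 0. qmd_remainder P g h / ennreal ((norm h)\<^sup>2) < ennreal \<epsilon>"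
    using \<epsilon> by (intro order_tendstoD(2)) auto
  then obtain d where d: "d > 0"
    "\<And>h. h \<noteq> 0 \<Longrightarrow> norm h < d \<Longrightarrow> qmd_remainder P g h / ennreal ((norm h)\<^sup>2) < ennreal \<epsilon>"
    by (auto simp: eventually_at dist_norm)
  have "qmd_remainder P g h \<le> ennreal (\<epsilon> * (norm h)\<^sup>2)" if "norm h < d" for h
  proof (cases "h = 0")
    case True
    then show ?thesis
      by (simp add: qmd_remainder_zero)
  next
    case False
    then have pos: "0 < ennreal ((norm h)\<^sup>2)" "ennreal ((norm h)\<^sup>2) < \<top>"
      by simp_all
    have "qmd_remainder P g h = qmd_remainder P g h / ennreal ((norm h)\<^sup>2) * ennreal ((norm h)\<^sup>2)"
      using pos by (simp add: ennreal_divide_times ennreal_times_divide[symmetric] mult_divide_eq_ennreal)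
    also have "\<dots> \<le> ennreal \<epsilon> * ennreal ((norm h)\<^sup>2)"
      using d(2)[OF False that] by (intro mult_right_mono) auto
    finally show ?thesis
      using \<epsilon> by (simp add: ennreal_mult)
  qed
  with d(1) show ?thesis
    by blast
qed

lemma remainder_small:
  assumes "\<epsilon> > 0"
  shows "\<forall>\<^sub>F h in nhds 0. qmd_remainder P g h < \<infinity> \<and> remainder h \<le> \<epsilon> * (norm h)\<^sup>2"
proof -
  obtain d where d: "d > 0" "\<And>h. norm h < d \<Longrightarrow> qmd_remainder P g h \<le> ennreal (\<epsilon> * (norm h)\<^sup>2)"
    using qmd_remainder_small[OF assms] by blast
  have "qmd_remainder P g h < \<infinity> \<and> remainder h \<le> \<epsilon> * (norm h)\<^sup>2" if "norm h < d" for h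
  proof
    show "qmd_remainder P g h < \<infinity>"
      using d(2)[OF that] ennreal_less_top order_le_less_trans by (metis infinity_ennreal_def)
    show "remainder h \<le> \<epsilon> * (norm h)\<^sup>2"
      using d(2)[OF that] assms unfolding remainder_def by (intro enn2real_leI) auto
  qed
  with d(1) show ?thesis
    unfolding eventually_nhds_metric by (auto simp: dist_norm)
qed

text \<open>The part of the second moment of the score where it exceeds 1. This and the remainder are the two sources of points
  that are not good.\<close>

definition large_score :: "real ^ 'd \<Rightarrow> real" where
  "large_score h = (\<integral>x. (h \<bullet> g x)\<^sup>2 * indicator {y. 1 < \<bar>h \<bullet> g y\<bar>} x \<partial>P 0)"

context
  fixes h :: "real ^ 'd"
  assumes finite: "qmd_remainder P g h < \<infinity>"
begin

private lemma finite_score_remainder: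
  "(\<integral>\<^sup>+x. ennreal ((root_densities.score_remainder (root\<^sub>0 h) (root\<^sub>1 h) (\<lambda>x. h \<bullet> g x) x)\<^sup>2) \<partial>\<mu> h) =
    qmd_remainder P g h"
  by (simp add: root_densities.score_remainder_def[OF root_densities_P] qmd_remainder_def Let_def)

lemma directional_score_square_integrable: "integrable (P 0) (\<lambda>x. (h \<bullet> g x)\<^sup>2)"
proof -
  interpret D: root_densities "\<mu> h" "P 0" "P h" "root\<^sub>0 h" "root\<^sub>1 h"
    by (rule root_densities_P)
  note [simp del] = D.sets_P0 D.space_P0
  show ?thesis
    by (rule D.score_square_integrable) (use finite finite_score_remainder in auto)
qed

lemma local_contiguity_bound:
  assumes I: "finite I" and B: "B \<in> sets (PiM I (\<lambda>_. P 0))" and K: "0 < K"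
  shows "emeasure (PiM I (\<lambda>_. P h)) B \<le> ennreal (real (card I) * (16 * remainder h + 2 * large_score h))
    + ennreal K * emeasure (PiM I (\<lambda>_. P 0)) B
    + ennreal ((1 + 10 * (2 * remainder h + 1 / 2 * (\<integral>x. (h \<bullet> g x)\<^sup>2 \<partial>P 0))) ^ card I / K)"
proof -
  interpret D: root_densities "\<mu> h" "P 0" "P h" "root\<^sub>0 h" "root\<^sub>1 h"
    by (rule root_densities_P)
  note [simp del] = D.sets_P0 D.space_P0
  have B': "B \<in> sets (PiM I (\<lambda>_. \<mu> h))"
    using B sets_PiM_cong[of I I "\<lambda>_. P 0" "\<lambda>_. \<mu> h"] by simp
  have fin: "(\<integral>\<^sup>+x. ennreal ((D.score_remainder (\<lambda>x. h \<bullet> g x) x)\<^sup>2) \<partial>\<mu> h) < \<infinity>"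
    using finite finite_score_remainder by simp
  have rem: "(\<integral>x. (D.score_remainder (\<lambda>x. h \<bullet> g x) x)\<^sup>2 \<partial>\<mu> h) = remainder h"
    by (subst D.integral_remainder_square) (use fin in \<open>auto simp: finite_score_remainder remainder_def\<close>)
  have "emeasure (P h) {x\<in>space (\<mu> h). \<not> D.good x} \<le>
      16 * (\<integral>\<^sup>+x. ennreal ((D.score_remainder (\<lambda>x. h \<bullet> g x) x)\<^sup>2) \<partial>\<mu> h)
      + 2 * (\<integral>\<^sup>+x. ennreal ((h \<bullet> g x)\<^sup>2 * indicator {y. 1 < \<bar>h \<bullet> g y\<bar>} x) \<partial>P 0)"
    unfolding D.score_remainder_def by (rule D.prob_not_good) measurable
  also have "(\<integral>\<^sup>+x. ennreal ((D.score_remainder (\<lambda>x. h \<bullet> g x) x)\<^sup>2) \<partial>\<mu> h) = ennreal (remainder h)"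
    using finite by (simp add: finite_score_remainder remainder_def)
  also have "(\<integral>\<^sup>+x. ennreal ((h \<bullet> g x)\<^sup>2 * indicator {y. 1 < \<bar>h \<bullet> g y\<bar>} x) \<partial>P 0) = ennreal (large_score h)"
    unfolding large_score_def
  proof (rule nn_integral_eq_integral)
    show "integrable (P 0) (\<lambda>x. (h \<bullet> g x)\<^sup>2 * indicator {y. 1 < \<bar>h \<bullet> g y\<bar>} x)"
      by (rule Bochner_Integration.integrable_bound[OF directional_score_square_integrable])
        (auto simp: indicator_def)
  qed simp
  finally have not_good: "emeasure (P h) {x\<in>space (\<mu> h). \<not> D.good x} \<le> ennreal (16 * remainder h + 2 * large_score h)"
    by (simp add: ennreal_mult remainder_nonneg large_score_def)
  have "emeasure (PiM I (\<lambda>_. P h)) B \<le> of_nat (card I) * emeasure (P h) {x\<in>space (\<mu> h). \<not> D.good x}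
    + ennreal K * emeasure (PiM I (\<lambda>_. P 0)) B + ennreal ((1 + 10 * D.hellinger2) ^ card I / K)"
    by (rule D.contiguity_bound[OF I B' K])
  also have "of_nat (card I) * emeasure (P h) {x\<in>space (\<mu> h). \<not> D.good x}
      \<le> ennreal (real (card I) * (16 * remainder h + 2 * large_score h))"
  proof -
    have "of_nat (card I) * emeasure (P h) {x\<in>space (\<mu> h). \<not> D.good x}
        \<le> of_nat (card I) * ennreal (16 * remainder h + 2 * large_score h)"
      by (intro mult_left_mono not_good) simp
    then show ?thesis
      by (simp add: ennreal_mult' ennreal_of_nat_eq_real_of_nat)
  qed
  also have "ennreal ((1 + 10 * D.hellinger2) ^ card I / K) \<le>
      ennreal ((1 + 10 * (2 * remainder h + 1 / 2 * (\<integral>x. (h \<bullet> g x)\<^sup>2 \<partial>P 0))) ^ card I / K)"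
  proof -
    have "D.hellinger2 \<le> 2 * remainder h + 1 / 2 * (\<integral>x. (h \<bullet> g x)\<^sup>2 \<partial>P 0)"
      using D.hellinger2_le[of "\<lambda>x. h \<bullet> g x"] fin rem by simp
    then show ?thesis
      using K D.hellinger2_nonneg
      by (intro ennreal_leI divide_right_mono power_mono) auto
  qed
  finally show ?thesis
    by (simp add: add_mono)
qed

lemma local_expectation_change:
  fixes e :: "'x \<Rightarrow> complex" and a :: "'x \<Rightarrow> real"
  assumes e[measurable]: "e \<in> borel_measurable (P 0)" and e2: "\<And>x. cmod (e x) \<le> 2"
    and ea: "\<And>x. cmod (e x) \<le> \<bar>a x\<bar>" and a[measurable]: "a \<in> borel_measurable (P 0)"
    and a2: "integrable (P 0) (\<lambda>x. (a x)\<^sup>2)" and \<tau>: "\<tau> > 0"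
  shows "cmod ((\<integral>x. e x \<partial>P h) - (\<integral>x. e x \<partial>P 0) - (\<integral>x. e x * (h \<bullet> g x) \<partial>P 0)) \<le>
    \<tau> * (\<integral>x. (a x)\<^sup>2 \<partial>P 0) + (1 / \<tau> + 4) * remainder h
    + 1 / 2 * (\<integral>x. cmod (e x) * (h \<bullet> g x)\<^sup>2 \<partial>P 0)"
proof -
  interpret D: root_densities "\<mu> h" "P 0" "P h" "root\<^sub>0 h" "root\<^sub>1 h"
    by (rule root_densities_P)
  note [simp del] = D.sets_P0 D.space_P0
  have fin: "(\<integral>\<^sup>+x. ennreal ((D.score_remainder (\<lambda>x. h \<bullet> g x) x)\<^sup>2) \<partial>\<mu> h) < \<infinity>"
    using finite finite_score_remainder by simp
  have rem: "(\<integral>x. (D.score_remainder (\<lambda>x. h \<bullet> g x) x)\<^sup>2 \<partial>\<mu> h) = remainder h"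
    by (subst D.integral_remainder_square) (use fin in \<open>auto simp: finite_score_remainder remainder_def\<close>)
  have "cmod ((\<integral>x. e x \<partial>P h) - (\<integral>x. e x \<partial>P 0) - (\<integral>x. e x * (h \<bullet> g x) \<partial>P 0)) \<le>
    \<tau> * (\<integral>x. (a x)\<^sup>2 \<partial>P 0) + (1 / \<tau> + 4) * (\<integral>x. (D.score_remainder (\<lambda>x. h \<bullet> g x) x)\<^sup>2 \<partial>\<mu> h)
    + 1 / 2 * (\<integral>x. cmod (e x) * (h \<bullet> g x)\<^sup>2 \<partial>P 0)"
    using e a by (intro D.expectation_change fin e2 ea a2 \<tau>) (simp_all, measurable)
  then show ?thesis
    by (simp add: rem)
qed

end

text \<open>A finite remainder in the direction of each coordinate axis forces the coordinates of the score to be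
  square integrable, since the root densities are.\<close>

lemma score_integrable: "integrable (P 0) (\<lambda>x. (norm (g x))\<^sup>2)"
proof -
  obtain d where d: "d > 0" "\<And>h. norm h < d \<Longrightarrow> qmd_remainder P g h < \<infinity>"
    using remainder_small[of 1] by (auto simp: eventually_nhds_metric dist_norm)
  have "integrable (P 0) (\<lambda>x. (g x $ i)\<^sup>2)" for i
  proof -
    have "integrable (P 0) (\<lambda>x. (((d / 2) *\<^sub>R axis i 1) \<bullet> g x)\<^sup>2)"
      using d(1) by (intro directional_score_square_integrable d(2)) (simp add: norm_axis_1)
    moreover have "(((d / 2) *\<^sub>R axis i 1) \<bullet> g x)\<^sup>2 = (d / 2)\<^sup>2 * (g x $ i)\<^sup>2" for x
      by (simp add: power_mult_distrib power_divide inner_axis')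
    moreover have "(d / 2)\<^sup>2 \<noteq> 0"
      using d(1) by simp
    ultimately show ?thesis
      by (simp only: integrable_mult_left_iff) blast
  qed
  then have "integrable (P 0) (\<lambda>x. \<Sum>i\<in>UNIV. (g x $ i)\<^sup>2)"
    by simp
  moreover have "(norm (g x))\<^sup>2 = (\<Sum>i\<in>UNIV. (g x $ i)\<^sup>2)" for x
    by (simp add: norm_vec_def L2_set_def sum_nonneg)
  ultimately show ?thesis
    by simp
qed

end

lemma inverse_sqrt_tendsto_0: "(\<lambda>n. inverse (sqrt (real n))) \<longlonglongrightarrow> 0"
  by (intro tendsto_inverse_0_at_top filterlim_compose[OF sqrt_at_top filterlim_real_sequentially])

text \<open>Parameters that approach 0 at the rate \<open>n\<^sup>-\<^sup>1\<^sup>/\<^sup>2\<close>.\<close>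

locale local_alternatives = qmd_model P g
  for P :: "real ^ 'd \<Rightarrow> 'x measure" and g +
  fixes k :: "nat \<Rightarrow> real ^ 'd" and c :: real
  assumes local_bound: "sqrt (real n) * norm (k n) \<le> c"
begin

lemma c_nonneg: "0 \<le> c"
  using local_bound[of 0] by simp

lemma k_tendsto_0: "k \<longlonglongrightarrow> 0"
proof (rule Lim_null_comparison)
  show "\<forall>\<^sub>F n in sequentially. norm (k n) \<le> c * inverse (sqrt (real n))"
  proof (rule eventually_sequentiallyI[of 1])
    fix n :: nat
    assume "1 \<le> n"
    then show "norm (k n) \<le> c * inverse (sqrt (real n))"
      using local_bound[of n] by (simp add: field_simps)
  qed
  show "(\<lambda>n. c * inverse (sqrt (real n))) \<longlonglongrightarrow> 0"
    by (intro tendsto_mult_right_zero inverse_sqrt_tendsto_0)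
qed

lemma norm_square_bound: "real n * (norm (k n))\<^sup>2 \<le> c\<^sup>2"
proof -
  have "(sqrt (real n) * norm (k n))\<^sup>2 \<le> c\<^sup>2"
    using local_bound by (intro power_mono) auto
  then show ?thesis
    by (simp add: power_mult_distrib)
qed

lemma scaled_score_square: "real n * (k n \<bullet> g x)\<^sup>2 = ((sqrt (real n) *\<^sub>R k n) \<bullet> g x)\<^sup>2"
  by (simp add: power_mult_distrib)

lemma scaled_score_le: "\<bar>(sqrt (real n) *\<^sub>R k n) \<bullet> g x\<bar> \<le> c * norm (g x)"
proof -
  have "\<bar>(sqrt (real n) *\<^sub>R k n) \<bullet> g x\<bar> \<le> norm (sqrt (real n) *\<^sub>R k n) * norm (g x)"
    by (rule Cauchy_Schwarz_ineq2)
  also have "\<dots> \<le> c * norm (g x)"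
    using local_bound[of n] by (intro mult_right_mono) auto
  finally show ?thesis .
qed

lemma scaled_score_square_le: "((sqrt (real n) *\<^sub>R k n) \<bullet> g x)\<^sup>2 \<le> c\<^sup>2 * (norm (g x))\<^sup>2"
proof -
  have "\<bar>(sqrt (real n) *\<^sub>R k n) \<bullet> g x\<bar>\<^sup>2 \<le> (c * norm (g x))\<^sup>2"
    by (intro power_mono scaled_score_le) simp
  then show ?thesis
    by (simp only: power2_abs power_mult_distrib)
qed

lemma finite_remainder: "\<forall>\<^sub>F n in sequentially. qmd_remainder P g (k n) < \<infinity>"
  using eventually_compose_filterlim[OF remainder_small[of 1] k_tendsto_0] by (auto elim: eventually_mono)

lemma n_remainder_tendsto_0: "(\<lambda>n. real n * remainder (k n)) \<longlonglongrightarrow> 0"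
proof (rule tendstoI)
  fix \<epsilon> :: real
  assume \<epsilon>: "\<epsilon> > 0"
  define \<epsilon>' where "\<epsilon>' = \<epsilon> / (c\<^sup>2 + 1)"
  have pos: "c\<^sup>2 + 1 > 0"
    by (simp add: add_nonneg_pos)
  then have "\<epsilon>' > 0"
    using \<epsilon> by (simp add: \<epsilon>'_def)
  have "\<forall>\<^sub>F n in sequentially. remainder (k n) \<le> \<epsilon>' * (norm (k n))\<^sup>2"
    using eventually_compose_filterlim[OF remainder_small[OF \<open>\<epsilon>' > 0\<close>] k_tendsto_0]
    by (auto elim: eventually_mono)
  then show "\<forall>\<^sub>F n in sequentially. dist (real n * remainder (k n)) 0 < \<epsilon>"
  proof eventually_elim
    case (elim n)
    then have "real n * remainder (k n) \<le> real n * (\<epsilon>' * (norm (k n))\<^sup>2)"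
      by (rule mult_left_mono) simp
    also have "\<dots> = \<epsilon>' * (real n * (norm (k n))\<^sup>2)"
      by simp
    also have "\<dots> \<le> \<epsilon>' * c\<^sup>2"
      using \<open>\<epsilon>' > 0\<close> by (intro mult_left_mono norm_square_bound) simp
    also have "\<dots> < \<epsilon>' * (c\<^sup>2 + 1)"
      using \<open>\<epsilon>' > 0\<close> by simp
    also have "\<dots> = \<epsilon>"
      using pos by (simp add: \<epsilon>'_def)
    finally show ?case
      using remainder_nonneg[of "k n"] by (simp add: dist_real_def)
  qed
qed

lemma n_large_score_tendsto_0: "(\<lambda>n. real n * large_score (k n)) \<longlonglongrightarrow> 0"
proof -
  define f where "f n x = ((sqrt (real n) *\<^sub>R k n) \<bullet> g x)\<^sup>2 * indicator {y. 1 < \<bar>k n \<bullet> g y\<bar>} x" for n x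
  have "real n * large_score (k n) = (\<integral>x. f n x \<partial>P 0)" for n
    unfolding large_score_def f_def scaled_score_square[symmetric]
    by (simp only: integral_mult_right_zero[symmetric] mult.assoc)
  moreover have "(\<lambda>n. \<integral>x. f n x \<partial>P 0) \<longlonglongrightarrow> (\<integral>x. 0 \<partial>P 0)"
  proof (rule integral_dominated_convergence[where w = "\<lambda>x. c\<^sup>2 * (norm (g x))\<^sup>2"])
    show "integrable (P 0) (\<lambda>x. c\<^sup>2 * (norm (g x))\<^sup>2)"
      using score_integrable by simp
    show "AE x in P 0. norm (f n x) \<le> c\<^sup>2 * (norm (g x))\<^sup>2" for n
      using scaled_score_square_le[of n] by (auto simp: f_def indicator_def)
    show "AE x in P 0. (\<lambda>n. f n x) \<longlonglongrightarrow> 0"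
    proof (rule AE_I2)
      fix x
      have "(\<lambda>n. k n \<bullet> g x) \<longlonglongrightarrow> 0 \<bullet> g x"
        by (intro tendsto_intros k_tendsto_0)
      then have "\<forall>\<^sub>F n in sequentially. \<bar>k n \<bullet> g x\<bar> < 1"
        by (auto dest!: tendstoD[of _ _ _ 1] simp: dist_real_def)
      then show "(\<lambda>n. f n x) \<longlonglongrightarrow> 0"
        by (intro tendsto_eventually) (auto elim!: eventually_mono simp: f_def)
    qed
    show "f n \<in> borel_measurable (P 0)" for n
      unfolding f_def[abs_def] by measurable
  qed simp
  ultimately show ?thesis
    by simp
qed

lemma n_score_energy_le: "real n * (\<integral>x. (k n \<bullet> g x)\<^sup>2 \<partial>P 0) \<le> c\<^sup>2 * (\<integral>x. (norm (g x))\<^sup>2 \<partial>P 0)"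
proof -
  have "real n * (\<integral>x. (k n \<bullet> g x)\<^sup>2 \<partial>P 0) = (\<integral>x. ((sqrt (real n) *\<^sub>R k n) \<bullet> g x)\<^sup>2 \<partial>P 0)"
    unfolding scaled_score_square[symmetric] by simp
  also have "\<dots> \<le> (\<integral>x. c\<^sup>2 * (norm (g x))\<^sup>2 \<partial>P 0)"
  proof (rule integral_mono_AE)
    show "integrable (P 0) (\<lambda>x. ((sqrt (real n) *\<^sub>R k n) \<bullet> g x)\<^sup>2)"
    proof (rule Bochner_Integration.integrable_bound)
      show "integrable (P 0) (\<lambda>x. c\<^sup>2 * (norm (g x))\<^sup>2)"
        using score_integrable by simp
      show "AE x in P 0. norm (((sqrt (real n) *\<^sub>R k n) \<bullet> g x)\<^sup>2) \<le> norm (c\<^sup>2 * (norm (g x))\<^sup>2)"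
        using scaled_score_square_le[of n] by (auto simp: abs_mult)
    qed measurable
    show "AE x in P 0. ((sqrt (real n) *\<^sub>R k n) \<bullet> g x)\<^sup>2 \<le> c\<^sup>2 * (norm (g x))\<^sup>2"
      using scaled_score_square_le by blast
  qed (use score_integrable in simp)
  finally show ?thesis
    by simp
qed

text \<open>The bound for a single parameter value, with the error of order \<open>n \<cdot> o(1/n)\<close> collected in \<open>\<delta>\<close> and the second moment
  \<open>(1 + O(1/n))\<^sup>n\<close> bounded by \<open>C\<close>.\<close>

lemma contiguity:
  obtains C and \<delta> :: "nat \<Rightarrow> real" where "0 \<le> C" "\<delta> \<longlonglongrightarrow> 0" "\<And>n. 0 \<le> \<delta> n"
    "\<forall>\<^sub>F n in sequentially. \<forall>B\<in>sets (PiM {1..n} (\<lambda>_. P 0)). \<forall>K>0.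
       emeasure (PiM {1..n} (\<lambda>_. P (k n))) B
         \<le> ennreal (\<delta> n) + ennreal K * emeasure (PiM {1..n} (\<lambda>_. P 0)) B + ennreal (C / K)"
proof
  define G where "G = (\<integral>x. (norm (g x))\<^sup>2 \<partial>P 0)"
  define C where "C = exp (10 * (2 + 1 / 2 * (c\<^sup>2 * G)))"
  define \<delta> where "\<delta> n = real n * (16 * remainder (k n) + 2 * large_score (k n))" for n
  show "0 \<le> C"
    by (simp add: C_def)
  show "0 \<le> \<delta> n" for n
    unfolding \<delta>_def large_score_def by (intro mult_nonneg_nonneg add_nonneg_nonneg remainder_nonneg) simp_all
  have "(\<lambda>n. 16 * (real n * remainder (k n)) + 2 * (real n * large_score (k n))) \<longlonglongrightarrow> 16 * 0 + 2 * 0"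
    by (intro tendsto_intros n_remainder_tendsto_0 n_large_score_tendsto_0)
  then show "\<delta> \<longlonglongrightarrow> 0"
    by (simp add: \<delta>_def[abs_def] algebra_simps)
  have "\<forall>\<^sub>F n in sequentially. real n * remainder (k n) < 1"
    using n_remainder_tendsto_0 by (rule order_tendstoD) simp
  with finite_remainder
  show "\<forall>\<^sub>F n in sequentially. \<forall>B\<in>sets (PiM {1..n} (\<lambda>_. P 0)). \<forall>K>0.
       emeasure (PiM {1..n} (\<lambda>_. P (k n))) B
         \<le> ennreal (\<delta> n) + ennreal K * emeasure (PiM {1..n} (\<lambda>_. P 0)) B + ennreal (C / K)"
  proof eventually_elim
    case (elim n)
    show ?case
    proof (intro ballI allI impI)
      fix B and K :: real
      assume B: "B \<in> sets (PiM {1..n} (\<lambda>_. P 0))" and K: "0 < K"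
      define q where "q = 2 * remainder (k n) + 1 / 2 * (\<integral>x. (k n \<bullet> g x)\<^sup>2 \<partial>P 0)"
      have "0 \<le> q"
        unfolding q_def by (simp add: remainder_nonneg)
      have nq: "real n * q \<le> 2 + 1 / 2 * (c\<^sup>2 * G)"
        using elim(2) n_score_energy_le[of n] unfolding q_def G_def by (simp add: algebra_simps)
      have "(1 + 10 * q) ^ n \<le> exp (10 * q) ^ n"
        using \<open>0 \<le> q\<close> by (intro power_mono) auto
      also have "\<dots> = exp (10 * (real n * q))"
        by (simp flip: exp_of_nat_mult add: ac_simps)
      also have "\<dots> \<le> C"
        unfolding C_def exp_le_cancel_iff by (intro mult_left_mono nq) simp
      finally have "(1 + 10 * q) ^ n / K \<le> C / K"
        using K by (intro divide_right_mono) auto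
      then have "ennreal ((1 + 10 * q) ^ n / K) \<le> ennreal (C / K)"
        by (rule ennreal_leI)
      moreover have "emeasure (PiM {1..n} (\<lambda>_. P (k n))) B
         \<le> ennreal (\<delta> n) + ennreal K * emeasure (PiM {1..n} (\<lambda>_. P 0)) B + ennreal ((1 + 10 * q) ^ n / K)"
        using local_contiguity_bound[OF elim(1) _ B K] unfolding \<delta>_def q_def by simp
      ultimately show "emeasure (PiM {1..n} (\<lambda>_. P (k n))) B
         \<le> ennreal (\<delta> n) + ennreal K * emeasure (PiM {1..n} (\<lambda>_. P 0)) B + ennreal (C / K)"
        by (meson add_left_mono order_trans)
    qed
  qed
qed

context
  fixes X :: "'x \<Rightarrow> real"
  assumes X[measurable]: "X \<in> borel_measurable (P 0)" and X2: "integrable (P 0) (\<lambda>x. (X x)\<^sup>2)"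
begin

private definition e :: "nat \<Rightarrow> 'x \<Rightarrow> complex" where
  "e n x = iexp (X x / sqrt (real n)) - 1"

private definition \<gamma> :: "nat \<Rightarrow> 'x \<Rightarrow> real" where
  "\<gamma> n x = (sqrt (real n) *\<^sub>R k n) \<bullet> g x"

private lemma e_measurable [measurable]: "e n \<in> borel_measurable (P 0)"
  unfolding e_def[abs_def] by measurable

private lemma \<gamma>_measurable [measurable]: "\<gamma> n \<in> borel_measurable (P 0)"
  unfolding \<gamma>_def[abs_def] by measurable

private lemma e_le: "cmod (e n x) \<le> \<bar>X x\<bar> * inverse (sqrt (real n))" "cmod (e n x) \<le> 2"
  using norm_iexp_minus_1_le[of "X x / sqrt (real n)"] by (simp_all add: e_def divide_inverse abs_mult)

private lemma e_tendsto_0: "(\<lambda>n. e n x) \<longlonglongrightarrow> 0"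
proof (rule Lim_null_comparison)
  show "\<forall>\<^sub>F n in sequentially. norm (e n x) \<le> \<bar>X x\<bar> * inverse (sqrt (real n))"
    using e_le(1) by simp
  show "(\<lambda>n. \<bar>X x\<bar> * inverse (sqrt (real n))) \<longlonglongrightarrow> 0"
    by (intro tendsto_mult_right_zero inverse_sqrt_tendsto_0)
qed

private lemma drift_tendsto_0:
  "(\<lambda>n. of_nat n * (CLINT x|P 0. e n x * (k n \<bullet> g x)) - \<i> * (\<integral>x. X x * \<gamma> n x \<partial>P 0)) \<longlonglongrightarrow> 0"
proof -
  define D where "D n x = sqrt (real n) * e n x - \<i> * X x" for n x
  have D_eq: "cmod (D n x) = sqrt (real n) * cmod (iexp (X x / sqrt (real n)) - 1 - \<i> * (X x / sqrt (real n)))"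
    if "0 < n" for n x
  proof -
    have "D n x = sqrt (real n) * (iexp (X x / sqrt (real n)) - 1 - \<i> * (X x / sqrt (real n)))"
      using that by (simp add: D_def e_def algebra_simps)
    then show ?thesis
      by (simp only: norm_mult norm_of_real) simp
  qed
  have D_le: "cmod (D n x) \<le> 2 * \<bar>X x\<bar>" for n x
  proof (cases "n = 0")
    case True
    then show ?thesis
      by (simp add: D_def norm_mult)
  next
    case False
    then have n: "0 < n"
      by simp
    have "cmod (D n x) \<le> sqrt (real n) * (2 * \<bar>X x / sqrt (real n)\<bar>)"
      unfolding D_eq[OF n] by (intro mult_left_mono norm_iexp_minus_linear_le) auto
    also have "\<dots> = 2 * \<bar>X x\<bar>"
      using False by simp
    finally show ?thesis .
  qed
  have D_lim: "(\<lambda>n. D n x) \<longlonglongrightarrow> 0" for x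
  proof (rule Lim_null_comparison)
    show "\<forall>\<^sub>F n in sequentially. norm (D n x) \<le> (X x)\<^sup>2 / 2 * inverse (sqrt (real n))"
    proof (rule eventually_sequentiallyI[of 1])
      fix n :: nat
      assume "1 \<le> n"
      then have n: "0 < n"
        by simp
      have "cmod (D n x) \<le> sqrt (real n) * ((X x / sqrt (real n))\<^sup>2 / 2)"
        unfolding D_eq[OF n] by (intro mult_left_mono norm_iexp_minus_linear_le) auto
      also have "\<dots> = (X x)\<^sup>2 / 2 * inverse (sqrt (real n))"
        using n by (simp add: power_divide field_simps)
      finally show "norm (D n x) \<le> (X x)\<^sup>2 / 2 * inverse (sqrt (real n))" .
    qed
    show "(\<lambda>n. (X x)\<^sup>2 / 2 * inverse (sqrt (real n))) \<longlonglongrightarrow> 0"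
      by (intro tendsto_mult_right_zero inverse_sqrt_tendsto_0)
  qed
  define w where "w x = \<bar>X x\<bar> * (c * norm (g x))" for x
  have w: "integrable (P 0) w"
    unfolding w_def using X2 score_integrable by (intro integrable_mult_of_squares) (auto simp: power_mult_distrib)
  have w_nonneg: "0 \<le> w x" for x
    using c_nonneg by (simp add: w_def)
  have \<gamma>_le: "\<bar>\<gamma> n x\<bar> \<le> c * norm (g x)" for n x
    unfolding \<gamma>_def by (rule scaled_score_le)
  have D\<gamma>_le: "cmod (D n x * \<gamma> n x) \<le> 2 * w x" for n x
    using mult_mono[OF D_le[of n x] \<gamma>_le[of n x]] by (simp add: norm_mult w_def mult.assoc)
  have X\<gamma>_le: "\<bar>X x * \<gamma> n x\<bar> \<le> w x" for n x
    using mult_left_mono[OF \<gamma>_le[of n x], of "\<bar>X x\<bar>"] by (simp add: abs_mult w_def)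
  have D_meas[measurable]: "D n \<in> borel_measurable (P 0)" for n
    unfolding D_def by measurable
  have int_D: "integrable (P 0) (\<lambda>x. D n x * \<gamma> n x)" for n
  proof (rule Bochner_Integration.integrable_bound)
    show "integrable (P 0) (\<lambda>x. 2 * w x)"
      using w by simp
    show "AE x in P 0. norm (D n x * \<gamma> n x) \<le> norm (2 * w x)"
      using D\<gamma>_le w_nonneg by (intro AE_I2) simp
  qed measurable
  have int_X: "integrable (P 0) (\<lambda>x. X x * \<gamma> n x)" for n
  proof (rule Bochner_Integration.integrable_bound[OF w])
    show "AE x in P 0. norm (X x * \<gamma> n x) \<le> norm (w x)"
      using X\<gamma>_le w_nonneg by (intro AE_I2) simp
  qed measurable
  have "of_nat n * (CLINT x|P 0. e n x * (k n \<bullet> g x)) - \<i> * (\<integral>x. X x * \<gamma> n x \<partial>P 0) = (CLINT x|P 0. D n x * \<gamma> n x)" for n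
  proof -
    have "complex_of_nat n = complex_of_real (sqrt (real n)) * complex_of_real (sqrt (real n))"
      by (simp flip: of_real_mult)
    then have "complex_of_nat n * (e n x * complex_of_real (k n \<bullet> g x)) = D n x * \<gamma> n x + \<i> * complex_of_real (X x * \<gamma> n x)" for x
      by (simp add: \<gamma>_def D_def algebra_simps)
    then have "of_nat n * (CLINT x|P 0. e n x * (k n \<bullet> g x)) =
        (CLINT x|P 0. D n x * \<gamma> n x + \<i> * complex_of_real (X x * \<gamma> n x))"
      by (simp only: integral_mult_right_zero[symmetric])
    also have "\<dots> = (CLINT x|P 0. D n x * \<gamma> n x) + \<i> * (CLINT x|P 0. complex_of_real (X x * \<gamma> n x))"
    proof -
      have "integrable (P 0) (\<lambda>x. \<i> * complex_of_real (X x * \<gamma> n x))"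
        by (intro integrable_mult_right integrable_of_real int_X)
      then show ?thesis
        by (subst Bochner_Integration.integral_add[OF int_D]) (simp_all only: integral_mult_right_zero)
    qed
    finally show ?thesis
      by (simp only: integral_complex_of_real add_diff_cancel_right')
  qed
  moreover have "(\<lambda>n. CLINT x|P 0. D n x * \<gamma> n x) \<longlonglongrightarrow> (CLINT x|P 0. 0)"
  proof (rule integral_dominated_convergence)
    show "integrable (P 0) (\<lambda>x. 2 * w x)"
      using w by simp
    show "AE x in P 0. norm (D n x * \<gamma> n x) \<le> 2 * w x" for n
      using D\<gamma>_le by simp
    show "AE x in P 0. (\<lambda>n. D n x * \<gamma> n x) \<longlonglongrightarrow> 0"
    proof (rule AE_I2)
      fix x
      show "(\<lambda>n. D n x * \<gamma> n x) \<longlonglongrightarrow> 0"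
      proof (rule Lim_null_comparison)
        show "\<forall>\<^sub>F n in sequentially. norm (D n x * \<gamma> n x) \<le> cmod (D n x) * (c * norm (g x))"
          using \<gamma>_le by (simp add: norm_mult mult_left_mono)
        show "(\<lambda>n. cmod (D n x) * (c * norm (g x))) \<longlonglongrightarrow> 0"
          by (intro tendsto_mult_left_zero tendsto_norm_zero D_lim)
      qed
    qed
  qed measurable
  ultimately show ?thesis
    by simp
qed

private lemma change_error_tendsto_0:
  "(\<lambda>n. of_nat n * ((CLINT x|P (k n). e n x) - (CLINT x|P 0. e n x) - (CLINT x|P 0. e n x * (k n \<bullet> g x)))) \<longlonglongrightarrow> 0"
proof -
  define V where "V = (\<integral>x. (X x)\<^sup>2 \<partial>P 0)"
  define b where "b n = (\<integral>x. cmod (e n x) * (c\<^sup>2 * (norm (g x))\<^sup>2) \<partial>P 0)" for n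
  have "b \<longlonglongrightarrow> (\<integral>x. 0 \<partial>P 0)"
    unfolding b_def
  proof (rule integral_dominated_convergence[where w = "\<lambda>x. 2 * (c\<^sup>2 * (norm (g x))\<^sup>2)"])
    show "integrable (P 0) (\<lambda>x. 2 * (c\<^sup>2 * (norm (g x))\<^sup>2))"
      using score_integrable by simp
    show "AE x in P 0. norm (cmod (e n x) * (c\<^sup>2 * (norm (g x))\<^sup>2)) \<le> 2 * (c\<^sup>2 * (norm (g x))\<^sup>2)" for n
      using e_le(2)[of n] by (intro AE_I2) (simp add: abs_mult mult_right_mono)
    show "AE x in P 0. (\<lambda>n. cmod (e n x) * (c\<^sup>2 * (norm (g x))\<^sup>2)) \<longlonglongrightarrow> 0"
      using e_tendsto_0 by (intro AE_I2 tendsto_mult_left_zero tendsto_norm_zero)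
  qed measurable
  then have b: "b \<longlonglongrightarrow> 0"
    by simp
  define S where "S n = of_nat n * ((CLINT x|P (k n). e n x) - (CLINT x|P 0. e n x) - (CLINT x|P 0. e n x * (k n \<bullet> g x)))" for n
  have S_le: "\<forall>\<^sub>F n in sequentially. cmod (S n) \<le> \<tau> * V + ((1 / \<tau> + 4) * (real n * remainder (k n)) + 1 / 2 * b n)"
    if \<tau>: "\<tau> > 0" for \<tau>
    using finite_remainder eventually_gt_at_top[of 0]
  proof eventually_elim
    case (elim n)
    define R where "R = cmod ((CLINT x|P (k n). e n x) - (CLINT x|P 0. e n x) - (CLINT x|P 0. e n x * (k n \<bullet> g x)))"
    have "R \<le> \<tau> * (\<integral>x. (X x / sqrt (real n))\<^sup>2 \<partial>P 0) + (1 / \<tau> + 4) * remainder (k n)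
        + 1 / 2 * (\<integral>x. cmod (e n x) * (k n \<bullet> g x)\<^sup>2 \<partial>P 0)"
      unfolding R_def
    proof (rule local_expectation_change[OF elim(1)])
      show "cmod (e n x) \<le> \<bar>X x / sqrt (real n)\<bar>" for x
        unfolding e_def by (rule norm_iexp_minus_1_le)
      show "integrable (P 0) (\<lambda>x. (X x / sqrt (real n))\<^sup>2)"
        using X2 by (simp add: power_divide)
    qed (use e_le(2) \<tau> in auto)
    then have "real n * R \<le> real n * (\<tau> * (\<integral>x. (X x / sqrt (real n))\<^sup>2 \<partial>P 0) + (1 / \<tau> + 4) * remainder (k n)
        + 1 / 2 * (\<integral>x. cmod (e n x) * (k n \<bullet> g x)\<^sup>2 \<partial>P 0))"
      by (rule mult_left_mono) simp
    also have "\<dots> = \<tau> * (real n * (\<integral>x. (X x / sqrt (real n))\<^sup>2 \<partial>P 0)) + ((1 / \<tau> + 4) * (real n * remainder (k n))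
        + 1 / 2 * (real n * (\<integral>x. cmod (e n x) * (k n \<bullet> g x)\<^sup>2 \<partial>P 0)))"
      by (simp add: algebra_simps)
    also have "real n * (\<integral>x. (X x / sqrt (real n))\<^sup>2 \<partial>P 0) = V"
      using elim(2) by (simp add: power_divide V_def)
    also have "real n * (\<integral>x. cmod (e n x) * (k n \<bullet> g x)\<^sup>2 \<partial>P 0) \<le> b n"
    proof -
      have "real n * (\<integral>x. cmod (e n x) * (k n \<bullet> g x)\<^sup>2 \<partial>P 0) = (\<integral>x. cmod (e n x) * (\<gamma> n x)\<^sup>2 \<partial>P 0)"
        unfolding \<gamma>_def scaled_score_square[symmetric]
        by (simp only: integral_mult_right_zero[symmetric] mult.left_commute)
      also have "\<dots> \<le> b n"
        unfolding b_def
      proof (rule integral_mono_AE)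
        have int: "integrable (P 0) (\<lambda>x. 2 * (c\<^sup>2 * (norm (g x))\<^sup>2))"
          using score_integrable by simp
        show "integrable (P 0) (\<lambda>x. cmod (e n x) * (c\<^sup>2 * (norm (g x))\<^sup>2))"
        proof (rule Bochner_Integration.integrable_bound[OF int])
          show "AE x in P 0. norm (cmod (e n x) * (c\<^sup>2 * (norm (g x))\<^sup>2)) \<le> norm (2 * (c\<^sup>2 * (norm (g x))\<^sup>2))"
            using e_le(2)[of n] by (intro AE_I2) (simp add: abs_mult mult_right_mono)
        qed measurable
        have le: "cmod (e n x) * (\<gamma> n x)\<^sup>2 \<le> cmod (e n x) * (c\<^sup>2 * (norm (g x))\<^sup>2)" for x
          unfolding \<gamma>_def by (intro mult_left_mono scaled_score_square_le) simp
        show "integrable (P 0) (\<lambda>x. cmod (e n x) * (\<gamma> n x)\<^sup>2)"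
        proof (rule Bochner_Integration.integrable_bound)
          show "integrable (P 0) (\<lambda>x. cmod (e n x) * (c\<^sup>2 * (norm (g x))\<^sup>2))" by fact
          show "AE x in P 0. norm (cmod (e n x) * (\<gamma> n x)\<^sup>2) \<le> norm (cmod (e n x) * (c\<^sup>2 * (norm (g x))\<^sup>2))"
            using le by (intro AE_I2) (simp add: abs_mult)
        qed measurable
        show "AE x in P 0. cmod (e n x) * (\<gamma> n x)\<^sup>2 \<le> cmod (e n x) * (c\<^sup>2 * (norm (g x))\<^sup>2)"
          using le by simp
      qed
      finally show ?thesis .
    qed
    finally show ?case
      by (simp add: S_def R_def norm_mult)
  qed
  have "S \<longlonglongrightarrow> 0"
  proof (rule tendstoI)
    fix \<epsilon> :: real
    assume \<epsilon>: "\<epsilon> > 0"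
    have "0 \<le> V"
      by (simp add: V_def)
    define \<tau> where "\<tau> = \<epsilon> / (2 * (V + 1))"
    have \<tau>: "\<tau> > 0"
      using \<epsilon> \<open>0 \<le> V\<close> by (simp add: \<tau>_def)
    have "\<tau> * V \<le> \<epsilon> / 2"
      using \<epsilon> \<open>0 \<le> V\<close> by (simp add: \<tau>_def field_simps)
    have "(\<lambda>n. (1 / \<tau> + 4) * (real n * remainder (k n)) + 1 / 2 * b n) \<longlonglongrightarrow> (1 / \<tau> + 4) * 0 + 1 / 2 * 0"
      by (intro tendsto_intros n_remainder_tendsto_0 b)
    then have "\<forall>\<^sub>F n in sequentially. (1 / \<tau> + 4) * (real n * remainder (k n)) + 1 / 2 * b n < \<epsilon> / 2"
      using \<epsilon> by (intro order_tendstoD(2)) auto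
    with S_le[OF \<tau>] show "\<forall>\<^sub>F n in sequentially. dist (S n) 0 < \<epsilon>"
    proof eventually_elim
      case (elim n)
      have "x < \<epsilon>" if "x \<le> y + z" "y \<le> \<epsilon> / 2" "z < \<epsilon> / 2" for x y z
        using that by simp
      from this[OF elim(1) \<open>\<tau> * V \<le> \<epsilon> / 2\<close> elim(2)] show ?case
        by simp
    qed
  qed
  then show ?thesis
    by (simp add: S_def[abs_def])
qed

text \<open>Three contributions: the second-order expansion under \<open>P 0\<close>, the linear effect of the score, and the error bounded
  in \<open>local_expectation_change\<close>.\<close>

lemma local_char_expansion:
  assumes X0: "(\<integral>x. X x \<partial>P 0) = 0"
  shows "(\<lambda>n. of_nat n * ((CLINT x|P (k n). iexp (X x / sqrt (real n))) - 1)
      - (\<i> * (\<integral>x. X x * ((sqrt (real n) *\<^sub>R k n) \<bullet> g x) \<partial>P 0) - (\<integral>x. (X x)\<^sup>2 \<partial>P 0) / 2)) \<longlonglongrightarrow> 0"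
proof -
  interpret P0: prob_space "P 0" by (rule prob)
  define V where "V = (\<integral>x. (X x)\<^sup>2 \<partial>P 0)"
  have int_e: "(CLINT x|P h. e n x) = (CLINT x|P h. iexp (X x / sqrt (real n))) - 1" for h n
  proof -
    interpret Ph: prob_space "P h" by (rule prob)
    have [measurable]: "X \<in> borel_measurable (P h)"
      using X sets_P[of h] by (simp cong: measurable_cong_sets)
    have "integrable (P h) (\<lambda>x. iexp (X x / sqrt (real n)))"
      by (rule Ph.integrable_iexp) auto
    then show ?thesis
      unfolding e_def by (simp add: Ph.prob_space)
  qed
  have null: "(\<lambda>n. of_nat n * (CLINT x|P 0. e n x) + V / 2) \<longlonglongrightarrow> 0"
  proof -
    have "(\<lambda>n. of_nat n * (CLINT x|P 0. e n x) + V / 2) \<longlonglongrightarrow> - complex_of_real (V / 2) + complex_of_real (V / 2)"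
      unfolding int_e V_def by (intro tendsto_add tendsto_const P0.char_second_order_expansion X X2 X0)
    then show ?thesis
      by simp
  qed
  have "(\<lambda>n. (of_nat n * (CLINT x|P 0. e n x) + V / 2)
      + (of_nat n * (CLINT x|P 0. e n x * (k n \<bullet> g x)) - \<i> * (\<integral>x. X x * \<gamma> n x \<partial>P 0))
      + of_nat n * ((CLINT x|P (k n). e n x) - (CLINT x|P 0. e n x) - (CLINT x|P 0. e n x * (k n \<bullet> g x)))) \<longlonglongrightarrow> 0 + 0 + 0"
    by (intro tendsto_add null drift_tendsto_0 change_error_tendsto_0)
  moreover have "(of_nat n * (CLINT x|P 0. e n x) + V / 2)
      + (of_nat n * (CLINT x|P 0. e n x * (k n \<bullet> g x)) - \<i> * (\<integral>x. X x * \<gamma> n x \<partial>P 0))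
      + of_nat n * ((CLINT x|P (k n). e n x) - (CLINT x|P 0. e n x) - (CLINT x|P 0. e n x * (k n \<bullet> g x))) =
      of_nat n * (CLINT x|P (k n). e n x) - (\<i> * (\<integral>x. X x * \<gamma> n x \<partial>P 0) - V / 2)" for n
    by (simp add: right_diff_distrib)
  ultimately have "(\<lambda>n. of_nat n * (CLINT x|P (k n). e n x)
      - (\<i> * (\<integral>x. X x * \<gamma> n x \<partial>P 0) - V / 2)) \<longlonglongrightarrow> 0"
    by (simp only: add_0_left)
  then show ?thesis
    by (simp only: int_e \<gamma>_def V_def of_real_divide of_real_numeral)
qed

end


end

section \<open>The joint law of data and noise\<close>

lemma sets_sampling_cong:
  "sets P = sets P' \<Longrightarrow> sets \<nu> = sets \<nu>' \<Longrightarrow> sets Q = sets Q' \<Longrightarrow> sets (sampling P \<nu> Q) = sets (sampling P' \<nu>' Q')"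
  unfolding sampling_def by (intro sets_pair_measure_cong sets_PiM_cong refl)

lemma prob_space_pair:
  assumes "prob_space M" "prob_space N"
  shows "prob_space (M \<Otimes>\<^sub>M N)"
proof -
  interpret M: prob_space M by fact
  interpret N: prob_space N by fact
  interpret MN: pair_prob_space M N ..
  show ?thesis
    by (rule MN.P.prob_space_axioms)
qed

lemma prob_space_sampling:
  assumes "prob_space P" "prob_space \<nu>" "prob_space Q"
  shows "prob_space (sampling P \<nu> Q)"
  unfolding sampling_def using assms by (intro prob_space_pair prob_space_PiM)

lemma integral_pair_mult:
  fixes F :: "'a \<Rightarrow> complex" and G :: "'b \<Rightarrow> complex"
  assumes "prob_space M" "prob_space N"
    and [measurable]: "F \<in> borel_measurable M" "G \<in> borel_measurable N"
    and F: "\<And>x. cmod (F x) \<le> 1" and G: "\<And>x. cmod (G x) \<le> 1"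
  shows "(CLINT p|M \<Otimes>\<^sub>M N. F (fst p) * G (snd p)) = (CLINT x|M. F x) * (CLINT y|N. G y)"
proof -
  interpret M: prob_space M by fact
  interpret N: prob_space N by fact
  interpret pair_prob_space M N ..
  have "integrable (M \<Otimes>\<^sub>M N) (\<lambda>p. F (fst p) * G (snd p))"
    by (rule integrable_const_bound[of _ 1]) (auto simp: norm_mult intro!: mult_le_one F G)
  then have "(CLINT p|M \<Otimes>\<^sub>M N. F (fst p) * G (snd p)) = (CLINT x|M. CLINT y|N. F x * G y)"
    using integral_fst'[of "\<lambda>p. F (fst p) * G (snd p)"] by simp
  then show ?thesis
    by simp
qed

lemma integral_PiM_power:
  fixes u :: "'a \<Rightarrow> complex"
  assumes P: "prob_space P" and u[measurable]: "u \<in> borel_measurable P" "\<And>x. cmod (u x) \<le> 1"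
    and I: "finite I"
  shows "(CLINT x|PiM (UNIV :: 'i set) (\<lambda>_. P). (\<Prod>i\<in>I. u (x i))) = (CLINT x|P. u x) ^ card I"
proof -
  interpret P: prob_space P by fact
  interpret X: product_prob_space "\<lambda>_. P" "UNIV :: 'i set"
    by (rule product_prob_spaceI) (rule P)
  have int: "integrable P u"
    by (rule P.integrable_const_bound[of _ 1]) (use u in auto)
  have "(CLINT x|PiM (UNIV :: 'i set) (\<lambda>_. P). (\<Prod>i\<in>I. u (x i))) =
      (CLINT x|PiM (UNIV :: 'i set) (\<lambda>_. P). (\<Prod>i\<in>I. u (restrict x I i)))"
    by (intro Bochner_Integration.integral_cong prod.cong) auto
  also have "\<dots> = (CLINT x|distr (PiM (UNIV :: 'i set) (\<lambda>_. P)) (PiM I (\<lambda>_. P)) (\<lambda>x. restrict x I). (\<Prod>i\<in>I. u (x i)))"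
    by (intro integral_distr[symmetric]) (use I in measurable)
  also have "distr (PiM (UNIV :: 'i set) (\<lambda>_. P)) (PiM I (\<lambda>_. P)) (\<lambda>x. restrict x I) = PiM I (\<lambda>_. P)"
    using X.distr_PiM_restrict_finite[OF I] by simp
  also have "(CLINT x|PiM I (\<lambda>_. P). (\<Prod>i\<in>I. u (x i))) = (\<Prod>i\<in>I. CLINT x|P. u x)"
    using I int by (intro X.product_integral_prod) auto
  finally show ?thesis
    by simp
qed

lemma sampling_product_integral:
  fixes u :: "'x \<Rightarrow> complex" and v :: "'c \<Rightarrow> complex"
  assumes P: "prob_space P" and \<nu>: "prob_space \<nu>" and Q: "prob_space Q"
    and u[measurable]: "u \<in> borel_measurable P" and u1: "\<And>x. cmod (u x) \<le> 1"
    and v[measurable]: "v \<in> borel_measurable Q" and v1: "\<And>x. cmod (v x) \<le> 1"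
  shows "(CLINT \<omega>|sampling P \<nu> Q. (\<Prod>i=1..n. u (fst \<omega> i)) * (\<Prod>i=1..n. v (snd (snd \<omega>) i))) =
    (CLINT x|P. u x) ^ n * (CLINT z|Q. v z) ^ n"
proof -
  have le: "cmod (\<Prod>i\<in>I. w (x i)) \<le> 1" if "\<And>y. cmod (w y) \<le> 1"
    for w :: "'y \<Rightarrow> complex" and x :: "nat \<Rightarrow> 'y" and I
    using that by (simp add: prod_norm[symmetric] prod_le_1)
  interpret \<nu>: prob_space \<nu> by fact
  have "(CLINT \<omega>|sampling P \<nu> Q. (\<Prod>i=1..n. u (fst \<omega> i)) * (\<Prod>i=1..n. v (snd (snd \<omega>) i))) =
      (CLINT x|PiM UNIV (\<lambda>_. P). (\<Prod>i=1..n. u (x i))) *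
      (CLINT y|\<nu> \<Otimes>\<^sub>M PiM UNIV (\<lambda>_. Q). (\<Prod>i=1..n. v (snd y i)))"
    unfolding sampling_def
    using P \<nu> Q u1 v1
    by (intro integral_pair_mult[where F = "\<lambda>x. \<Prod>i=1..n. u (x i)" and G = "\<lambda>y. \<Prod>i=1..n. v (snd y i)"]
        prob_space_pair prob_space_PiM le[OF u1] le[OF v1]) auto
  also have "(CLINT y|\<nu> \<Otimes>\<^sub>M PiM UNIV (\<lambda>_. Q). (\<Prod>i=1..n. v (snd y i))) =
      (CLINT t|\<nu>. 1) * (CLINT z|PiM UNIV (\<lambda>_. Q). (\<Prod>i=1..n. v (z i)))"
    using \<nu> Q v1
      integral_pair_mult[of \<nu> "PiM UNIV (\<lambda>_. Q)" "\<lambda>_. 1" "\<lambda>z. \<Prod>i=1..n. v (z i)"]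
    by (simp add: prob_space_PiM le)
  also have "(CLINT t|\<nu>. 1) = (1 :: complex)"
    by (simp add: \<nu>.prob_space)
  finally show ?thesis
    using integral_PiM_power[OF P u u1, of "{1..n}"] integral_PiM_power[OF Q v v1, of "{1..n}"]
    by simp
qed

text \<open>The base \<open>B\<close> serves all measures with the same measurable sets at once. It is obtained by filling the free
  coordinates with a fixed point \<open>a\<close> of the space.\<close>

lemma cylinder_base:
  fixes A :: "('i \<Rightarrow> 'x) set"
  assumes M: "prob_space M" and I: "finite I" and A: "A \<in> sets (PiM UNIV (\<lambda>_. M))"
    and cyl: "\<And>x x'. x \<in> space (PiM UNIV (\<lambda>_. M)) \<Longrightarrow> x' \<in> space (PiM UNIV (\<lambda>_. M)) \<Longrightarrow>
      (\<And>i. i \<in> I \<Longrightarrow> x i = x' i) \<Longrightarrow> x \<in> A \<Longrightarrow> x' \<in> A"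
  shows "\<exists>B\<in>sets (PiM I (\<lambda>_. M)). \<forall>P. prob_space P \<longrightarrow> sets P = sets M \<longrightarrow>
    emeasure (PiM UNIV (\<lambda>_. P)) A = emeasure (PiM I (\<lambda>_. P)) B"
proof -
  interpret M: prob_space M by fact
  obtain a where a: "a \<in> space M"
    using M.not_empty by blast
  define ext where "ext y i = (if i \<in> I then y i else a)" for y :: "'i \<Rightarrow> 'x" and i
  have ext[measurable]: "ext \<in> measurable (PiM I (\<lambda>_. M)) (PiM UNIV (\<lambda>_. M))"
  proof (rule measurable_PiM_single')
    show "(\<lambda>y. ext y i) \<in> measurable (PiM I (\<lambda>_. M)) M" for i
      unfolding ext_def using a by (cases "i \<in> I") auto
    show "(\<lambda>y i. ext y i) \<in> space (PiM I (\<lambda>_. M)) \<rightarrow> (\<Pi>\<^sub>E i\<in>UNIV. space M)"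
      using a by (auto simp: ext_def space_PiM PiE_iff)
  qed
  define B where "B = ext -` A \<inter> space (PiM I (\<lambda>_. M))"
  have B: "B \<in> sets (PiM I (\<lambda>_. M))"
    unfolding B_def by (rule measurable_sets[OF ext A])
  have A_eq: "A = (\<lambda>x. restrict x I) -` B \<inter> space (PiM UNIV (\<lambda>_. M))"
  proof (intro set_eqI iffI)
    fix x
    assume "x \<in> A"
    then have x: "x \<in> space (PiM UNIV (\<lambda>_. M))"
      using sets.sets_into_space[OF A] by blast
    moreover have r: "restrict x I \<in> space (PiM I (\<lambda>_. M))"
      using x by (auto simp: space_PiM PiE_iff)
    moreover have "ext (restrict x I) \<in> A"
      by (rule cyl[OF x measurable_space[OF ext r] _ \<open>x \<in> A\<close>]) (simp add: ext_def)
    ultimately show "x \<in> (\<lambda>x. restrict x I) -` B \<inter> space (PiM UNIV (\<lambda>_. M))"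
      by (auto simp: B_def)
  next
    fix x
    assume x: "x \<in> (\<lambda>x. restrict x I) -` B \<inter> space (PiM UNIV (\<lambda>_. M))"
    then have "ext (restrict x I) \<in> A" "ext (restrict x I) \<in> space (PiM UNIV (\<lambda>_. M))"
      using sets.sets_into_space[OF A] by (auto simp: B_def)
    moreover have "x \<in> space (PiM UNIV (\<lambda>_. M))"
      using x by blast
    ultimately show "x \<in> A"
      by (intro cyl[of "ext (restrict x I)" x]) (simp_all add: ext_def)
  qed
  show ?thesis
  proof (intro bexI[of _ B] allI impI)
    show "B \<in> sets (PiM I (\<lambda>_. M))" by fact
    fix P :: "'x measure"
    assume P: "prob_space P" and sets_P: "sets P = sets M"
    interpret X: product_prob_space "\<lambda>_. P" "UNIV :: 'i set"
      by (rule product_prob_spaceI) (rule P)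
    have sets_eq: "sets (PiM J (\<lambda>_. P)) = sets (PiM J (\<lambda>_. M))" for J :: "'i set"
      using sets_P by (intro sets_PiM_cong) auto
    have "emeasure (PiM I (\<lambda>_. P)) B =
        emeasure (distr (PiM UNIV (\<lambda>_. P)) (PiM I (\<lambda>_. P)) (\<lambda>x. restrict x I)) B"
      using X.distr_PiM_restrict_finite[OF I] by simp
    also have "\<dots> = emeasure (PiM UNIV (\<lambda>_. P)) ((\<lambda>x. restrict x I) -` B \<inter> space (PiM UNIV (\<lambda>_. P)))"
      using B sets_eq by (intro emeasure_distr) auto
    also have "space (PiM UNIV (\<lambda>_. P)) = space (PiM (UNIV :: 'i set) (\<lambda>_. M))"
      by (rule sets_eq_imp_space_eq[OF sets_eq])
    also note A_eq[symmetric]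
    finally show "emeasure (PiM UNIV (\<lambda>_. P)) A = emeasure (PiM I (\<lambda>_. P)) B" ..
  qed
qed

text \<open>Fubini: for fixed noise and initial value the section of \<open>A\<close> is a cylinder over finitely many observations, and the
  assumed bound is linear.\<close>

lemma sampling_bound:
  fixes A :: "((nat \<Rightarrow> 'x) \<times> 'b \<times> (nat \<Rightarrow> 'c)) set"
  assumes P0: "prob_space P0" and P1: "prob_space P1" "sets P1 = sets P0"
    and \<nu>: "prob_space \<nu>" and Q: "prob_space Q"
    and A: "A \<in> sets (sampling P0 \<nu> Q)"
    and cyl: "\<And>x x' y. (\<And>i. i \<in> I \<Longrightarrow> x i = x' i) \<Longrightarrow> (x', y) \<in> space (sampling P0 \<nu> Q) \<Longrightarrow> (x, y) \<in> A \<Longrightarrow> (x', y) \<in> A"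
    and I: "finite I"
    and bound: "\<And>B. B \<in> sets (PiM I (\<lambda>_. P0)) \<Longrightarrow>
      emeasure (PiM I (\<lambda>_. P1)) B \<le> D\<^sub>1 + K * emeasure (PiM I (\<lambda>_. P0)) B + D\<^sub>2"
  shows "emeasure (sampling P1 \<nu> Q) A \<le> D\<^sub>1 + K * emeasure (sampling P0 \<nu> Q) A + D\<^sub>2"
proof -
  let ?X = "\<lambda>P. PiM (UNIV :: nat set) (\<lambda>_. P)"
  define R where "R = \<nu> \<Otimes>\<^sub>M PiM (UNIV :: nat set) (\<lambda>_. Q)"
  have samp: "sampling P \<nu> Q = ?X P \<Otimes>\<^sub>M R" for P :: "'x measure"
    by (simp add: sampling_def R_def)
  have R: "prob_space R"
    unfolding R_def using \<nu> Q by (intro prob_space_pair prob_space_PiM)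
  interpret R: prob_space R by (rule R)
  interpret X0: prob_space "?X P0" using P0 by (rule prob_space_PiM)
  interpret X1: prob_space "?X P1" using P1(1) by (rule prob_space_PiM)
  interpret R0: pair_sigma_finite "?X P0" R ..
  interpret R1: pair_sigma_finite "?X P1" R ..
  have A0: "A \<in> sets (?X P0 \<Otimes>\<^sub>M R)"
    using A samp by simp
  have A1: "A \<in> sets (?X P1 \<Otimes>\<^sub>M R)"
    using A sets_sampling_cong[OF P1(2) refl refl, of \<nu> Q] samp by simp
  have "emeasure (sampling P1 \<nu> Q) A = (\<integral>\<^sup>+y. emeasure (?X P1) ((\<lambda>x. (x, y)) -` A) \<partial>R)"
    unfolding samp by (rule R1.emeasure_pair_measure_alt2[OF A1])
  also have "\<dots> \<le> (\<integral>\<^sup>+y. D\<^sub>1 + K * emeasure (?X P0) ((\<lambda>x. (x, y)) -` A) + D\<^sub>2 \<partial>R)"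
  proof (rule nn_integral_mono)
    fix y
    assume y: "y \<in> space R"
    let ?S = "(\<lambda>x. (x, y)) -` A"
    have S: "?S \<in> sets (?X P0)"
      using A0 by (rule sets_Pair2)
    have cylS: "x' \<in> ?S" if "x \<in> space (?X P0)" "x' \<in> space (?X P0)" "\<And>i. i \<in> I \<Longrightarrow> x i = x' i" "x \<in> ?S" for x x'
      using that y cyl[of x x' y] by (simp add: samp space_pair_measure)
    have "\<exists>B\<in>sets (PiM I (\<lambda>_. P0)). \<forall>P. prob_space P \<longrightarrow> sets P = sets P0 \<longrightarrow>
        emeasure (?X P) ?S = emeasure (PiM I (\<lambda>_. P)) B"
      by (rule cylinder_base[OF P0 I S cylS])
    then obtain B where B: "B \<in> sets (PiM I (\<lambda>_. P0))"
      "\<And>P. prob_space P \<Longrightarrow> sets P = sets P0 \<Longrightarrow> emeasure (?X P) ?S = emeasure (PiM I (\<lambda>_. P)) B"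
      by blast
    show "emeasure (?X P1) ?S \<le> D\<^sub>1 + K * emeasure (?X P0) ?S + D\<^sub>2"
      using bound[OF B(1)] B(2)[OF P1] B(2)[OF P0 refl] by simp
  qed
  also have "\<dots> = D\<^sub>1 + K * (\<integral>\<^sup>+y. emeasure (?X P0) ((\<lambda>x. (x, y)) -` A) \<partial>R) + D\<^sub>2"
  proof -
    have meas[measurable]: "(\<lambda>y. emeasure (?X P0) ((\<lambda>x. (x, y)) -` A)) \<in> borel_measurable R"
      using R0.measurable_emeasure_Pair2[OF A0] by simp
    show ?thesis
      by (simp add: nn_integral_add nn_integral_cmult R.emeasure_space_1)
  qed
  also have "(\<integral>\<^sup>+y. emeasure (?X P0) ((\<lambda>x. (x, y)) -` A) \<partial>R) = emeasure (sampling P0 \<nu> Q) A"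
    unfolding samp by (rule R0.emeasure_pair_measure_alt2[OF A0, symmetric])
  finally show ?thesis .
qed

text \<open>The constant \<open>K\<close> is fixed first to make \<open>C / K\<close> small; then \<open>n\<close> tends to infinity.\<close>

lemma (in local_alternatives) sampling_contiguity:
  fixes A :: "nat \<Rightarrow> ((nat \<Rightarrow> 'x) \<times> 'b \<times> (nat \<Rightarrow> 'c)) set"
  assumes \<nu>: "prob_space \<nu>" and Q: "prob_space Q"
    and A: "\<And>n. A n \<in> sets (sampling (P 0) \<nu> Q)"
    and cyl: "\<And>n x x' y. (\<And>i. i \<in> {1..n} \<Longrightarrow> x i = x' i) \<Longrightarrow>
      (x', y) \<in> space (sampling (P 0) \<nu> Q) \<Longrightarrow> (x, y) \<in> A n \<Longrightarrow> (x', y) \<in> A n"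
    and null: "(\<lambda>n. measure (sampling (P 0) \<nu> Q) (A n)) \<longlonglongrightarrow> 0"
  shows "(\<lambda>n. measure (sampling (P (k n)) \<nu> Q) (A n)) \<longlonglongrightarrow> 0"
proof (rule tendstoI)
  fix \<epsilon> :: real
  assume \<epsilon>: "\<epsilon> > 0"
  interpret S: prob_space "sampling (P h) \<nu> Q" for h
    by (intro prob_space_sampling prob \<nu> Q)
  obtain C and \<delta> :: "nat \<Rightarrow> real" where C: "0 \<le> C" and \<delta>: "\<delta> \<longlonglongrightarrow> 0" "\<And>n. 0 \<le> \<delta> n"
    and ev: "\<forall>\<^sub>F n in sequentially. \<forall>B\<in>sets (PiM {1..n} (\<lambda>_. P 0)). \<forall>K>0.
       emeasure (PiM {1..n} (\<lambda>_. P (k n))) B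
         \<le> ennreal (\<delta> n) + ennreal K * emeasure (PiM {1..n} (\<lambda>_. P 0)) B + ennreal (C / K)"
    using contiguity by blast
  define K where "K = 3 * (C + 1) / \<epsilon>"
  have K: "K > 0"
    using C \<epsilon> by (simp add: K_def)
  have CK: "C / K < \<epsilon> / 3"
    using C \<epsilon> by (simp add: K_def field_simps)
  have "\<forall>\<^sub>F n in sequentially. \<delta> n < \<epsilon> / 3"
    using \<delta>(1) \<epsilon> by (intro order_tendstoD(2)) auto
  moreover have "(\<lambda>n. K * measure (sampling (P 0) \<nu> Q) (A n)) \<longlonglongrightarrow> K * 0"
    by (intro tendsto_intros null)
  then have "\<forall>\<^sub>F n in sequentially. K * measure (sampling (P 0) \<nu> Q) (A n) < \<epsilon> / 3"
    using \<epsilon> by (intro order_tendstoD(2)) auto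
  ultimately show "\<forall>\<^sub>F n in sequentially. dist (measure (sampling (P (k n)) \<nu> Q) (A n)) 0 < \<epsilon>"
    using ev
  proof eventually_elim
    case (elim n)
    have "emeasure (sampling (P (k n)) \<nu> Q) (A n)
        \<le> ennreal (\<delta> n) + ennreal K * emeasure (sampling (P 0) \<nu> Q) (A n) + ennreal (C / K)"
      using elim(3) K
      by (intro sampling_bound[OF prob prob sets_P \<nu> Q A cyl, where I = "{1..n}"]) auto
    then have "measure (sampling (P (k n)) \<nu> Q) (A n) \<le> \<delta> n + K * measure (sampling (P 0) \<nu> Q) (A n) + C / K"
      using \<delta>(2)[of n] K C
      by (simp add: S.emeasure_eq_measure ennreal_mult[symmetric] ennreal_plus[symmetric] del: ennreal_plus)
    moreover have "a < \<epsilon>" if "a \<le> d + b + e" "d < \<epsilon> / 3" "b < \<epsilon> / 3" "e < \<epsilon> / 3" for a b d e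
      using that by simp
    ultimately have "measure (sampling (P (k n)) \<nu> Q) (A n) < \<epsilon>"
      using elim(1,2) CK by blast
    then show ?case
      by (simp add: dist_real_def)
  qed
qed

text \<open>Centring \<open>U\<close> already turns the covariance into the mixed second moment; the score will enter as \<open>V\<close>.\<close>

lemma cov_matrix_bilinear:
  fixes U :: "'x \<Rightarrow> real ^ 'p" and V :: "'x \<Rightarrow> real ^ 'd"
  assumes M: "prob_space M"
    and [measurable]: "U \<in> borel_measurable M" "V \<in> borel_measurable M"
    and U: "integrable M (\<lambda>x. (norm (U x))\<^sup>2)" and V: "integrable M (\<lambda>x. (norm (V x))\<^sup>2)"
    and U0: "\<And>v. (\<integral>x. v \<bullet> U x \<partial>M) = 0"
  shows "s \<bullet> (cov_matrix M U V *v h) = (\<integral>x. (s \<bullet> U x) * (h \<bullet> V x) \<partial>M)"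
proof -
  interpret M: prob_space M by fact
  have [measurable]: "(\<lambda>x. U x $ i) \<in> borel_measurable M" "(\<lambda>x. V x $ j) \<in> borel_measurable M" for i j
    unfolding cart_eq_inner_axis by measurable
  have UV: "integrable M (\<lambda>x. U x $ i * V x $ j)" for i j
  proof (rule Bochner_Integration.integrable_bound)
    show "integrable M (\<lambda>x. norm (U x) * norm (V x))"
      using U V by (intro integrable_mult_of_squares) auto
    show "AE x in M. norm (U x $ i * V x $ j) \<le> norm (norm (U x) * norm (V x))"
      by (intro AE_I2) (simp add: abs_mult mult_mono component_le_norm_cart)
  qed measurable
  have norm_int: "integrable M (\<lambda>x. norm (U x))"
    by (rule M.square_integrable_imp_integrable[OF _ U]) measurable
  have Ui: "integrable M (\<lambda>x. U x $ i)" for i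
    by (rule Bochner_Integration.integrable_bound[OF norm_int]) (auto simp: component_le_norm_cart)
  have U0': "(\<integral>x. U x $ i \<partial>M) = 0" for i
    using U0[of "axis i 1"] by (simp add: inner_axis')
  have entry: "cov_matrix M U V $ i $ j = (\<integral>x. U x $ i * V x $ j \<partial>M)" for i j
  proof -
    have "cov_matrix M U V $ i $ j = (\<integral>x. U x $ i * V x $ j - U x $ i * (\<integral>y. V y $ j \<partial>M) \<partial>M)"
      by (simp add: cov_matrix_def U0' right_diff_distrib)
    also have "\<dots> = (\<integral>x. U x $ i * V x $ j \<partial>M) - (\<integral>x. U x $ i \<partial>M) * (\<integral>y. V y $ j \<partial>M)"
      using UV Ui by simp
    finally show ?thesis
      by (simp add: U0')
  qed
  have "s \<bullet> (cov_matrix M U V *v h) = (\<Sum>i\<in>UNIV. \<Sum>j\<in>UNIV. (\<integral>x. s $ i * h $ j * (U x $ i * V x $ j) \<partial>M))"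
    by (simp add: inner_vec_def matrix_vector_mult_def entry sum_distrib_left ac_simps)
  also have "\<dots> = (\<integral>x. (\<Sum>i\<in>UNIV. \<Sum>j\<in>UNIV. s $ i * h $ j * (U x $ i * V x $ j)) \<partial>M)"
    using UV by (subst Bochner_Integration.integral_sum; simp)
  also have "\<dots> = (\<integral>x. (s \<bullet> U x) * (h \<bullet> V x) \<partial>M)"
    by (auto simp: inner_vec_def sum_product intro!: Bochner_Integration.integral_cong sum.cong)
  finally show ?thesis .
qed

text \<open>Slutsky's theorem at the level of characteristic functions.\<close>

lemma char_diff_tendsto_0:
  fixes Y W :: "nat \<Rightarrow> 'a \<Rightarrow> 'b::euclidean_space"
  assumes M: "\<And>n. prob_space (M n)"
    and Y[measurable]: "\<And>n. Y n \<in> borel_measurable (M n)" and W[measurable]: "\<And>n. W n \<in> borel_measurable (M n)"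
    and close: "\<And>\<epsilon>. \<epsilon> > 0 \<Longrightarrow> (\<lambda>n. measure (M n) {\<omega>\<in>space (M n). norm (Y n \<omega> - W n \<omega>) > \<epsilon>}) \<longlonglongrightarrow> 0"
  shows "(\<lambda>n. (CLINT \<omega>|M n. iexp (t \<bullet> Y n \<omega>)) - (CLINT \<omega>|M n. iexp (t \<bullet> W n \<omega>))) \<longlonglongrightarrow> 0"
proof (rule tendstoI)
  fix \<epsilon> :: real
  assume \<epsilon>: "\<epsilon> > 0"
  define \<eta> where "\<eta> = \<epsilon> / (2 * (norm t + 1))"
  have pos: "norm t + 1 > 0"
    by (simp add: add_nonneg_pos)
  have \<eta>: "\<eta> > 0" "norm t * \<eta> \<le> \<epsilon> / 2"
    using \<epsilon> pos by (simp_all add: \<eta>_def field_simps)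
  let ?B = "\<lambda>n. {\<omega>\<in>space (M n). norm (Y n \<omega> - W n \<omega>) > \<eta>}"
  have "\<forall>\<^sub>F n in sequentially. measure (M n) (?B n) < \<epsilon> / 4"
    using close[OF \<eta>(1)] \<epsilon> by (intro order_tendstoD(2)) auto
  then show "\<forall>\<^sub>F n in sequentially. dist ((CLINT \<omega>|M n. iexp (t \<bullet> Y n \<omega>)) - (CLINT \<omega>|M n. iexp (t \<bullet> W n \<omega>))) 0 < \<epsilon>"
  proof eventually_elim
    case (elim n)
    interpret M: prob_space "M n" by (rule M)
    have int: "integrable (M n) (\<lambda>\<omega>. iexp (t \<bullet> Y n \<omega>))" "integrable (M n) (\<lambda>\<omega>. iexp (t \<bullet> W n \<omega>))"
      by (rule M.integrable_iexp; simp)+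
    have "(CLINT \<omega>|M n. iexp (t \<bullet> Y n \<omega>)) - (CLINT \<omega>|M n. iexp (t \<bullet> W n \<omega>)) =
        (CLINT \<omega>|M n. iexp (t \<bullet> Y n \<omega>) - iexp (t \<bullet> W n \<omega>))"
      using int by simp
    also have "cmod \<dots> \<le> (\<integral>\<omega>. norm t * \<eta> + 2 * indicator (?B n) \<omega> \<partial>M n)"
    proof (rule order_trans[OF integral_norm_bound integral_mono])
      show "integrable (M n) (\<lambda>\<omega>. cmod (iexp (t \<bullet> Y n \<omega>) - iexp (t \<bullet> W n \<omega>)))"
        using int by simp
      show "integrable (M n) (\<lambda>\<omega>. norm t * \<eta> + 2 * indicator (?B n) \<omega>)"
        by (intro Bochner_Integration.integrable_add integrable_mult_right integrable_real_indicator)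
          (auto simp: M.emeasure_eq_measure)
      fix \<omega>
      assume \<omega>: "\<omega> \<in> space (M n)"
      have "iexp (t \<bullet> Y n \<omega>) - iexp (t \<bullet> W n \<omega>) = iexp (t \<bullet> W n \<omega>) * (iexp (t \<bullet> (Y n \<omega> - W n \<omega>)) - 1)"
        by (simp add: inner_diff_right right_diff_distrib exp_diff)
      then have eq: "cmod (iexp (t \<bullet> Y n \<omega>) - iexp (t \<bullet> W n \<omega>)) = cmod (iexp (t \<bullet> (Y n \<omega> - W n \<omega>)) - 1)"
        by (simp add: norm_mult)
      show "cmod (iexp (t \<bullet> Y n \<omega>) - iexp (t \<bullet> W n \<omega>)) \<le> norm t * \<eta> + 2 * indicator (?B n) \<omega>"
      proof (cases "\<omega> \<in> ?B n")
        case True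
        then show ?thesis
          using \<eta>(1) norm_iexp_minus_1_le(2)[of "t \<bullet> (Y n \<omega> - W n \<omega>)"] unfolding eq
          by (simp add: add_increasing)
      next
        case False
        have "cmod (iexp (t \<bullet> (Y n \<omega> - W n \<omega>)) - 1) \<le> \<bar>t \<bullet> (Y n \<omega> - W n \<omega>)\<bar>"
          by (rule norm_iexp_minus_1_le)
        also have "\<dots> \<le> norm t * norm (Y n \<omega> - W n \<omega>)"
          by (rule Cauchy_Schwarz_ineq2)
        also have "\<dots> \<le> norm t * \<eta>"
          using False \<omega> by (intro mult_left_mono) auto
        finally show ?thesis
          using False unfolding eq by simp
      qed
    qed
    also have "\<dots> = norm t * \<eta> + 2 * measure (M n) (?B n)"
      by (subst Bochner_Integration.integral_add)
        (auto simp: M.prob_space M.emeasure_eq_measure intro!: integrable_real_indicator)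
    also have "\<dots> < \<epsilon>"
      using \<eta>(2) elim by simp
    finally show ?case
      by simp
  qed
qed

text \<open>The first factor removes the drift of the sum under the alternatives. What remains is the same
  Gaussian limit for every sequence of local parameters.\<close>

lemma (in local_alternatives) linear_statistic_char:
  fixes \<psi> :: "'x \<Rightarrow> real ^ 'p" and s :: "real ^ 'p"
  assumes \<nu>: "prob_space \<nu>" and Q: "prob_space Q" "sets Q = sets borel"
    and \<psi>[measurable]: "\<psi> \<in> borel_measurable (P 0)" and \<psi>2: "integrable (P 0) (\<lambda>x. (norm (\<psi> x))\<^sup>2)"
    and \<psi>0: "\<And>v. (\<integral>x. v \<bullet> \<psi> x \<partial>P 0) = 0"
    and Q2: "integrable Q (\<lambda>z. (norm z)\<^sup>2)" and Q0: "(\<integral>z. z \<partial>Q) = 0"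
  shows "(\<lambda>n. iexp (s \<bullet> (cov_matrix (P 0) \<psi> g *v (sqrt (real n) *\<^sub>R k n))) *
      (CLINT \<omega>|sampling (P (k n)) \<nu> Q. iexp (- (1 / sqrt (real n) * (\<Sum>i=1..n. s \<bullet> (\<psi> (fst \<omega> i) + snd (snd \<omega>) i))))))
    \<longlonglongrightarrow> exp (- (s \<bullet> ((cov_matrix (P 0) \<psi> \<psi> + cov_matrix Q (\<lambda>z. z) (\<lambda>z. z)) *v s)) / 2)"
proof -
  interpret P0: prob_space "P 0" by (rule prob)
  interpret Q: prob_space Q by fact
  have [measurable_cong]: "sets Q = sets borel" by fact
  have \<psi>h[measurable]: "\<psi> \<in> borel_measurable (P h)" for h
    using \<psi> sets_P[of h] by (simp cong: measurable_cong_sets)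
  define V1 where "V1 = (\<integral>x. (- (s \<bullet> \<psi> x))\<^sup>2 \<partial>P 0)"
  define V2 where "V2 = (\<integral>z. (- (s \<bullet> z))\<^sup>2 \<partial>Q)"
  have Q_int: "integrable Q (\<lambda>z. z)"
  proof -
    have "integrable Q (\<lambda>z. norm z)"
      by (rule Q.square_integrable_imp_integrable[OF _ Q2]) measurable
    then show ?thesis
      by (subst integrable_norm_iff[symmetric]) auto
  qed
  have Q0': "(\<integral>z. v \<bullet> z \<partial>Q) = 0" for v
    using Q0 Q_int by simp
  have sq: "integrable K (\<lambda>x. (- (s \<bullet> U x))\<^sup>2)"
    if [measurable]: "U \<in> borel_measurable K" and U: "integrable K (\<lambda>x. (norm (U x))\<^sup>2)"
    for K :: "'k measure" and U :: "'k \<Rightarrow> real ^ 'p"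
  proof (rule Bochner_Integration.integrable_bound)
    show "integrable K (\<lambda>x. (norm s)\<^sup>2 * (norm (U x))\<^sup>2)"
      using U by simp
    have "(- (s \<bullet> u))\<^sup>2 \<le> (norm s)\<^sup>2 * (norm u)\<^sup>2" for u
      using power_mono[OF Cauchy_Schwarz_ineq2[of s u], of 2] by (simp add: power_mult_distrib)
    then show "AE x in K. norm ((- (s \<bullet> U x))\<^sup>2) \<le> norm ((norm s)\<^sup>2 * (norm (U x))\<^sup>2)"
      by auto
  qed measurable
  have V: "s \<bullet> ((cov_matrix (P 0) \<psi> \<psi> + cov_matrix Q (\<lambda>z. z) (\<lambda>z. z)) *v s) = V1 + V2"
    using cov_matrix_bilinear[OF prob \<psi> \<psi> \<psi>2 \<psi>2 \<psi>0, of s s] cov_matrix_bilinear[OF Q(1) _ _ Q2 Q2 Q0', of s s]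
    by (simp add: matrix_vector_mult_add_rdistrib inner_add_right V1_def V2_def power2_eq_square)

  define a where "a n = s \<bullet> (cov_matrix (P 0) \<psi> g *v (sqrt (real n) *\<^sub>R k n))" for n
  have a_eq: "(\<integral>x. - (s \<bullet> \<psi> x) * ((sqrt (real n) *\<^sub>R k n) \<bullet> g x) \<partial>P 0) = - a n" for n
    unfolding a_def cov_matrix_bilinear[OF prob \<psi> g_measurable \<psi>2 score_integrable \<psi>0]
    by (simp only: mult_minus_left Bochner_Integration.integral_minus)
  define m where "m = norm (transpose (cov_matrix (P 0) \<psi> g) *v s)"
  have a_le: "\<bar>a n\<bar> \<le> m * c" for n
  proof -
    have "a n = (transpose (cov_matrix (P 0) \<psi> g) *v s) \<bullet> (sqrt (real n) *\<^sub>R k n)"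
      unfolding a_def by (metis dot_lmul_matrix transpose_matrix_vector)
    then have "\<bar>a n\<bar> \<le> m * norm (sqrt (real n) *\<^sub>R k n)"
      unfolding m_def by (metis Cauchy_Schwarz_ineq2)
    also have "\<dots> \<le> m * c"
      unfolding m_def using local_bound[of n] by (intro mult_left_mono) auto
    finally show ?thesis .
  qed

  define \<phi> where "\<phi> n = (CLINT x|P (k n). iexp (- (s \<bullet> \<psi> x) / sqrt (real n)))" for n
  define \<zeta> where "\<zeta> n = (CLINT z|Q. iexp (- (s \<bullet> z) / sqrt (real n)))" for n
  have \<phi>1: "cmod (\<phi> n) \<le> 1" for n
  proof -
    interpret Pk: prob_space "P (k n)" by (rule prob)
    have "cmod (\<phi> n) \<le> (\<integral>x. cmod (iexp (- (s \<bullet> \<psi> x) / sqrt (real n))) \<partial>P (k n))"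
      unfolding \<phi>_def by (rule integral_norm_bound)
    also have "\<dots> = 1"
      by (simp add: Pk.prob_space)
    finally show ?thesis .
  qed
  have \<zeta>1: "cmod (\<zeta> n) \<le> 1" for n
  proof -
    have "cmod (\<zeta> n) \<le> (\<integral>z. cmod (iexp (- (s \<bullet> z) / sqrt (real n))) \<partial>Q)"
      unfolding \<zeta>_def by (rule integral_norm_bound)
    also have "\<dots> = 1"
      by (simp add: Q.prob_space)
    finally show ?thesis .
  qed
  have data: "(\<lambda>n. \<phi> n ^ n - exp (- \<i> * a n - V1 / 2)) \<longlonglongrightarrow> 0"
  proof (rule power_tendsto_exp[OF \<phi>1])
    have "(\<lambda>n. of_nat n * (\<phi> n - 1)
        - (\<i> * (\<integral>x. - (s \<bullet> \<psi> x) * ((sqrt (real n) *\<^sub>R k n) \<bullet> g x) \<partial>P 0) - V1 / 2)) \<longlonglongrightarrow> 0"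
    proof -
      have "(\<lambda>x. - (s \<bullet> \<psi> x)) \<in> borel_measurable (P 0)"
        by measurable
      note local_char_expansion[OF this sq[OF \<psi> \<psi>2]]
      moreover have "(\<integral>x. - (s \<bullet> \<psi> x) \<partial>P 0) = 0"
        using \<psi>0[of s] by simp
      ultimately show ?thesis
        unfolding \<phi>_def V1_def by (simp only: of_real_divide of_real_numeral)
    qed
    then show "(\<lambda>n. of_nat n * (\<phi> n - 1) - (- \<i> * a n - V1 / 2)) \<longlonglongrightarrow> 0"
      by (simp only: a_eq) simp
    have V1: "0 \<le> V1"
      by (simp add: V1_def)
    show "cmod (- \<i> * a n - V1 / 2) \<le> m * c + V1 / 2" for n
      using norm_triangle_ineq4[of "- \<i> * a n" "V1 / 2"] a_le[of n] V1 by (simp add: norm_mult)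
    show "Re (- \<i> * a n - V1 / 2) \<le> 0" for n
      using V1 by simp
  qed
  have noise: "(\<lambda>n. \<zeta> n ^ n - exp (- of_real (V2 / 2))) \<longlonglongrightarrow> 0"
  proof (rule power_tendsto_exp[OF \<zeta>1])
    have "(\<lambda>n. of_nat n * (\<zeta> n - 1)) \<longlonglongrightarrow> - of_real (V2 / 2)"
      unfolding \<zeta>_def V2_def
      using sq[of "\<lambda>z. z" Q] Q2 Q0'[of "- s"] by (intro Q.char_second_order_expansion) auto
    then show "(\<lambda>n. of_nat n * (\<zeta> n - 1) - (- of_real (V2 / 2))) \<longlonglongrightarrow> 0"
      by (rule LIM_zero)
    show "Re (- of_real (V2 / 2)) \<le> 0"
      by (simp add: V2_def)
  qed (rule order_refl)
  have factor: "(CLINT \<omega>|sampling (P (k n)) \<nu> Q. iexp (- (1 / sqrt (real n) * (\<Sum>i=1..n. s \<bullet> (\<psi> (fst \<omega> i) + snd (snd \<omega>) i))))) =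
      \<phi> n ^ n * \<zeta> n ^ n" for n
  proof -
    have "iexp (- (1 / sqrt (real n) * (\<Sum>i=1..n. s \<bullet> (\<psi> (x i) + z i)))) =
        (\<Prod>i=1..n. iexp (- (s \<bullet> \<psi> (x i)) / sqrt (real n))) * (\<Prod>i=1..n. iexp (- (s \<bullet> z i) / sqrt (real n)))"
      for x and z :: "nat \<Rightarrow> real ^ 'p"
    proof -
      have "- (1 / sqrt (real n) * (\<Sum>i=1..n. s \<bullet> (\<psi> (x i) + z i))) =
          (\<Sum>i=1..n. - (s \<bullet> \<psi> (x i)) / sqrt (real n)) + (\<Sum>i=1..n. - (s \<bullet> z i) / sqrt (real n))"
        by (simp add: inner_add_right sum.distrib sum_distrib_left sum_negf[symmetric] sum_divide_distrib
            add_divide_distrib diff_divide_distrib)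
      then show ?thesis
        by (simp only: of_real_add of_real_sum distrib_left exp_add sum_distrib_left exp_sum[OF finite_atLeastAtMost])
    qed
    then have "(CLINT \<omega>|sampling (P (k n)) \<nu> Q. iexp (- (1 / sqrt (real n) * (\<Sum>i=1..n. s \<bullet> (\<psi> (fst \<omega> i) + snd (snd \<omega>) i))))) =
        (CLINT \<omega>|sampling (P (k n)) \<nu> Q. (\<Prod>i=1..n. iexp (- (s \<bullet> \<psi> (fst \<omega> i)) / sqrt (real n))) *
          (\<Prod>i=1..n. iexp (- (s \<bullet> snd (snd \<omega>) i) / sqrt (real n))))"
      by simp
    also have "\<dots> = \<phi> n ^ n * \<zeta> n ^ n"
      unfolding \<phi>_def \<zeta>_def by (rule sampling_product_integral[OF prob \<nu> Q(1)]) auto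
    finally show ?thesis .
  qed
  have drift: "(\<lambda>n. iexp (a n) * \<phi> n ^ n) \<longlonglongrightarrow> exp (- of_real (V1 / 2))"
  proof -
    have "(\<lambda>n. iexp (a n) * (\<phi> n ^ n - exp (- \<i> * a n - V1 / 2))) \<longlonglongrightarrow> 0"
      by (rule Lim_null_comparison[OF _ tendsto_norm_zero[OF data]]) (auto simp: norm_mult)
    moreover have "iexp (a n) * (\<phi> n ^ n - exp (- \<i> * a n - V1 / 2)) = iexp (a n) * \<phi> n ^ n - exp (- of_real (V1 / 2))" for n
      by (simp add: right_diff_distrib exp_add[symmetric])
    ultimately show ?thesis
      by (simp add: LIM_zero_iff)
  qed
  have "(\<lambda>n. (iexp (a n) * \<phi> n ^ n) * \<zeta> n ^ n) \<longlonglongrightarrow> exp (- of_real (V1 / 2)) * exp (- of_real (V2 / 2))"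
    by (intro tendsto_mult drift LIM_zero_cancel[OF noise])
  moreover have "exp (- of_real (V1 / 2)) * exp (- of_real (V2 / 2)) = complex_of_real (exp (- (V1 + V2) / 2))"
    by (simp add: exp_add[symmetric] exp_of_real[symmetric] add_divide_distrib diff_divide_distrib)
  ultimately show ?thesis
    unfolding factor V a_def by (simp add: mult.assoc)
qed

section \<open>Averaged stochastic gradient iterates\<close>

lemma sgd_iterate_measurable:
  fixes F :: "real ^ 'p \<Rightarrow> 'x \<Rightarrow> real"
    and T :: "nat \<Rightarrow> (nat \<Rightarrow> 'x) \<times> (real ^ 'p) \<times> (nat \<Rightarrow> real ^ 'p) \<Rightarrow> real ^ 'p"
  assumes F: "\<And>t. F t \<in> borel_measurable X"
    and diff: "\<And>x t. x \<in> space X \<Longrightarrow> (\<lambda>s. F s x) differentiable (at t)"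
    and P: "sets P = sets X" and \<nu>: "sets \<nu> = sets borel" and Q: "sets Q = sets borel"
    and init: "\<And>x t z. T 1 (x, t, z) = t"
    and step: "\<And>i x t z. 1 \<le> i \<Longrightarrow>
      T (i + 1) (x, t, z) = T i (x, t, z) - \<eta> i *\<^sub>R (grad (\<lambda>s. F s (x i)) (T i (x, t, z)) + z i)"
    and i: "1 \<le> i"
  shows "T i \<in> borel_measurable (sampling P \<nu> Q)"
  using i
proof (induction i rule: dec_induct)
  have [measurable_cong]: "sets P = sets X" "sets \<nu> = sets borel" "sets Q = sets borel"
    by fact+
  case base
  have "T 1 = (\<lambda>\<omega>. fst (snd \<omega>))"
    using init by auto
  then show ?case
    by (simp add: sampling_def)
next
  have [measurable_cong]: "sets P = sets X" "sets \<nu> = sets borel" "sets Q = sets borel"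
    by fact+
  case (step i)
  then have [measurable]: "T i \<in> borel_measurable (PiM UNIV (\<lambda>_. P) \<Otimes>\<^sub>M (\<nu> \<Otimes>\<^sub>M PiM UNIV (\<lambda>_. Q)))"
    by (simp add: sampling_def)
  have G: "(\<lambda>\<omega>. grad (\<lambda>s. F s (fst \<omega> i)) (T i \<omega>))
      \<in> borel_measurable (PiM UNIV (\<lambda>_. P) \<Otimes>\<^sub>M (\<nu> \<Otimes>\<^sub>M PiM UNIV (\<lambda>_. Q)))"
    using measurable_compose[OF _ measurable_grad[OF F diff],
        of "\<lambda>\<omega>. (T i \<omega>, fst \<omega> i)" "PiM UNIV (\<lambda>_. P) \<Otimes>\<^sub>M (\<nu> \<Otimes>\<^sub>M PiM UNIV (\<lambda>_. Q))"] by simp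
  have "T (Suc i) = (\<lambda>\<omega>. T i \<omega> - \<eta> i *\<^sub>R (grad (\<lambda>s. F s (fst \<omega> i)) (T i \<omega>) + snd (snd \<omega>) i))"
    using assms(7)[OF step(1)] by auto
  then show ?case
    unfolding sampling_def using G by simp
qed

text \<open>The \<open>i\<close>-th iterate has seen only the first \<open>i - 1\<close> observations, so contiguity of finitely many observations is
  enough to transfer the remainder.\<close>

lemma sgd_iterate_adapted:
  assumes init: "\<And>x t z. T (1::nat) (x, t, z) = t"
    and step: "\<And>i x t z. 1 \<le> i \<Longrightarrow>
      T (i + 1) (x, t, z) = T i (x, t, z) - \<eta> i *\<^sub>R (G (x i) (T i (x, t, z)) + (z i :: 'b :: real_vector))"
    and i: "1 \<le> i" and eq: "\<And>j. j \<in> {1..<i} \<Longrightarrow> x j = x' j"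
  shows "T i (x, t, z) = T i (x', t, z)"
  using i eq
proof (induction i rule: dec_induct)
  case base
  show ?case
    by (simp only: init)
next
  case (step i)
  then show ?case
    using assms(2)[OF step(1)] by simp
qed

text \<open>Regularity is an expansion at 0 with error \<open>o(\<parallel>h\<parallel>)\<close>. At \<open>h = k\<^sub>n\<close> the error stays negligible after multiplication with
  \<open>\<surd>n\<close>, because \<open>\<surd>n \<parallel>k\<^sub>n\<parallel>\<close> is bounded.\<close>

lemma (in local_alternatives) regular_parameter_expansion:
  assumes "regular_parameter loss P g \<theta>"
  shows "(\<lambda>n. sqrt (real n) *\<^sub>R (\<theta> (k n) - \<theta> 0)
    + matrix_inv (hessian (risk loss (P 0)) (\<theta> 0)) *v
      (cov_matrix (P 0) (\<lambda>x. grad (\<lambda>t. loss t x) (\<theta> 0)) g *v (sqrt (real n) *\<^sub>R k n))) \<longlonglongrightarrow> 0"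
proof -
  define A where "A h = matrix_inv (hessian (risk loss (P 0)) (\<theta> 0)) *v
      (cov_matrix (P 0) (\<lambda>x. grad (\<lambda>t. loss t x) (\<theta> 0)) g *v h)" for h
  have A_scale: "A (r *\<^sub>R h) = r *\<^sub>R A h" for r h
    by (simp add: A_def matrix_vector_mult_scaleR)
  have small: "\<exists>\<delta>>0. \<forall>h. norm h < \<delta> \<longrightarrow> norm (\<theta> h - \<theta> 0 + A h) \<le> \<epsilon> * norm h" if \<epsilon>: "\<epsilon> > 0" for \<epsilon>
  proof -
    have "((\<lambda>h. (\<theta> h - (\<theta> 0 - A h)) /\<^sub>R norm h) \<longlongrightarrow> 0) (at 0)"
      using assms by (simp add: regular_parameter_def A_def)
    then have "\<forall>\<^sub>F h in at 0. norm ((\<theta> h - (\<theta> 0 - A h)) /\<^sub>R norm h) < \<epsilon>"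
      using \<epsilon> by (auto dest: tendstoD simp: dist_norm)
    then obtain \<delta> where \<delta>: "\<delta> > 0"
      "\<And>h. h \<noteq> 0 \<Longrightarrow> norm h < \<delta> \<Longrightarrow> norm ((\<theta> h - (\<theta> 0 - A h)) /\<^sub>R norm h) < \<epsilon>"
      by (auto simp: eventually_at dist_norm)
    have "norm (\<theta> h - \<theta> 0 + A h) \<le> \<epsilon> * norm h" if "norm h < \<delta>" for h
    proof (cases "h = 0")
      case True
      then show ?thesis
        by (simp add: A_def)
    next
      case False
      have "norm (\<theta> h - (\<theta> 0 - A h)) = norm ((\<theta> h - (\<theta> 0 - A h)) /\<^sub>R norm h) * norm h"
        using False by simp
      also have "\<dots> \<le> \<epsilon> * norm h"
        using \<delta>(2)[OF False that] by (intro mult_right_mono) auto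
      finally show ?thesis
        by (simp add: algebra_simps)
    qed
    with \<delta>(1) show ?thesis
      by blast
  qed
  have "(\<lambda>n. sqrt (real n) *\<^sub>R (\<theta> (k n) - \<theta> 0) + A (sqrt (real n) *\<^sub>R k n)) \<longlonglongrightarrow> 0"
  proof (rule tendstoI)
    fix e :: real
    assume e: "e > 0"
    define \<epsilon> where "\<epsilon> = e / (c + 1)"
    have \<epsilon>: "\<epsilon> > 0"
      using e c_nonneg by (simp add: \<epsilon>_def)
    obtain \<delta> where \<delta>: "\<delta> > 0" "\<And>h. norm h < \<delta> \<Longrightarrow> norm (\<theta> h - \<theta> 0 + A h) \<le> \<epsilon> * norm h"
      using small[OF \<epsilon>] by blast
    have "\<forall>\<^sub>F n in sequentially. norm (k n) < \<delta>"
      using tendstoD[OF k_tendsto_0 \<delta>(1)] by simp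
    then show "\<forall>\<^sub>F n in sequentially. dist (sqrt (real n) *\<^sub>R (\<theta> (k n) - \<theta> 0) + A (sqrt (real n) *\<^sub>R k n)) 0 < e"
    proof eventually_elim
      case (elim n)
      have "dist (sqrt (real n) *\<^sub>R (\<theta> (k n) - \<theta> 0) + A (sqrt (real n) *\<^sub>R k n)) 0 =
          sqrt (real n) * norm (\<theta> (k n) - \<theta> 0 + A (k n))"
        by (simp add: A_scale scaleR_add_right[symmetric])
      also have "\<dots> \<le> sqrt (real n) * (\<epsilon> * norm (k n))"
        using \<delta>(2)[OF elim] by (intro mult_left_mono) auto
      also have "\<dots> = \<epsilon> * (sqrt (real n) * norm (k n))"
        by simp
      also have "\<dots> \<le> \<epsilon> * c"
        using \<epsilon> by (intro mult_left_mono local_bound) simp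
      also have "\<dots> < \<epsilon> * (c + 1)"
        using \<epsilon> by simp
      also have "\<dots> = e"
        using c_nonneg by (simp add: \<epsilon>_def)
      finally show ?case .
    qed
  qed
  then show ?thesis
    by (simp add: A_def)
qed

lemma (in prob_space) abs_expectation_le:
  fixes f :: "'a \<Rightarrow> real"
  assumes "\<And>x. \<bar>f x\<bar> \<le> B" "f \<in> borel_measurable M"
  shows "\<bar>expectation f\<bar> \<le> B"
proof -
  have int: "integrable M f"
    using assms by (intro integrable_const_bound[of _ B]) auto
  have "\<bar>expectation f\<bar> \<le> (\<integral>x. \<bar>f x\<bar> \<partial>M)"
    by (rule integral_abs_bound)
  also have "\<dots> \<le> (\<integral>x. B \<partial>M)"
    using assms(1) int by (intro integral_mono) auto
  finally show ?thesis
    by (simp add: prob_space)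
qed

text \<open>A selection of near-maximizers is one of the sequences along which convergence is assumed.\<close>

lemma SUP_tendsto_of_selections:
  fixes F :: "nat \<Rightarrow> 'h \<Rightarrow> real"
  assumes ne: "\<And>n. S n \<noteq> {}" and bdd: "\<And>n h. \<bar>F n h\<bar> \<le> B"
    and lim: "\<And>h. (\<And>n. h n \<in> S n) \<Longrightarrow> (\<lambda>n. F n (h n)) \<longlonglongrightarrow> l"
  shows "(\<lambda>n. SUP h\<in>S n. F n h) \<longlonglongrightarrow> l"
proof -
  have above: "bdd_above (F n ` S n)" for n
    using bdd[of n] by (auto intro!: bdd_aboveI[of _ B] simp: abs_le_iff)
  have "\<exists>h\<in>S n. (SUP h\<in>S n. F n h) - inverse (real (Suc n)) < F n h" for n
  proof -
    have "(SUP h\<in>S n. F n h) - inverse (real (Suc n)) < (SUP h\<in>S n. F n h)"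
      by simp
    then show ?thesis
      unfolding less_cSUP_iff[OF ne above] .
  qed
  then obtain h where h: "\<And>n. h n \<in> S n" "\<And>n. (SUP h\<in>S n. F n h) - inverse (real (Suc n)) < F n (h n)"
    by metis
  show ?thesis
  proof (rule tendsto_sandwich)
    show "\<forall>\<^sub>F n in sequentially. F n (h n) \<le> (SUP h\<in>S n. F n h)"
      using h(1) above by (intro always_eventually allI cSUP_upper)
    show "\<forall>\<^sub>F n in sequentially. (SUP h\<in>S n. F n h) \<le> F n (h n) + inverse (real (Suc n))"
    proof (intro always_eventually allI)
      show "(SUP h\<in>S n. F n h) \<le> F n (h n) + inverse (real (Suc n))" for n
        using h(2)[of n] by linarith
    qed
    show "(\<lambda>n. F n (h n)) \<longlonglongrightarrow> l"
      using h(1) by (rule lim)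
    then show "(\<lambda>n. F n (h n) + inverse (real (Suc n))) \<longlonglongrightarrow> l"
      using tendsto_add[OF _ LIMSEQ_inverse_real_of_nat] by fastforce
  qed
qed

theorem proposition5:
  fixes loss :: "real ^ 'p \<Rightarrow> 'x \<Rightarrow> real"
    and \<X> :: "'x measure"
    and \<P> :: "'x measure set"
    and P :: "real ^ 'd \<Rightarrow> 'x measure"
    and g :: "'x \<Rightarrow> real ^ 'd"
    and \<Theta> :: "(real ^ 'p) set"
    and \<theta> :: "real ^ 'd \<Rightarrow> real ^ 'p"
    and \<nu> Q :: "(real ^ 'p) measure"
    and \<eta>\<^sub>0 \<beta> :: real
    and T :: "nat \<Rightarrow> (nat \<Rightarrow> 'x) \<times> (real ^ 'p) \<times> (nat \<Rightarrow> real ^ 'p) \<Rightarrow> real ^ 'p"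
    and N :: "'z measure"
    and Z :: "'z \<Rightarrow> real ^ 'p"
  assumes model: "\<And>P'. P' \<in> \<P> \<Longrightarrow> prob_space P' \<and> sets P' = sets \<X>"
    and loss_measurable: "\<And>t. loss t \<in> borel_measurable \<X>"
    and loss_convex: "\<And>x. x \<in> space \<X> \<Longrightarrow> convex_on UNIV (\<lambda>t. loss t x)"
    and loss_differentiable: "\<And>x t. x \<in> space \<X> \<Longrightarrow> (\<lambda>s. loss s x) differentiable (at t)"
    and loss_integrable: "\<And>P' t. P' \<in> \<P> \<Longrightarrow> integrable P' (loss t)"
    and submodel: "\<And>h. P h \<in> \<P>"
    and qmd: "qmd_at_zero P g"
    and minimizer_0: "is_arg_min (risk loss (P 0)) (\<lambda>t. True) (\<theta> 0)"
    and minimizer: "\<And>h. is_arg_min (risk loss (P h)) (\<lambda>t. t \<in> \<Theta>) (\<theta> h)"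
    and risk_smooth: "twice_differentiable_at (risk loss (P 0)) (\<theta> 0)"
    and hessian_invertible: "invertible (hessian (risk loss (P 0)) (\<theta> 0))"
    and grad_square_integrable: "integrable (P 0) (\<lambda>x. (norm (grad (\<lambda>t. loss t x) (\<theta> 0)))\<^sup>2)"
    and regular: "regular_parameter loss P g \<theta>"
    and init_law: "prob_space \<nu>" "sets \<nu> = sets borel"
    and noise_law: "prob_space Q" "sets Q = sets borel"
    and noise_square_integrable: "integrable Q (\<lambda>z. (norm z)\<^sup>2)"
    and noise_mean_zero: "(\<integral>z. z \<partial>Q) = 0"
    and step_sizes: "1 / 2 < \<beta>" "\<beta> < 1" "0 < \<eta>\<^sub>0"
    and iterate_init: "\<And>x t z. T 1 (x, t, z) = t"
    and iterate_step: "\<And>i x t z. 1 \<le> i \<Longrightarrow>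
      T (i + 1) (x, t, z) = T i (x, t, z)
        - (\<eta>\<^sub>0 * real i powr (- \<beta>)) *\<^sub>R (grad (\<lambda>s. loss s (x i)) (T i (x, t, z)) + z i)"
    and asymptotically_linear: "conv_in_prob_zero (sampling (P 0) \<nu> Q)
      (\<lambda>n (x, t, z).
         (1 / sqrt (real n)) *\<^sub>R (\<Sum>i=1..n. (T i (x, t, z) - \<theta> 0))
         - (- ((1 / sqrt (real n)) *\<^sub>R
              (\<Sum>i=1..n. matrix_inv (hessian (risk loss (P 0)) (\<theta> 0)) *v
                          (grad (\<lambda>s. loss s (x i)) (\<theta> 0) + z i)))))"
    and limit_space: "prob_space N"
    and limit_measurable: "Z \<in> borel_measurable N"
    and limit_gaussian: "gaussian_law 0
      (matrix_inv (hessian (risk loss (P 0)) (\<theta> 0))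
        ** (cov_matrix (P 0) (\<lambda>x. grad (\<lambda>t. loss t x) (\<theta> 0)) (\<lambda>x. grad (\<lambda>t. loss t x) (\<theta> 0))
            + cov_matrix Q (\<lambda>z. z) (\<lambda>z. z))
        ** matrix_inv (hessian (risk loss (P 0)) (\<theta> 0)))
      (distr N borel Z)"
  shows "(\<forall>h :: nat \<Rightarrow> real ^ 'd. bounded (range h) \<longrightarrow>
            conv_in_distribution
              (\<lambda>n. sampling (P (h n /\<^sub>R sqrt (real n))) \<nu> Q)
              (\<lambda>n \<omega>. sqrt (real n) *\<^sub>R (iterate_mean T n \<omega> - \<theta> (h n /\<^sub>R sqrt (real n))))
              N Z) \<and>
         (\<forall>(L :: real ^ 'p \<Rightarrow> real) (c :: real).
            continuous_on UNIV L \<longrightarrow> bounded (range L) \<longrightarrow> (\<forall>y. 0 \<le> L y) \<longrightarrow> 0 \<le> c \<longrightarrow>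
            (\<lambda>n. SUP h\<in>{h. norm h \<le> c / sqrt (real n)}.
                   \<integral>\<omega>. L (sqrt (real n) *\<^sub>R (iterate_mean T n \<omega> - \<theta> h))
                     \<partial>sampling (P h) \<nu> Q)
              \<longlonglongrightarrow> (\<integral>z. L (Z z) \<partial>N))"
proof -
  let ?\<psi> = "\<lambda>x. grad (\<lambda>t. loss t x) (\<theta> 0)"
  let ?H = "matrix_inv (hessian (risk loss (P 0)) (\<theta> 0))"
  have P: "prob_space (P h)" "sets (P h) = sets \<X>" for h
    using model[OF submodel] by auto
  have space_P: "space (P h) = space \<X>" for h
    using P(2) by (rule sets_eq_imp_space_eq)
  interpret qmd_model P g
    by (rule qmd_model.intro[OF P(1) _ qmd]) (simp only: P(2))
  have \<psi>[measurable]: "?\<psi> \<in> borel_measurable (P h)" for h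
  proof -
    have "(\<lambda>x. (\<theta> 0, x)) \<in> measurable \<X> (borel \<Otimes>\<^sub>M \<X>)"
      by measurable
    from measurable_compose[OF this measurable_grad[OF loss_measurable loss_differentiable]]
    show ?thesis
      using P(2)[of h] by (simp cong: measurable_cong_sets)
  qed
  have \<psi>0: "(\<integral>x. v \<bullet> ?\<psi> x \<partial>P 0) = 0" for v
  proof (rule expected_gradient_at_minimizer)
    show "(\<integral>x. loss (\<theta> 0) x \<partial>P 0) \<le> (\<integral>x. loss t x \<partial>P 0)" for t
      using minimizer_0 by (auto simp: is_arg_min_linorder risk_def)
  qed (use loss_integrable[OF submodel] loss_convex loss_differentiable space_P in auto)
  have H_sym: "t \<bullet> (?H *v y) = (?H *v t) \<bullet> y" for t y
  proof -
    have "transpose ?H = ?H"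
      by (rule transpose_matrix_inv[OF hessian_invertible transpose_hessian[OF risk_smooth]])
    then show ?thesis
      by (metis dot_lmul_matrix transpose_matrix_vector)
  qed

  define Y where "Y n h \<omega> = sqrt (real n) *\<^sub>R (iterate_mean T n \<omega> - \<theta> h)" for n h \<omega>
  have T_meas: "T i \<in> borel_measurable (sampling (P h) \<nu> Q)" if "1 \<le> i" for i h
    using sgd_iterate_measurable[OF loss_measurable loss_differentiable P(2) init_law(2) noise_law(2) iterate_init iterate_step that] .
  have Y_meas: "Y n h' \<in> borel_measurable (sampling (P h) \<nu> Q)" for n h h'
    unfolding Y_def iterate_mean_def
    by (intro borel_measurable_scaleR borel_measurable_diff borel_measurable_const borel_measurable_sum T_meas) auto

  have main: "conv_in_distribution (\<lambda>n. sampling (P (k n)) \<nu> Q) (\<lambda>n. Y n (k n)) N Z"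
    if k: "\<And>n. sqrt (real n) * norm (k n) \<le> c" for k c
  proof (rule levy_continuity_euclidean)
    interpret local_alternatives P g k c
      using k by unfold_locales
    let ?M = "\<lambda>n. sampling (P (k n)) \<nu> Q"
    have M: "prob_space (?M n)" for n
      by (intro prob_space_sampling P init_law noise_law)
    show "prob_space (?M n)" for n by (rule M)
    show "Y n (k n) \<in> borel_measurable (?M n)" for n by (rule Y_meas)
    show "prob_space N" "Z \<in> borel_measurable N" by fact+
    define C where "C = cov_matrix (P 0) ?\<psi> g"
    define lin where "lin n \<omega> = (1 / sqrt (real n)) *\<^sub>R (\<Sum>i=1..n. ?H *v (?\<psi> (fst \<omega> i) + snd (snd \<omega>) i))"
      for n and \<omega> :: "(nat \<Rightarrow> 'x) \<times> (real ^ 'p) \<times> (nat \<Rightarrow> real ^ 'p)"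
    define R where "R n \<omega> = (1 / sqrt (real n)) *\<^sub>R (\<Sum>i=1..n. (T i \<omega> - \<theta> 0)) - (- lin n \<omega>)" for n \<omega>
    \<comment> \<open>tends to 0 by regularity: the parameter follows the drift of \<open>- lin n\<close>\<close>
    define d where "d n = sqrt (real n) *\<^sub>R (\<theta> (k n) - \<theta> 0) + ?H *v (C *v (sqrt (real n) *\<^sub>R k n))" for n
    \<comment> \<open>\<open>- lin n\<close> with its drift removed, which approximates \<open>Y n (k n)\<close>\<close>
    define W where "W n \<omega> = ?H *v (C *v (sqrt (real n) *\<^sub>R k n)) - lin n \<omega>" for n \<omega>
    have lin_meas: "lin n \<in> borel_measurable (sampling (P h) \<nu> Q)" for n h
    proof -
      have [measurable_cong]: "sets Q = sets borel"
        by fact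
      have [measurable]: "(*v) ?H \<in> borel_measurable borel"
        by (intro borel_measurable_continuous_onI matrix_vector_mult_linear_continuous_on)
      have "(\<lambda>\<omega>. ?H *v (?\<psi> (fst \<omega> i) + snd (snd \<omega>) i)) \<in> borel_measurable (sampling (P h) \<nu> Q)" for i
        unfolding sampling_def using \<psi>[of h]
        by (intro measurable_compose[OF _ \<open>(*v) ?H \<in> borel_measurable borel\<close>]) measurable
      then show ?thesis
        unfolding lin_def by (intro borel_measurable_scaleR borel_measurable_const borel_measurable_sum)
    qed
    have R_meas: "R n \<in> borel_measurable (sampling (P h) \<nu> Q)" for n h
      unfolding R_def
      by (intro borel_measurable_scaleR borel_measurable_diff borel_measurable_const borel_measurable_sum T_meas
          borel_measurable_uminus lin_meas) auto
    have W_meas: "W n \<in> borel_measurable (sampling (P h) \<nu> Q)" for n h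
      unfolding W_def by (intro borel_measurable_diff borel_measurable_const lin_meas)
    have d: "d \<longlonglongrightarrow> 0"
      using regular_parameter_expansion[OF regular] by (simp add: d_def[abs_def] C_def)
    have YWR: "Y n (k n) \<omega> - W n \<omega> = R n \<omega> - d n" if "1 \<le> n" for n \<omega>
    proof -
      let ?r = "sqrt (real n)"
      have r: "?r * (1 / real n) = 1 / ?r" "1 / ?r * real n = ?r"
        using that by (simp_all add: field_simps)
      have "(1 / ?r) *\<^sub>R (\<Sum>i=1..n. (T i \<omega> - \<theta> 0)) = (1 / ?r) *\<^sub>R (\<Sum>i=1..n. T i \<omega>) - (1 / ?r * real n) *\<^sub>R \<theta> 0"
        by (simp add: sum_subtractf scaleR_diff_right sum_constant_scaleR del: sum_constant)
      moreover have "Y n (k n) \<omega> = (?r * (1 / real n)) *\<^sub>R (\<Sum>i=1..n. T i \<omega>) - ?r *\<^sub>R \<theta> (k n)"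
        by (simp add: Y_def iterate_mean_def scaleR_diff_right)
      ultimately show ?thesis
        unfolding R_def d_def W_def r by (simp add: scaleR_diff_right)
    qed

    have R0: "(\<lambda>n. measure (sampling (P 0) \<nu> Q) {\<omega>\<in>space (sampling (P 0) \<nu> Q). norm (R n \<omega>) > \<epsilon>}) \<longlonglongrightarrow> 0"
      if "\<epsilon> > 0" for \<epsilon>
    proof -
      have "R n = (\<lambda>(x, t, z). (1 / sqrt (real n)) *\<^sub>R (\<Sum>i=1..n. (T i (x, t, z) - \<theta> 0))
         - (- ((1 / sqrt (real n)) *\<^sub>R
              (\<Sum>i=1..n. ?H *v (grad (\<lambda>s. loss s (x i)) (\<theta> 0) + z i)))))" for n
        by (auto simp: R_def lin_def)
      then show ?thesis
        using asymptotically_linear that unfolding conv_in_prob_zero_def by simp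
    qed
    have R1: "(\<lambda>n. measure (?M n) {\<omega>\<in>space (?M n). norm (R n \<omega>) > \<epsilon>}) \<longlonglongrightarrow> 0"
      if \<epsilon>: "\<epsilon> > 0" for \<epsilon>
    proof -
      define A where "A n = {\<omega>\<in>space (sampling (P 0) \<nu> Q). norm (R n \<omega>) > \<epsilon>}" for n
      have "(\<lambda>n. measure (?M n) (A n)) \<longlonglongrightarrow> 0"
      proof (rule sampling_contiguity[OF init_law(1) noise_law(1)])
        show "A n \<in> sets (sampling (P 0) \<nu> Q)" for n
          unfolding A_def using R_meas[of n 0] by measurable
        show "(\<lambda>n. measure (sampling (P 0) \<nu> Q) (A n)) \<longlonglongrightarrow> 0"
          unfolding A_def by (rule R0[OF \<epsilon>])
        fix n and x x' :: "nat \<Rightarrow> 'x" and y :: "(real ^ 'p) \<times> (nat \<Rightarrow> real ^ 'p)"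
        assume eq: "\<And>i. i \<in> {1..n} \<Longrightarrow> x i = x' i" and x': "(x', y) \<in> space (sampling (P 0) \<nu> Q)"
          and A: "(x, y) \<in> A n"
        obtain t z where y: "y = (t, z)"
          by (cases y)
        have "T i (x, y) = T i (x', y)" if "i \<in> {1..n}" for i
          unfolding y using that eq
          by (intro sgd_iterate_adapted[OF iterate_init iterate_step]) auto
        moreover have "lin n (x, y) = lin n (x', y)"
          unfolding lin_def using eq by simp
        ultimately have "R n (x, y) = R n (x', y)"
          by (simp add: R_def)
        with A x' show "(x', y) \<in> A n"
          by (simp add: A_def)
      qed
      moreover have "space (?M n) = space (sampling (P 0) \<nu> Q)" for n
        by (intro sets_eq_imp_space_eq sets_sampling_cong sets_P refl)
      ultimately show ?thesis
        by (simp add: A_def)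
    qed
    have close: "(\<lambda>n. measure (?M n) {\<omega>\<in>space (?M n). norm (Y n (k n) \<omega> - W n \<omega>) > \<epsilon>}) \<longlonglongrightarrow> 0"
      if \<epsilon>: "\<epsilon> > 0" for \<epsilon>
    proof (rule Lim_null_comparison)
      show "(\<lambda>n. measure (?M n) {\<omega>\<in>space (?M n). norm (R n \<omega>) > \<epsilon> / 2}) \<longlonglongrightarrow> 0"
        using \<epsilon> by (intro R1) simp
      have "\<forall>\<^sub>F n in sequentially. norm (d n) < \<epsilon> / 2"
        using tendstoD[OF d, of "\<epsilon> / 2"] \<epsilon> by simp
      then show "\<forall>\<^sub>F n in sequentially. norm (measure (?M n) {\<omega>\<in>space (?M n). norm (Y n (k n) \<omega> - W n \<omega>) > \<epsilon>})
          \<le> measure (?M n) {\<omega>\<in>space (?M n). norm (R n \<omega>) > \<epsilon> / 2}"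
        using eventually_ge_at_top[of 1]
      proof eventually_elim
        case (elim n)
        interpret M: prob_space "?M n" by (rule M)
        have "M.prob {\<omega>\<in>space (?M n). norm (Y n (k n) \<omega> - W n \<omega>) > \<epsilon>} \<le> M.prob {\<omega>\<in>space (?M n). norm (R n \<omega>) > \<epsilon> / 2}"
        proof (rule M.finite_measure_mono)
          show "{\<omega>\<in>space (?M n). norm (Y n (k n) \<omega> - W n \<omega>) > \<epsilon>} \<subseteq> {\<omega>\<in>space (?M n). norm (R n \<omega>) > \<epsilon> / 2}"
          proof safe
            fix \<omega>
            assume "\<epsilon> < norm (Y n (k n) \<omega> - W n \<omega>)"
            then have "\<epsilon> < norm (R n \<omega> - d n)"
              by (simp add: YWR[OF elim(2)])
            then show "\<epsilon> / 2 < norm (R n \<omega>)"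
              using norm_triangle_ineq4[of "R n \<omega>" "d n"] elim(1) by linarith
          qed
          show "{\<omega>\<in>space (?M n). norm (R n \<omega>) > \<epsilon> / 2} \<in> M.events"
            using R_meas[of n "k n"] by measurable
        qed
        then show ?case
          by simp
      qed
    qed

    fix t :: "real ^ 'p"
    define s where "s = ?H *v t"
    have W_char: "(CLINT \<omega>|?M n. iexp (t \<bullet> W n \<omega>)) =
        iexp (s \<bullet> (C *v (sqrt (real n) *\<^sub>R k n))) *
        (CLINT \<omega>|?M n. iexp (- (1 / sqrt (real n) * (\<Sum>i=1..n. s \<bullet> (?\<psi> (fst \<omega> i) + snd (snd \<omega>) i)))))" for n
    proof -
      have "t \<bullet> W n \<omega> = s \<bullet> (C *v (sqrt (real n) *\<^sub>R k n))
          + - (1 / sqrt (real n) * (\<Sum>i=1..n. s \<bullet> (?\<psi> (fst \<omega> i) + snd (snd \<omega>) i)))" for \<omega>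
        unfolding W_def lin_def s_def
        by (simp only: inner_add_right inner_minus_right inner_scaleR_right inner_sum_right H_sym diff_conv_add_uminus)
      then show ?thesis
        by (simp only: of_real_add distrib_left exp_add integral_mult_right_zero)
    qed
    have "(\<lambda>n. CLINT \<omega>|?M n. iexp (t \<bullet> W n \<omega>)) \<longlonglongrightarrow>
        exp (- (s \<bullet> ((cov_matrix (P 0) ?\<psi> ?\<psi> + cov_matrix Q (\<lambda>z. z) (\<lambda>z. z)) *v s)) / 2)"
      unfolding W_char C_def
      by (intro linear_statistic_char init_law noise_law \<psi> grad_square_integrable \<psi>0 noise_square_integrable
          noise_mean_zero)
    moreover have "(CLINT z|N. iexp (t \<bullet> Z z)) =
        exp (- (s \<bullet> ((cov_matrix (P 0) ?\<psi> ?\<psi> + cov_matrix Q (\<lambda>z. z) (\<lambda>z. z)) *v s)) / 2)"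
    proof -
      have "(CLINT z|N. iexp (t \<bullet> Z z)) = (CLINT y|distr N borel Z. iexp (t \<bullet> y))"
        using limit_measurable by (intro integral_distr[symmetric]) auto
      also have "\<dots> = exp (- (t \<bullet> ((?H ** (cov_matrix (P 0) ?\<psi> ?\<psi> + cov_matrix Q (\<lambda>z. z) (\<lambda>z. z)) ** ?H) *v t)) / 2)"
        using limit_gaussian by (simp add: gaussian_law_def)
      finally show ?thesis
        by (simp add: matrix_vector_mul_assoc[symmetric] H_sym s_def)
    qed
    ultimately have "(\<lambda>n. CLINT \<omega>|?M n. iexp (t \<bullet> W n \<omega>)) \<longlonglongrightarrow> (CLINT z|N. iexp (t \<bullet> Z z))"
      by simp
    from tendsto_add[OF char_diff_tendsto_0[OF M Y_meas W_meas close, of t] this]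
    show "(\<lambda>n. CLINT \<omega>|?M n. iexp (t \<bullet> Y n (k n) \<omega>)) \<longlonglongrightarrow> (CLINT z|N. iexp (t \<bullet> Z z))"
      by simp
  qed

  show ?thesis
  proof (intro conjI allI impI)
    fix h :: "nat \<Rightarrow> real ^ 'd"
    assume "bounded (range h)"
    then obtain c where c: "\<And>n. norm (h n) \<le> c"
      by (auto simp: bounded_iff)
    have "sqrt (real n) * norm (h n /\<^sub>R sqrt (real n)) \<le> c" for n
      using c[of n] order_trans[OF norm_ge_zero c[of n]] by (cases "n = 0") (auto simp: mult.assoc[symmetric])
    from main[OF this]
    show "conv_in_distribution
              (\<lambda>n. sampling (P (h n /\<^sub>R sqrt (real n))) \<nu> Q)
              (\<lambda>n \<omega>. sqrt (real n) *\<^sub>R (iterate_mean T n \<omega> - \<theta> (h n /\<^sub>R sqrt (real n))))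
              N Z"
      by (simp add: Y_def[abs_def])
  next
    fix L :: "real ^ 'p \<Rightarrow> real" and c :: real
    assume L: "continuous_on UNIV L" "bounded (range L)" and c: "0 \<le> c"
    obtain B where B: "\<And>y. \<bar>L y\<bar> \<le> B"
      using L(2) by (auto simp: bounded_iff)
    show "(\<lambda>n. SUP h\<in>{h. norm h \<le> c / sqrt (real n)}.
                   \<integral>\<omega>. L (sqrt (real n) *\<^sub>R (iterate_mean T n \<omega> - \<theta> h))
                     \<partial>sampling (P h) \<nu> Q)
              \<longlonglongrightarrow> (\<integral>z. L (Z z) \<partial>N)"
    proof (rule SUP_tendsto_of_selections)
      show "{h :: real ^ 'd. norm h \<le> c / sqrt (real n)} \<noteq> {}" for n
        using c by (auto intro!: exI[of _ 0])
      show "\<bar>\<integral>\<omega>. L (sqrt (real n) *\<^sub>R (iterate_mean T n \<omega> - \<theta> h)) \<partial>sampling (P h) \<nu> Q\<bar> \<le> B" for n h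
      proof (rule prob_space.abs_expectation_le[OF prob_space_sampling[OF P(1) init_law(1) noise_law(1)]])
        show "(\<lambda>\<omega>. L (sqrt (real n) *\<^sub>R (iterate_mean T n \<omega> - \<theta> h))) \<in> borel_measurable (sampling (P h) \<nu> Q)"
          using measurable_compose[OF Y_meas borel_measurable_continuous_onI[OF L(1)]] by (simp add: Y_def)
      qed (rule B)
      fix k :: "nat \<Rightarrow> real ^ 'd"
      assume "\<And>n. k n \<in> {h. norm h \<le> c / sqrt (real n)}"
      then have k: "norm (k n) \<le> c / sqrt (real n)" for n
        by blast
      have "sqrt (real n) * norm (k n) \<le> c" for n
        using k[of n] c by (cases "n = 0") (auto simp: field_simps)
      from main[OF this] L
      show "(\<lambda>n. \<integral>\<omega>. L (sqrt (real n) *\<^sub>R (iterate_mean T n \<omega> - \<theta> (k n))) \<partial>sampling (P (k n)) \<nu> Q)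
          \<longlonglongrightarrow> (\<integral>z. L (Z z) \<partial>N)"
        by (simp add: conv_in_distribution_def Y_def)
    qed
  qed
qed

end
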